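(* In each of the two cases (L) and (H): let $\Delta\ge 84\,C_\varphi$ and $\kappa\ge1$, and let $\widehat f_w=\sum_{k=1}^{M_n}w_k\widehat f_k$ be the aggregated estimator using either the Bayesian weights $w=\widetilde w$ or the model selection weights $w=\widehat w$. Let $L>0$ and let $\omega=(\omega_k)_{k\in\mathbb{N}}$ be a strictly positive, monotonically non-increasing sequence with $\omega_1\le1$ and $\lim_{k\to\infty}\omega_k=0$, and suppose there is a constant $C_{\omega,L}>0$ such that $1\le L\vee v_f\vee\|f\|_A^2\vee\|f\|_\infty^2\le C_{\omega,L}$ for all $f\in\mathcal{D}^\omega_2(A,L)$. Assume in addition that there is $n_{\omega,L}\in\mathbb{N}$ such that $$M_n^{1/2}\ge(k_n^\star)^{1/2}\ge\frac{400\,C_{\omega,L}}{C_\varphi}\,|\log R_n^\star(\omega)|\qquad\text{for all }n\ge n_{\omega,L}.$$ Then there is a numerical constant $C>0$ such that for all $n\in\mathbb{N}$ (with $M_n$ well defined and $M_n\ge1$) $$\sup_{f\in\mathcal{D}^\omega_2(A,L)}\mathbb{E}^n_f\|\widehat f_w-f\|_A^2\le C\big([n_{\omega,L}\vee C_{\omega,L}]\,R_n^\star(\omega)+C_{\omega,L}^3\,n^{-1}\big).$$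
   Context: Two cases are considered. Case (L): $A=(0,\infty)$, $\varphi_j=\ell_j$ are the Laguerre functions $\ell_j(x)=\sqrt2\,L_j(2x)e^{-x}\mathbf 1_{(0,\infty)}(x)$, $L_j(x)=\sum_{k=0}^j(-1)^k\binom jk\frac{x^k}{k!}$; $\alpha=-1/2$, $d=1$, $M_n=\lfloor n^2(600\log n)^{-4}\rfloor$. Case (H): $A=\mathbb{R}$, $\varphi_j=h_j$ are the Hermite functions $h_j(x)=(2^jj!\sqrt\pi)^{-1/2}H_j(x)e^{-x^2/2}$, $H_j(x)=(-1)^je^{x^2}\frac{d^j}{dx^j}e^{-x^2}$; $\alpha=2/3$, $d=10/12$, $M_n=n^2$. In each case $(\varphi_j)_{j\ge0}$ is an orthonormal basis of $L^2(A)$ with usual inner product $\langle\cdot,\cdot\rangle_A$ and norm $\|\cdot\|_A$; $\|\cdot\|_\infty$ is the sup norm; $a\vee b=\max(a,b)$. $X_1,\dots,X_n$ are i.i.d. with probability density $f\in L^2(A)$ supported in $A$; $\mathbb{E}_f$, $\mathbb{E}_f^n$ denote expectation under the marginal and joint law. Put $a_j(f)=\langle f,\varphi_j\rangle_A$, $v_f=\mathbb{E}_f(|X_1|^{\alpha})+1$, $\widehat v=1+\frac1n\sum_{i=1}^n|X_i|^\alpha$. For $\omega=(\omega_k)_{k\in\mathbb{N}}$ strictly positive and $L>0$, $$\mathcal{D}^{\omega}_{2}(A,L):=\Big\{f\in L^2(A): f\text{ is a probability density},\ \sum_{k\in\mathbb{N}}|a_k(f)|^2/\omega_k\le L,\ \mathbb{E}_f(|X_1|^{2\alpha})\le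 L\Big\}.$$ Put $R_n^k(\omega)=\omega_k\vee n^{-1}k^{1/2}$, $R_n^\star(\omega)=\min_{k\in\mathbb{N}}R_n^k(\omega)$, and let $k_n^\star$ be the smallest $k\in\mathbb{N}$ with $R_n^k(\omega)=R_n^\star(\omega)$. $C_\varphi\ge1$ is a fixed numerical constant such that for all $k\in\mathbb{N}$ (and all densities $f$): $\|\sum_{j=0}^{k-1}\varphi_j^2\|_\infty\le C_\varphi k^{d}$ and $\sum_{j=0}^{k-1}\mathbb{E}_f(\varphi_j^2(X_1))\le C_\varphi v_fk^{1/2}$. Orthogonal series estimators: $\widehat f_k=\sum_{j=0}^{k-1}\widehat a_j\varphi_j$, $\widehat a_j=\frac1n\sum_{i=1}^n\varphi_j(X_i)$. Penalties: $\widehat{\mathrm{pen}}_k=\Delta\,\widehat v\,k^{1/2}n^{-1}$. Bayesian weights: $$\widetilde w_k=\frac{\exp(-\kappa n\{-\|\widehat f_k\|_A^2+\widehat{\mathrm{pen}}_k\})}{\sum_{l=1}^{M_n}\exp(-\kappa n\{-\|\widehat f_l\|_A^2+\widehat{\mathrm{pen}}_l\})},\quad 1\le k\le M_n.$$ Model selection weights: $\widehat w_k=\mathbf 1\{k=\widehat k\}$, where $\widehat k$ is the smallest minimiser of $k\mapsto-\|\widehat f_k\|_A^2+\widehat{\mathrm{pen}}_k$ over $\{1,\dots,M_n\}$. $\Delta$ and $\kappa$ are fixed numerical constants; a "numerical constant" depends neither on $f$, $n$, $\omega$ nor $L$. *)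

theory Defs
  imports "HOL-Probability.Probability"
begin

datatype basis_case = Laguerre | Hermite

fun supp :: "basis_case \<Rightarrow> real set" where
  "supp Laguerre = {0<..}"
| "supp Hermite = UNIV"

fun alpha :: "basis_case \<Rightarrow> real" where
  "alpha Laguerre = - 1 / 2"
| "alpha Hermite = 2 / 3"

fun dexp :: "basis_case \<Rightarrow> real" where
  "dexp Laguerre = 1"
| "dexp Hermite = 10 / 12"

text \<open>In the Laguerre case division by zero gives \<open>max_dim Laguerre 1 = 0\<close>, so the requirement
  \<open>max_dim c n \<ge> 1\<close> excludes the sample size for which the expression is undefined.\<close>

fun max_dim :: "basis_case \<Rightarrow> nat \<Rightarrow> nat" where
  "max_dim Laguerre n = nat \<lfloor>(real n)\<^sup>2 / (600 * ln (real n)) ^ 4\<rfloor>"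
| "max_dim Hermite n = n\<^sup>2"

definition laguerre_poly :: "nat \<Rightarrow> real \<Rightarrow> real" where
  "laguerre_poly j x = (\<Sum>k\<le>j. (- 1) ^ k * real (j choose k) * (x ^ k / fact k))"

definition laguerre_fun :: "nat \<Rightarrow> real \<Rightarrow> real" where
  "laguerre_fun j x = sqrt 2 * laguerre_poly j (2 * x) * exp (- x) * indicator {0<..} x"

definition hermite_poly :: "nat \<Rightarrow> real \<Rightarrow> real" where
  "hermite_poly j x = (- 1) ^ j * exp (x\<^sup>2) * (deriv ^^ j) (\<lambda>y. exp (- (y\<^sup>2))) x"

definition hermite_fun :: "nat \<Rightarrow> real \<Rightarrow> real" where
  "hermite_fun j x = (1 / sqrt (2 ^ j * fact j * sqrt pi)) * hermite_poly j x * exp (- (x\<^sup>2) / 2)"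

fun phi :: "basis_case \<Rightarrow> nat \<Rightarrow> real \<Rightarrow> real" where
  "phi Laguerre = laguerre_fun"
| "phi Hermite = hermite_fun"

definition l2_inner :: "real set \<Rightarrow> (real \<Rightarrow> real) \<Rightarrow> (real \<Rightarrow> real) \<Rightarrow> real" where
  "l2_inner A g h = (LINT x:A|lborel. g x * h x)"

definition l2_norm :: "real set \<Rightarrow> (real \<Rightarrow> real) \<Rightarrow> real" where
  "l2_norm A g = sqrt (l2_inner A g g)"

text \<open>Elements of \<open>L\<^sup>2(A)\<close> are defined only up to null sets, so their sup norm is the essential
  supremum; for functions that are continuous on \<open>A\<close> it is the pointwise supremum over \<open>A\<close>.\<close>

definition linf_norm :: "real set \<Rightarrow> (real \<Rightarrow> real) \<Rightarrow> ennreal" where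
  "linf_norm A g = esssup lborel (\<lambda>x. ennreal (\<bar>g x\<bar> * indicator A x))"

definition l2_density :: "real set \<Rightarrow> (real \<Rightarrow> real) \<Rightarrow> bool" where
  "l2_density A f \<longleftrightarrow>
     f \<in> borel_measurable borel \<and> (\<forall>x. f x \<ge> 0) \<and> (\<forall>x. x \<notin> A \<longrightarrow> f x = 0) \<and>
     (\<integral>\<^sup>+x. ennreal (f x) \<partial>lborel) = 1 \<and> set_integrable lborel A (\<lambda>x. (f x)\<^sup>2)"

definition law :: "(real \<Rightarrow> real) \<Rightarrow> real measure" where
  "law f = density lborel (\<lambda>x. ennreal (f x))"

definition joint_law :: "nat \<Rightarrow> (real \<Rightarrow> real) \<Rightarrow> (nat \<Rightarrow> real) measure" where
  "joint_law n f = PiM {1..n} (\<lambda>_. law f)"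

definition coef :: "basis_case \<Rightarrow> (real \<Rightarrow> real) \<Rightarrow> nat \<Rightarrow> real" where
  "coef c f j = l2_inner (supp c) f (phi c j)"

definition moment :: "real \<Rightarrow> (real \<Rightarrow> real) \<Rightarrow> ennreal" where
  "moment a f = (\<integral>\<^sup>+x. ennreal (\<bar>x\<bar> powr a) \<partial>law f)"

definition vf :: "basis_case \<Rightarrow> (real \<Rightarrow> real) \<Rightarrow> ennreal" where
  "vf c f = moment (alpha c) f + 1"

text \<open>The index set of \<open>\<omega>\<close> is \<open>{1, 2, \<dots>}\<close>: the value \<open>\<omega> 0\<close> is never used, and the ellipsoid
  does not constrain the coefficient of \<open>phi c 0\<close>.\<close>

definition density_class :: "basis_case \<Rightarrow> (nat \<Rightarrow> real) \<Rightarrow> real \<Rightarrow> (real \<Rightarrow> real) set" where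
  "density_class c \<omega> L =
     {f. l2_density (supp c) f \<and>
         (\<Sum>\<^sub>\<infinity>k\<in>{1..}. ennreal (\<bar>coef c f k\<bar>\<^sup>2 / \<omega> k)) \<le> ennreal L \<and>
         moment (2 * alpha c) f \<le> ennreal L}"

definition rate_at :: "(nat \<Rightarrow> real) \<Rightarrow> nat \<Rightarrow> nat \<Rightarrow> real" where
  "rate_at \<omega> n k = max (\<omega> k) (sqrt (real k) / real n)"

text \<open>For \<open>n \<ge> 1\<close> and positive \<open>\<omega>\<close> tending to zero the infimum is attained, i.e. it is the minimum,
  because \<open>rate_at \<omega> n k\<close> tends to infinity with \<open>k\<close>.\<close>

definition opt_rate :: "(nat \<Rightarrow> real) \<Rightarrow> nat \<Rightarrow> real" where
  "opt_rate \<omega> n = (INF k\<in>{1..}. rate_at \<omega> n k)"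

definition opt_dim :: "(nat \<Rightarrow> real) \<Rightarrow> nat \<Rightarrow> nat" where
  "opt_dim \<omega> n = (LEAST k. k \<ge> 1 \<and> rate_at \<omega> n k = opt_rate \<omega> n)"

definition basis_const :: "basis_case \<Rightarrow> real \<Rightarrow> bool" where
  "basis_const c C\<phi> \<longleftrightarrow>
     C\<phi> \<ge> 1 \<and>
     (\<forall>k\<ge>1. linf_norm (supp c) (\<lambda>x. \<Sum>j<k. (phi c j x)\<^sup>2) \<le> ennreal (C\<phi> * real k powr dexp c)) \<and>
     (\<forall>f. l2_density (supp c) f \<longrightarrow>
        (\<forall>k\<ge>1. (\<Sum>j<k. \<integral>\<^sup>+x. ennreal ((phi c j x)\<^sup>2) \<partial>law f)
               \<le> ennreal C\<phi> * vf c f * ennreal (sqrt (real k))))"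

text \<open>Below, \<open>X\<close> is the sample, of which only \<open>X 1, \<dots>, X n\<close> are used.\<close>

definition coef_est :: "basis_case \<Rightarrow> nat \<Rightarrow> (nat \<Rightarrow> real) \<Rightarrow> nat \<Rightarrow> real" where
  "coef_est c n X j = (1 / real n) * (\<Sum>i=1..n. phi c j (X i))"

definition series_est :: "basis_case \<Rightarrow> nat \<Rightarrow> (nat \<Rightarrow> real) \<Rightarrow> nat \<Rightarrow> real \<Rightarrow> real" where
  "series_est c n X k x = (\<Sum>j<k. coef_est c n X j * phi c j x)"

definition v_est :: "basis_case \<Rightarrow> nat \<Rightarrow> (nat \<Rightarrow> real) \<Rightarrow> real" where
  "v_est c n X = 1 + (1 / real n) * (\<Sum>i=1..n. \<bar>X i\<bar> powr alpha c)"

definition pen_est :: "basis_case \<Rightarrow> real \<Rightarrow> nat \<Rightarrow> (nat \<Rightarrow> real) \<Rightarrow> nat \<Rightarrow> real" where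
  "pen_est c \<Delta> n X k = \<Delta> * v_est c n X * sqrt (real k) / real n"

definition contrast :: "basis_case \<Rightarrow> real \<Rightarrow> nat \<Rightarrow> (nat \<Rightarrow> real) \<Rightarrow> nat \<Rightarrow> real" where
  "contrast c \<Delta> n X k = - (l2_norm (supp c) (series_est c n X k))\<^sup>2 + pen_est c \<Delta> n X k"

definition selected_dim :: "basis_case \<Rightarrow> real \<Rightarrow> nat \<Rightarrow> (nat \<Rightarrow> real) \<Rightarrow> nat" where
  "selected_dim c \<Delta> n X =
     (LEAST k. k \<in> {1..max_dim c n} \<and>
        (\<forall>l\<in>{1..max_dim c n}. contrast c \<Delta> n X k \<le> contrast c \<Delta> n X l))"

datatype weighting = Bayesian | Model_Selection

fun weight ::
  "weighting \<Rightarrow> basis_case \<Rightarrow> real \<Rightarrow> real \<Rightarrow> nat \<Rightarrow> (nat \<Rightarrow> real) \<Rightarrow> nat \<Rightarrow> real" where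
  "weight Bayesian c \<Delta> \<kappa> n X k =
     exp (- \<kappa> * real n * contrast c \<Delta> n X k) /
     (\<Sum>l=1..max_dim c n. exp (- \<kappa> * real n * contrast c \<Delta> n X l))"
| "weight Model_Selection c \<Delta> \<kappa> n X k = (if k = selected_dim c \<Delta> n X then 1 else 0)"

definition aggregated_est ::
  "weighting \<Rightarrow> basis_case \<Rightarrow> real \<Rightarrow> real \<Rightarrow> nat \<Rightarrow> (nat \<Rightarrow> real) \<Rightarrow> real \<Rightarrow> real" where
  "aggregated_est w c \<Delta> \<kappa> n X x =
     (\<Sum>k=1..max_dim c n. weight w c \<Delta> \<kappa> n X k * series_est c n X k x)"

definition risk ::
  "weighting \<Rightarrow> basis_case \<Rightarrow> real \<Rightarrow> real \<Rightarrow> nat \<Rightarrow> (real \<Rightarrow> real) \<Rightarrow> ennreal" where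
  "risk w c \<Delta> \<kappa> n f =
     (\<integral>\<^sup>+X. ennreal ((l2_norm (supp c) (\<lambda>x. aggregated_est w c \<Delta> \<kappa> n X x - f x))\<^sup>2)
        \<partial>joint_law n f)"

definition magnitude :: "basis_case \<Rightarrow> real \<Rightarrow> (real \<Rightarrow> real) \<Rightarrow> ennreal" where
  "magnitude c L f =
     max (ennreal L) (max (vf c f)
       (max (ennreal ((l2_norm (supp c) f)\<^sup>2)) ((linf_norm (supp c) f)\<^sup>2)))"

end

theory Submission
  imports Defs
begin

text \<open>
  Let \<open>Z k\<close> be the squared distance of the estimated to the true first \<open>k\<close> coefficients. Concentration of
  \<open>Z k\<close> above its mean does not require Talagrand's inequality, because a Hilbert norm is smooth: with
  \<open>N s = sqrt (a\<^sup>2 + \<bar>s\<bar>\<^sup>2)\<close> one has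
  \<open>N (s + y) \<le> N s + \<langle>s, y\<rangle> / N s + \<bar>y\<bar>\<^sup>2 / (2 * a)\<close>, so the exponential moment of \<open>N\<close> of a sum is bounded
  one summand at a time, the linear term only contributing the weak variance (at most the sup norm of
  \<open>f\<close>). For both kinds of weights the mean of the contrast exceeds its value at any fixed \<open>k0\<close> by at
  most \<open>ln (max_dim c n) / n\<close>, which the condition on \<open>opt_dim\<close> makes smaller than the rate. This
  gives an oracle inequality as soon as the random penalty is at least half its expectation; the
  complementary event has probability of order \<open>1 / n\<close>. The squared bias is a tail of the series of
  squared coefficients by Parseval's identity, i.e. by completeness of the Laguerre and Hermite
  functions, which follows from uniqueness in the moment problem.
\<close>

subsection \<open>Concentration of sums of independent random vectors\<close>

text \<open>The constants depend on each other. If \<open>h\<close> squared bounds the total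
  variance of a sum, the exponential moment of its smoothed norm has size exp (2 * \<rho> * h), so
  the norm rarely exceeds 3 * h, and \<open>Z k\<close> rarely exceeds 9 times the bound
  \<open>H\<close> on its mean. The oracle inequality has to pay for 7/2 of \<open>Z k\<close>,
  hence for 63/2 of \<open>H\<close>; half of a penalty with \<Delta> \<ge> 84 * C\<phi> covers 42.
  The excess over 9 * \<open>H\<close> must have a sum of order 1 / n over up to n^2 dimensions. The
  weak variance contributes exp (- sqrt k / (8 * s)), whose sum over k is at most a multiple of s^4;
  with the prefactor s^2 and s^2 = C this is where the cube of C comes from. The sup norm of the
  basis contributes a second exponential, and the size of \<open>max_dim\<close> is what pushes it
  below a multiple of n^(-3).\<close>

lemma exp_le_quadratic:
  fixes x :: real
  assumes "x \<le> 1"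
  shows "exp x \<le> 1 + x + x\<^sup>2"
proof (cases "0 \<le> x")
  case True then show ?thesis using exp_bound assms by auto
next
  case False
  \<comment> \<open>Below zero the quadratic Taylor polynomial bounds exp y from below; multiplied
    by \<open>1 - y + y^2\<close> its linear terms cancel and at least 1 remains.\<close>
  define y where "y = -x"
  have y: "y > 0" using False y_def by simp
  have e: "exp y \<ge> 1 + y + y\<^sup>2/2" using exp_lower_Taylor_quadratic[of y] y by simp
  have "(1 - y + y\<^sup>2) * (1 + y + y\<^sup>2/2) = 1 + y\<^sup>2/2 + y^3/2 + y^4/2" by (simp add: algebra_simps power2_eq_square power3_eq_cube power4_eq_xxxx field_simps)
  then have "1 \<le> (1 - y + y\<^sup>2) * (1 + y + y\<^sup>2/2)" using y by simp
  also have "\<dots> \<le> (1 - y + y\<^sup>2) * exp y"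
  proof (rule mult_left_mono[OF e])
    have "1 - y + y\<^sup>2 = (1 - y/2)\<^sup>2 + 3/4 * y\<^sup>2" by (simp add: power2_eq_square algebra_simps)
    then show "0 \<le> 1 - y + y\<^sup>2" by simp
  qed
  finally have "exp (-y) \<le> 1 - y + y\<^sup>2" by (simp add: exp_minus field_simps)
  then show ?thesis by (simp add: y_def)
qed

text \<open>The root is linearised by \<open>2 * d * N s \<le> d^2 + (N s)^2\<close>, after which
  the expansion of \<open>d^2\<close> is exact. The offset \<open>a\<close> keeps \<open>N s\<close>
  away from zero, so the quadratic term is controlled uniformly in \<open>s\<close>.\<close>

lemma smoothed_norm_increment:
  fixes s y :: "'j \<Rightarrow> real" and a :: real and J :: "'j set"
  assumes "a > 0"
  defines "N \<equiv> \<lambda>s. sqrt (a\<^sup>2 + (\<Sum>j\<in>J. (s j)\<^sup>2))"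
  shows "N (\<lambda>j. s j + y j) \<le> N s + ((\<Sum>j\<in>J. (s j / N s) * y j) + (\<Sum>j\<in>J. (y j)\<^sup>2) / (2 * a))"
proof -
  define q where "q = (\<Sum>j\<in>J. (y j)\<^sup>2)"
  define p where "p = (\<Sum>j\<in>J. s j * y j)"
  have q0: "q \<ge> 0" by (auto simp: q_def intro: sum_nonneg)
  have s0: "0 \<le> (\<Sum>j\<in>J. (s j)\<^sup>2)" by (auto intro: sum_nonneg)
  have N2: "(N s)\<^sup>2 = a\<^sup>2 + (\<Sum>j\<in>J. (s j)\<^sup>2)" using s0 by (simp add: N_def)
  have Na: "N s \<ge> a" using s0 assms(1) by (simp add: N_def real_le_rsqrt)
  then have N0: "N s > 0" using assms(1) by linarith
  have "(\<Sum>j\<in>J. (s j + y j)\<^sup>2) = (\<Sum>j\<in>J. (s j)\<^sup>2) + 2 * p + q"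
    by (simp add: p_def q_def power2_sum sum.distrib sum_distrib_left mult.assoc)
  then have e: "(N (\<lambda>j. s j + y j))\<^sup>2 = (N s)\<^sup>2 + 2 * p + q"
  proof -
    have "0 \<le> (\<Sum>j\<in>J. (s j + y j)\<^sup>2)" by (auto intro: sum_nonneg)
    then have "(N (\<lambda>j. s j + y j))\<^sup>2 = a\<^sup>2 + (\<Sum>j\<in>J. (s j + y j)\<^sup>2)" by (simp add: N_def)
    then show ?thesis using N2 \<open>(\<Sum>j\<in>J. (s j + y j)\<^sup>2) = _\<close> by simp
  qed
  define d where "d = N (\<lambda>j. s j + y j)"
  have "2 * d * N s \<le> d\<^sup>2 + (N s)\<^sup>2" by (metis sum_squares_bound)
  then have "2 * d * N s \<le> 2 * (N s)\<^sup>2 + 2 * p + q" using e d_def by simp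
  moreover have "(N s + p / N s + q / (2 * N s)) * (2 * N s) = 2 * (N s)\<^sup>2 + 2 * p + q"
    using N0 by (simp add: distrib_right power2_eq_square)
  ultimately have "d * (2 * N s) \<le> (N s + p / N s + q / (2 * N s)) * (2 * N s)"
    by (simp only: mult_ac)
  then have "d \<le> N s + p / N s + q / (2 * N s)"
    using N0 by (simp add: mult_le_cancel_right)
  also have "q / (2 * N s) \<le> q / (2 * a)"
    using q0 Na assms(1) by (intro divide_left_mono) auto
  finally show ?thesis
    unfolding d_def p_def q_def by (simp add: sum_divide_distrib algebra_simps)
qed

text \<open>The direction \<open>s / N s\<close> has length at most one. The linear part of the
  increment is therefore centred with second moment at most the weak variance \<sigma>; the total
  variance \<tau> is paid only through the quadratic part, divided by \<open>a\<close>. The last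
  condition on \<rho> keeps the exponent below 1, the range of the quadratic bound for exp.\<close>

lemma exp_norm_step:
  fixes Y :: "'b \<Rightarrow> 'j \<Rightarrow> real"
  assumes "prob_space M" "finite J"
    and meas [measurable]: "\<And>j. (\<lambda>x. Y x j) \<in> borel_measurable M"
    and bd: "AE x in M. (\<Sum>j\<in>J. (Y x j)\<^sup>2) \<le> b\<^sup>2"
    and cent: "\<And>j. j \<in> J \<Longrightarrow> (\<integral>x. Y x j \<partial>M) = 0"
    and tot: "(\<integral>x. (\<Sum>j\<in>J. (Y x j)\<^sup>2) \<partial>M) \<le> \<tau>"
    and weak: "\<And>u. (\<Sum>j\<in>J. (u j)\<^sup>2) \<le> 1 \<Longrightarrow> (\<integral>x. (\<Sum>j\<in>J. u j * Y x j)\<^sup>2 \<partial>M) \<le> \<sigma>"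
    and pos: "a > 0" "\<rho> \<ge> 0" "b \<ge> 0" "\<rho> * (b + b\<^sup>2 / (2 * a)) \<le> 1"
  shows "(\<integral>\<^sup>+x. ennreal (exp (\<rho> * sqrt (a\<^sup>2 + (\<Sum>j\<in>J. (s j + Y x j)\<^sup>2)))) \<partial>M)
       \<le> ennreal (exp (\<rho> * sqrt (a\<^sup>2 + (\<Sum>j\<in>J. (s j)\<^sup>2)))
            * exp (\<rho> * \<tau> / (2 * a) + \<rho>\<^sup>2 * (2 * \<sigma> + b\<^sup>2 * \<tau> / (2 * a\<^sup>2))))"
proof -
  interpret prob_space M by fact
  define N where "N = sqrt (a\<^sup>2 + (\<Sum>j\<in>J. (s j)\<^sup>2))"
  define u where "u = (\<lambda>j. s j / N)"
  define q where "q = (\<lambda>x. \<Sum>j\<in>J. (Y x j)\<^sup>2)"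
  define p where "p = (\<lambda>x. \<Sum>j\<in>J. u j * Y x j)"
  have [measurable]: "q \<in> borel_measurable M" "p \<in> borel_measurable M"
    unfolding q_def p_def by measurable
  have s0: "0 \<le> (\<Sum>j\<in>J. (s j)\<^sup>2)" by (auto intro: sum_nonneg)
  have N0: "N > 0" unfolding N_def using s0 pos(1) by (auto intro: add_pos_nonneg)
  have u1: "(\<Sum>j\<in>J. (u j)\<^sup>2) \<le> 1"
  proof -
    have "(\<Sum>j\<in>J. (u j)\<^sup>2) = (\<Sum>j\<in>J. (s j)\<^sup>2) / N\<^sup>2"
      by (simp add: u_def power_divide sum_divide_distrib)
    also have "\<dots> \<le> 1" using N0 s0 by (simp add: N_def)
    finally show ?thesis .
  qed
  have q0: "q x \<ge> 0" for x unfolding q_def by (auto intro: sum_nonneg)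
  have pq: "(p x)\<^sup>2 \<le> q x" for x
  proof -
    have "(p x)\<^sup>2 \<le> (\<Sum>j\<in>J. (u j)\<^sup>2) * q x" unfolding p_def q_def
      by (rule Cauchy_Schwarz_ineq_sum)
    also have "\<dots> \<le> 1 * q x" by (rule mult_right_mono[OF u1 q0])
    finally show ?thesis by simp
  qed
  have qb: "AE x in M. q x \<le> b\<^sup>2" using bd unfolding q_def .
  have pb: "AE x in M. \<bar>p x\<bar> \<le> b"
    using qb
  proof eventually_elim
    fix x assume "q x \<le> b\<^sup>2"
    then have "(p x)\<^sup>2 \<le> b\<^sup>2" using pq[of x] by linarith
    then show "\<bar>p x\<bar> \<le> b" using pos(3) by (simp add: power2_le_iff_abs_le)
  qed
  have iq: "integrable M q"
    by (rule integrable_const_bound[where B="b\<^sup>2"]) (use qb q0 in auto)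
  have ip: "integrable M p"
    by (rule integrable_const_bound[where B="b"]) (use pb in auto)
  have ip2: "integrable M (\<lambda>x. (p x)\<^sup>2)"
    by (rule Bochner_Integration.integrable_bound[OF iq]) (use pq q0 in auto)
  have iY: "integrable M (\<lambda>x. Y x j)" if "j \<in> J" for j
  proof (rule integrable_const_bound[where B="b"])
    show "AE x in M. norm (Y x j) \<le> b" using qb
    proof eventually_elim
      fix x assume "q x \<le> b\<^sup>2"
      moreover have "(Y x j)\<^sup>2 \<le> q x" unfolding q_def by (rule member_le_sum) (use that assms(2) in auto)
      ultimately show "norm (Y x j) \<le> b" using pos(3) power2_le_iff_abs_le[of b "Y x j"] by simp
    qed
  qed auto
  have Ep: "(\<integral>x. p x \<partial>M) = 0"
  proof -
    have "(\<integral>x. p x \<partial>M) = (\<Sum>j\<in>J. u j * (\<integral>x. Y x j \<partial>M))"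
      unfolding p_def by (subst Bochner_Integration.integral_sum) (use iY in auto)
    then show ?thesis using cent by simp
  qed
  have Ep2: "(\<integral>x. (p x)\<^sup>2 \<partial>M) \<le> \<sigma>" unfolding p_def by (rule weak[OF u1])
  have Eq: "(\<integral>x. q x \<partial>M) \<le> \<tau>" using tot unfolding q_def .
  define W where "W = (\<lambda>x. p x + q x / (2 * a))"
  define U where "U = (\<lambda>x. 1 + \<rho> * (p x + q x / (2 * a)) + \<rho>\<^sup>2 * (2 * (p x)\<^sup>2 + b\<^sup>2 * q x / (2 * a\<^sup>2)))"
  have step: "AE x in M. exp (\<rho> * W x) \<le> U x"
    using qb pb
  proof eventually_elim
    fix x assume x: "q x \<le> b\<^sup>2" "\<bar>p x\<bar> \<le> b"
    have "\<rho> * W x \<le> \<rho> * (b + b\<^sup>2 / (2 * a))"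
      unfolding W_def using x pos by (intro mult_left_mono add_mono divide_right_mono) auto
    then have "\<rho> * W x \<le> 1" using pos(4) by linarith
    then have "exp (\<rho> * W x) \<le> 1 + \<rho> * W x + (\<rho> * W x)\<^sup>2" by (rule exp_le_quadratic)
    \<comment> \<open>One factor \<open>q x\<close> is replaced by its bound \<open>b^2\<close>, so
      that only the first moment of \<open>q\<close> is needed later.\<close>
    moreover have "(W x)\<^sup>2 \<le> 2 * (p x)\<^sup>2 + b\<^sup>2 * q x / (2 * a\<^sup>2)"
    proof -
      have "(W x)\<^sup>2 \<le> 2 * (p x)\<^sup>2 + 2 * (q x / (2 * a))\<^sup>2"
        unfolding W_def power2_sum using sum_squares_bound[of "p x" "q x / (2 * a)"] by linarith
      moreover have "2 * (q x / (2 * a))\<^sup>2 = (q x * q x) / (2 * a\<^sup>2)"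
        by (simp add: power2_eq_square field_simps)
      moreover have "(q x * q x) / (2 * a\<^sup>2) \<le> (b\<^sup>2 * q x) / (2 * a\<^sup>2)"
        by (intro divide_right_mono mult_right_mono x q0) auto
      ultimately show ?thesis by linarith
    qed
    then have "\<rho>\<^sup>2 * (W x)\<^sup>2 \<le> \<rho>\<^sup>2 * (2 * (p x)\<^sup>2 + b\<^sup>2 * q x / (2 * a\<^sup>2))"
      by (intro mult_left_mono) auto
    ultimately show "exp (\<rho> * W x) \<le> U x" unfolding U_def W_def by (simp add: power_mult_distrib)
  qed
  have iU: "integrable M U" unfolding U_def using iq ip ip2 by auto
  have EU: "(\<integral>x. U x \<partial>M) \<le> exp (\<rho> * \<tau> / (2 * a) + \<rho>\<^sup>2 * (2 * \<sigma> + b\<^sup>2 * \<tau> / (2 * a\<^sup>2)))"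
  proof -
    have "(\<integral>x. U x \<partial>M) = 1 + \<rho> * ((\<integral>x. q x \<partial>M) / (2 * a))
        + \<rho>\<^sup>2 * (2 * (\<integral>x. (p x)\<^sup>2 \<partial>M) + b\<^sup>2 * (\<integral>x. q x \<partial>M) / (2 * a\<^sup>2))"
      unfolding U_def using iq ip ip2 Ep by (simp add: prob_space)
    also have "\<dots> \<le> 1 + \<rho> * (\<tau> / (2 * a)) + \<rho>\<^sup>2 * (2 * \<sigma> + b\<^sup>2 * \<tau> / (2 * a\<^sup>2))"
      using Eq Ep2 pos by (intro add_mono mult_left_mono divide_right_mono) auto
    also have "\<dots> \<le> exp (\<rho> * (\<tau> / (2 * a)) + \<rho>\<^sup>2 * (2 * \<sigma> + b\<^sup>2 * \<tau> / (2 * a\<^sup>2)))"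
      using exp_ge_add_one_self[of "\<rho> * (\<tau> / (2 * a)) + \<rho>\<^sup>2 * (2 * \<sigma> + b\<^sup>2 * \<tau> / (2 * a\<^sup>2))"] by linarith
    finally show ?thesis by simp
  qed
  have "(\<integral>\<^sup>+x. ennreal (exp (\<rho> * sqrt (a\<^sup>2 + (\<Sum>j\<in>J. (s j + Y x j)\<^sup>2)))) \<partial>M)
      \<le> (\<integral>\<^sup>+x. ennreal (exp (\<rho> * N) * U x) \<partial>M)"
  proof (rule nn_integral_mono_AE, use step in eventually_elim)
    fix x assume x: "exp (\<rho> * W x) \<le> U x"
    have "sqrt (a\<^sup>2 + (\<Sum>j\<in>J. (s j + Y x j)\<^sup>2)) \<le> N + W x"
      using smoothed_norm_increment[OF pos(1), of s "Y x" J]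
      unfolding N_def W_def p_def q_def u_def by simp
    then have "exp (\<rho> * sqrt (a\<^sup>2 + (\<Sum>j\<in>J. (s j + Y x j)\<^sup>2))) \<le> exp (\<rho> * N) * exp (\<rho> * W x)"
      using pos(2) by (simp flip: exp_add distrib_left add: mult_left_mono)
    also have "\<dots> \<le> exp (\<rho> * N) * U x" using x by simp
    finally show "ennreal (exp (\<rho> * sqrt (a\<^sup>2 + (\<Sum>j\<in>J. (s j + Y x j)\<^sup>2)))) \<le> ennreal (exp (\<rho> * N) * U x)"
      by (rule ennreal_leI)
  qed
  also have "\<dots> = ennreal (\<integral>x. exp (\<rho> * N) * U x \<partial>M)"
  proof (rule nn_integral_eq_integral)
    show "AE x in M. 0 \<le> exp (\<rho> * N) * U x" using step
    proof eventually_elim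
      fix x assume "exp (\<rho> * W x) \<le> U x"
      then have "0 \<le> U x" using exp_ge_zero[of "\<rho> * W x"] by linarith
      then show "0 \<le> exp (\<rho> * N) * U x" by simp
    qed
  qed (use iU in auto)
  also have "\<dots> \<le> ennreal (exp (\<rho> * N) * exp (\<rho> * \<tau> / (2 * a) + \<rho>\<^sup>2 * (2 * \<sigma> + b\<^sup>2 * \<tau> / (2 * a\<^sup>2))))"
    using EU by (auto intro!: ennreal_leI)
  finally show ?thesis unfolding N_def .
qed

text \<open>Fubini for the last summand. The sum reaches \<open>F\<close> as a function of
  \<open>j\<close>, which covers sums of vectors and, with \<open>j\<close> of type unit, sums of
  numbers.\<close>

lemma nn_integral_PiM_insert_sum:
  fixes g :: "'b \<Rightarrow> 'j \<Rightarrow> real" and I :: "'i set" and F :: "('j \<Rightarrow> real) \<Rightarrow> ennreal"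
  assumes "prob_space M" "finite I" "i \<notin> I"
    and "(\<lambda>X. F (\<lambda>j. \<Sum>i'\<in>insert i I. g (X i') j)) \<in> borel_measurable (PiM (insert i I) (\<lambda>_. M))"
  shows "(\<integral>\<^sup>+X. F (\<lambda>j. \<Sum>i'\<in>insert i I. g (X i') j) \<partial>PiM (insert i I) (\<lambda>_. M))
    = (\<integral>\<^sup>+X. (\<integral>\<^sup>+y. F (\<lambda>j. (\<Sum>i'\<in>I. g (X i') j) + g y j) \<partial>M) \<partial>PiM I (\<lambda>_. M))"
proof -
  interpret prob_space M by fact
  interpret product_sigma_finite "\<lambda>_::'i. M" by (simp add: product_sigma_finite_def sigma_finite_measure_axioms)
  have "(\<Sum>i'\<in>I. g ((X(i := y)) i') j) = (\<Sum>i'\<in>I. g (X i') j)" for X y j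
    using assms(3) by (intro sum.cong) auto
  then show ?thesis
    using assms by (subst product_nn_integral_insert) (simp_all add: add.commute)
qed

text \<open>The factor lost per summand in \<open>exp_norm_step\<close> does not depend on the
  partial sum, so it simply accumulates \<open>card I\<close> times; exp (\<rho> * a) is the value
  at the empty sum.\<close>

lemma exp_norm_sum:
  fixes Y :: "'b \<Rightarrow> 'j \<Rightarrow> real" and I :: "'i set"
  assumes "prob_space M" "finite J" "finite I"
    and meas [measurable]: "\<And>j. (\<lambda>x. Y x j) \<in> borel_measurable M"
    and bd: "AE x in M. (\<Sum>j\<in>J. (Y x j)\<^sup>2) \<le> b\<^sup>2"
    and cent: "\<And>j. j \<in> J \<Longrightarrow> (\<integral>x. Y x j \<partial>M) = 0"
    and tot: "(\<integral>x. (\<Sum>j\<in>J. (Y x j)\<^sup>2) \<partial>M) \<le> \<tau>"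
    and weak: "\<And>u. (\<Sum>j\<in>J. (u j)\<^sup>2) \<le> 1 \<Longrightarrow> (\<integral>x. (\<Sum>j\<in>J. u j * Y x j)\<^sup>2 \<partial>M) \<le> \<sigma>"
    and pos: "a > 0" "\<rho> \<ge> 0" "b \<ge> 0" "\<rho> * (b + b\<^sup>2 / (2 * a)) \<le> 1"
  shows "(\<integral>\<^sup>+X. ennreal (exp (\<rho> * sqrt (a\<^sup>2 + (\<Sum>j\<in>J. (\<Sum>i\<in>I. Y (X i) j)\<^sup>2)))) \<partial>PiM I (\<lambda>_. M))
       \<le> ennreal (exp (\<rho> * a + real (card I) * (\<rho> * \<tau> / (2 * a) + \<rho>\<^sup>2 * (2 * \<sigma> + b\<^sup>2 * \<tau> / (2 * a\<^sup>2)))))"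
  using assms(3)
proof (induction I rule: finite_induct)
  case empty
  then show ?case using pos by (simp add: PiM_empty nn_integral_count_space_finite)
next
  case (insert i I)
  interpret prob_space M by fact
  define r where "r = \<rho> * \<tau> / (2 * a) + \<rho>\<^sup>2 * (2 * \<sigma> + b\<^sup>2 * \<tau> / (2 * a\<^sup>2))"
  define q where "q = exp r"
  have [measurable]: "(\<lambda>X. Y (X i') j) \<in> borel_measurable (PiM I' (\<lambda>_. M))" if "i' \<in> I'" for i' I' j
    using that by measurable
  have "(\<integral>\<^sup>+X. ennreal (exp (\<rho> * sqrt (a\<^sup>2 + (\<Sum>j\<in>J. (\<Sum>i\<in>insert i I. Y (X i) j)\<^sup>2)))) \<partial>PiM (insert i I) (\<lambda>_. M))
      = (\<integral>\<^sup>+X. (\<integral>\<^sup>+y. ennreal (exp (\<rho> * sqrt (a\<^sup>2 + (\<Sum>j\<in>J. ((\<Sum>i\<in>I. Y (X i) j) + Y y j)\<^sup>2)))) \<partial>M) \<partial>PiM I (\<lambda>_. M))"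
    using nn_integral_PiM_insert_sum[OF assms(1) insert(1,2), where g=Y
        and F="\<lambda>S. ennreal (exp (\<rho> * sqrt (a\<^sup>2 + (\<Sum>j\<in>J. (S j)\<^sup>2))))"] by simp
  also have "\<dots> \<le> (\<integral>\<^sup>+X. ennreal (exp (\<rho> * sqrt (a\<^sup>2 + (\<Sum>j\<in>J. (\<Sum>i'\<in>I. Y (X i') j)\<^sup>2)))) * ennreal q \<partial>PiM I (\<lambda>_. M))"
    unfolding q_def r_def
    by (intro nn_integral_mono order_trans[OF exp_norm_step[OF assms(1,2) meas bd cent tot weak pos]])
       (auto simp flip: ennreal_mult')
  also have "\<dots> = (\<integral>\<^sup>+X. ennreal (exp (\<rho> * sqrt (a\<^sup>2 + (\<Sum>j\<in>J. (\<Sum>i'\<in>I. Y (X i') j)\<^sup>2)))) \<partial>PiM I (\<lambda>_. M)) * ennreal q"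
    by (rule nn_integral_multc) measurable
  also have "\<dots> \<le> ennreal (exp (\<rho> * a + real (card I) * (\<rho> * \<tau> / (2 * a) + \<rho>\<^sup>2 * (2 * \<sigma> + b\<^sup>2 * \<tau> / (2 * a\<^sup>2))))) * ennreal q"
    by (rule mult_right_mono[OF insert.IH]) auto
  also have "\<dots> = ennreal (exp (\<rho> * a + real (card I) * r) * exp r)"
    unfolding q_def r_def by (simp add: ennreal_mult')
  also have "exp (\<rho> * a + real (card I) * r) * exp r = exp (\<rho> * a + real (card (insert i I)) * r)"
    using insert(1,2) by (simp flip: exp_add add: algebra_simps)
  finally show ?case unfolding r_def .
qed

text \<open>The smoothing is done at scale \<open>a = h\<close>. The offset contributes \<rho> * h
  to the exponent, the mean of the quadratic part and the weak variance \<rho> * h / 2 each, and the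
  sup bound \<open>b\<close> only the constant 1/8. Passing the level 3 * h, whose square is the
  threshold, then costs exp (- \<rho> * h); half of this decay is given away to absorb the factor 1
  + 3 * \<rho> * h.\<close>

lemma expected_excess:
  fixes Y :: "'b \<Rightarrow> 'j \<Rightarrow> real" and I :: "'i set"
  assumes "prob_space M" "finite J" "finite I"
    and meas [measurable]: "\<And>j. (\<lambda>x. Y x j) \<in> borel_measurable M"
    and bd: "AE x in M. (\<Sum>j\<in>J. (Y x j)\<^sup>2) \<le> b\<^sup>2"
    and cent: "\<And>j. j \<in> J \<Longrightarrow> (\<integral>x. Y x j \<partial>M) = 0"
    and tot: "(\<integral>x. (\<Sum>j\<in>J. (Y x j)\<^sup>2) \<partial>M) \<le> \<tau>" "real (card I) * \<tau> \<le> h\<^sup>2"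
    and weak: "\<And>u. (\<Sum>j\<in>J. (u j)\<^sup>2) \<le> 1 \<Longrightarrow> (\<integral>x. (\<Sum>j\<in>J. u j * Y x j)\<^sup>2 \<partial>M) \<le> \<sigma>"
    and pos: "h > 0" "\<rho> > 0" "b \<ge> 0" "b \<le> 2 * h"
    and lam: "2 * b * \<rho> \<le> 1" "4 * real (card I) * \<sigma> * \<rho> \<le> h"
  shows "(\<integral>\<^sup>+X. ennreal (max 0 ((\<Sum>j\<in>J. (\<Sum>i\<in>I. Y (X i) j)\<^sup>2) - 9 * h\<^sup>2)) \<partial>PiM I (\<lambda>_. M))
       \<le> ennreal (16 / \<rho>\<^sup>2 * exp (- (\<rho> * h / 2)))"
proof -
  define n where "n = real (card I)"
  define R where "R = (\<lambda>X. (\<Sum>j\<in>J. (\<Sum>i\<in>I. Y (X i) j)\<^sup>2))"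
  have [measurable]: "(\<lambda>X. Y (X i') j) \<in> borel_measurable (PiM I (\<lambda>_. M))" if "i' \<in> I" for i' j
    using that by measurable
  have R0: "R X \<ge> 0" for X unfolding R_def by (auto intro: sum_nonneg)
  define c where "c = (2 / \<rho>\<^sup>2 + 6 * h / \<rho>) * exp (- (3 * \<rho> * h))"
  have c0: "c \<ge> 0" using pos by (simp add: c_def)
  \<comment> \<open>With \<open>y\<close> the distance of the norm beyond 3 * h, the excess is
    \<open>y^2 + 6 * h * y\<close>, and each power of \<open>y\<close> is dominated by exp (\<rho> *
    y).\<close>
  have pw: "max 0 (R X - 9 * h\<^sup>2) \<le> c * exp (\<rho> * sqrt (h\<^sup>2 + R X))" for X
  proof (cases "R X \<le> 9 * h\<^sup>2")
    case True then show ?thesis using c0 by simp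
  next
    case False
    define x where "x = sqrt (R X)"
    define y where "y = x - 3 * h"
    have x2: "x\<^sup>2 = R X" using R0 by (simp add: x_def)
    have "(3 * h)\<^sup>2 < R X" using False by (simp add: power_mult_distrib)
    then have "3 * h < x" unfolding x_def using pos(1) real_less_rsqrt by blast
    then have y0: "y > 0" by (simp add: y_def)
    have "x\<^sup>2 - 9 * h\<^sup>2 = y\<^sup>2 + 6 * h * y" by (simp add: y_def power2_eq_square algebra_simps)
    also have "y\<^sup>2 \<le> 2 / \<rho>\<^sup>2 * exp (\<rho> * y)"
    proof -
      have "(\<rho> * y)\<^sup>2 / 2 \<le> exp (\<rho> * y)"
        using exp_lower_Taylor_quadratic[of "\<rho> * y"] pos(2) y0 by (smt (verit) mult_nonneg_nonneg)
      then show ?thesis using pos(2) by (simp add: field_simps power_mult_distrib)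
    qed
    also have "6 * h * y \<le> 6 * h / \<rho> * exp (\<rho> * y)"
    proof -
      have "\<rho> * y \<le> exp (\<rho> * y)" using exp_ge_add_one_self[of "\<rho> * y"] by linarith
      then have "y \<le> exp (\<rho> * y) / \<rho>" using pos(2) by (simp add: field_simps)
      then have "6 * h * y \<le> 6 * h * (exp (\<rho> * y) / \<rho>)" using pos(1) by (intro mult_left_mono) auto
      then show ?thesis by simp
    qed
    finally have "R X - 9 * h\<^sup>2 \<le> (2 / \<rho>\<^sup>2 + 6 * h / \<rho>) * exp (\<rho> * y)" using x2 by (simp add: algebra_simps)
    also have "exp (\<rho> * y) = exp (- (3 * \<rho> * h)) * exp (\<rho> * x)" by (simp add: y_def algebra_simps flip: exp_add)
    also have "exp (\<rho> * x) \<le> exp (\<rho> * sqrt (h\<^sup>2 + R X))" using pos(2) by (simp add: x_def)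
    finally have "R X - 9 * h\<^sup>2 \<le> c * exp (\<rho> * sqrt (h\<^sup>2 + R X))"
      unfolding c_def using pos by (simp add: mult.assoc mult_left_mono)
    then show ?thesis using c0 by simp
  qed
  have "\<rho> * (b + b\<^sup>2 / (2 * h)) \<le> \<rho> * (2 * b)"
  proof (rule mult_left_mono)
    have "b\<^sup>2 / (2 * h) \<le> b" using pos by (simp add: field_simps power2_eq_square mult_left_mono)
    then show "b + b\<^sup>2 / (2 * h) \<le> 2 * b" by simp
  qed (use pos in auto)
  then have l1: "\<rho> * (b + b\<^sup>2 / (2 * h)) \<le> 1" using lam by (simp add: algebra_simps)
  have l2: "\<rho> * h + n * (\<rho> * \<tau> / (2 * h) + \<rho>\<^sup>2 * (2 * \<sigma> + b\<^sup>2 * \<tau> / (2 * h\<^sup>2))) \<le> 2 * \<rho> * h + 1/8"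
  proof -
    have "n * (\<rho> * \<tau> / (2 * h)) = \<rho> * (n * \<tau>) / (2 * h)" by simp
    also have "\<dots> \<le> \<rho> * h\<^sup>2 / (2 * h)" using tot(2) pos unfolding n_def
      by (intro divide_right_mono mult_left_mono) auto
    also have "\<dots> = \<rho> * h / 2" using pos by (simp add: power2_eq_square)
    finally have 1: "n * (\<rho> * \<tau> / (2 * h)) \<le> \<rho> * h / 2" .
    have "n * (\<rho>\<^sup>2 * (2 * \<sigma>)) = (4 * n * \<sigma> * \<rho>) * \<rho> / 2" by (simp add: power2_eq_square)
    also have "\<dots> \<le> h * \<rho> / 2" using lam(2) pos unfolding n_def by (intro divide_right_mono mult_right_mono) auto
    finally have 2: "n * (\<rho>\<^sup>2 * (2 * \<sigma>)) \<le> \<rho> * h / 2" by (simp add: mult.commute)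
    have "n * (\<rho>\<^sup>2 * (b\<^sup>2 * \<tau> / (2 * h\<^sup>2))) = (b * \<rho>)\<^sup>2 * ((n * \<tau>) / (2 * h\<^sup>2))"
      by (simp add: power_mult_distrib)
    also have "\<dots> \<le> (1/2)\<^sup>2 * (1/2)"
    proof (rule mult_mono')
      show "(b * \<rho>)\<^sup>2 \<le> (1/2)\<^sup>2" using lam(1) pos by (intro power_mono) auto
      show "n * \<tau> / (2 * h\<^sup>2) \<le> 1/2" using tot(2) pos by (simp add: n_def field_simps)
      have "0 \<le> \<tau>" using tot(1) by (rule order_trans[rotated]) (auto intro!: Bochner_Integration.integral_nonneg sum_nonneg)
      then show "0 \<le> n * \<tau> / (2 * h\<^sup>2)" by (simp add: n_def)
    qed auto
    finally have 3: "n * (\<rho>\<^sup>2 * (b\<^sup>2 * \<tau> / (2 * h\<^sup>2))) \<le> 1/8" by (simp add: power2_eq_square)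
    show ?thesis unfolding distrib_left using 1 2 3 by linarith
  qed
  have "(\<integral>\<^sup>+X. ennreal (max 0 (R X - 9 * h\<^sup>2)) \<partial>PiM I (\<lambda>_. M))
     \<le> (\<integral>\<^sup>+X. ennreal c * ennreal (exp (\<rho> * sqrt (h\<^sup>2 + R X))) \<partial>PiM I (\<lambda>_. M))"
    using pw c0 by (intro nn_integral_mono) (simp add: ennreal_leI flip: ennreal_mult)
  also have "\<dots> = ennreal c * (\<integral>\<^sup>+X. ennreal (exp (\<rho> * sqrt (h\<^sup>2 + R X))) \<partial>PiM I (\<lambda>_. M))"
    unfolding R_def by (rule nn_integral_cmult) measurable
  also have "\<dots> \<le> ennreal c * ennreal (exp (\<rho> * h + n * (\<rho> * \<tau> / (2 * h) + \<rho>\<^sup>2 * (2 * \<sigma> + b\<^sup>2 * \<tau> / (2 * h\<^sup>2)))))"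
    unfolding R_def n_def
    by (intro mult_left_mono exp_norm_sum[OF assms(1,2,3) meas bd cent tot(1) weak]) (use pos l1 in auto)
  also have "\<dots> \<le> ennreal c * ennreal (exp (2 * \<rho> * h + 1/8))"
    using l2 by (intro mult_left_mono ennreal_leI) auto
  also have "\<dots> = ennreal (c * exp (2 * \<rho> * h + 1/8))" using c0 by (simp add: ennreal_mult)
  also have "\<dots> \<le> ennreal (16 / \<rho>\<^sup>2 * exp (- (\<rho> * h / 2)))"
  proof (rule ennreal_leI)
    define z where "z = \<rho> * h"
    have z: "z > 0" using pos by (simp add: z_def)
    have "exp (1/8 :: real) \<le> 1 + 1/8 + (1/8)\<^sup>2" by (rule exp_le_quadratic) simp
    then have e8: "exp (1/8 :: real) \<le> 4/3" by (simp add: power2_eq_square)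
    have "(1 + 3 * z) * exp (- z) * exp (1/8) \<le> (6 * exp (z/2)) * exp (- z) * (4/3)"
    proof -
      have "1 + 3 * z \<le> 6 * exp (z/2)" using exp_ge_add_one_self[of "z/2"] by linarith
      then show ?thesis using e8 z by (intro mult_mono) auto
    qed
    also have "\<dots> = 8 * exp (- (z / 2))" by (simp flip: exp_add)
    finally have z8: "(1 + 3 * z) * exp (- z) * exp (1/8) \<le> 8 * exp (- (z / 2))" .
    have "c * exp (2 * \<rho> * h + 1/8) = (2 / \<rho>\<^sup>2) * ((1 + 3 * z) * exp (- z) * exp (1/8))"
      unfolding c_def z_def using pos by (simp add: field_simps power2_eq_square flip: exp_add)
    also have "\<dots> \<le> (2 / \<rho>\<^sup>2) * (8 * exp (- (z / 2)))"
      by (intro mult_left_mono z8) auto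
    finally show "c * exp (2 * \<rho> * h + 1/8) \<le> 16 / \<rho>\<^sup>2 * exp (- (\<rho> * h / 2))"
      by (simp add: z_def)
  qed
  finally show ?thesis unfolding R_def .
qed

subsection \<open>Orthonormal sequences of square integrable functions\<close>

lemma integrable_mult_of_squares:
  fixes f g :: "'a \<Rightarrow> real"
  assumes [measurable]: "f \<in> borel_measurable M" "g \<in> borel_measurable M"
    and "integrable M (\<lambda>x. (f x)\<^sup>2)" "integrable M (\<lambda>x. (g x)\<^sup>2)"
  shows "integrable M (\<lambda>x. f x * g x)"
proof (rule Bochner_Integration.integrable_bound)
  show "integrable M (\<lambda>x. (f x)\<^sup>2 + (g x)\<^sup>2)" using assms by auto
  show "AE x in M. norm (f x * g x) \<le> norm ((f x)\<^sup>2 + (g x)\<^sup>2)"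
  proof (rule AE_I2)
    fix x
    have "2 * \<bar>f x\<bar> * \<bar>g x\<bar> \<le> (f x)\<^sup>2 + (g x)\<^sup>2" using sum_squares_bound[of "\<bar>f x\<bar>" "\<bar>g x\<bar>"] by simp
    moreover have "0 \<le> \<bar>f x\<bar> * \<bar>g x\<bar>" by simp
    ultimately have "\<bar>f x\<bar> * \<bar>g x\<bar> \<le> (f x)\<^sup>2 + (g x)\<^sup>2" by linarith
    then show "norm (f x * g x) \<le> norm ((f x)\<^sup>2 + (g x)\<^sup>2)" by (simp add: abs_mult)
  qed
qed auto

lemma integrable_square_add:
  fixes f g :: "'a \<Rightarrow> real"
  assumes "f \<in> borel_measurable M" "g \<in> borel_measurable M"
    and "integrable M (\<lambda>x. (f x)\<^sup>2)" "integrable M (\<lambda>x. (g x)\<^sup>2)"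
  shows "integrable M (\<lambda>x. (f x + g x)\<^sup>2)"
  unfolding power2_sum using integrable_mult_of_squares[OF assms] assms by (auto simp: mult.assoc)

lemma integrable_square_diff:
  fixes f g :: "'a \<Rightarrow> real"
  assumes "f \<in> borel_measurable M" "g \<in> borel_measurable M"
    and "integrable M (\<lambda>x. (f x)\<^sup>2)" "integrable M (\<lambda>x. (g x)\<^sup>2)"
  shows "integrable M (\<lambda>x. (f x - g x)\<^sup>2)"
  using integrable_square_add[of f M "\<lambda>x. - g x"] assms by auto

lemma abs_integral_mult_le:
  fixes f g :: "'a \<Rightarrow> real"
  assumes [measurable]: "f \<in> borel_measurable M" "g \<in> borel_measurable M"
    and i: "integrable M (\<lambda>x. (f x)\<^sup>2)" "integrable M (\<lambda>x. (g x)\<^sup>2)"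
  shows "(\<integral>x. \<bar>f x * g x\<bar> \<partial>M) \<le> sqrt (\<integral>x. (f x)\<^sup>2 \<partial>M) * sqrt (\<integral>x. (g x)\<^sup>2 \<partial>M)"
proof -
  have ifg: "integrable M (\<lambda>x. \<bar>f x * g x\<bar>)"
    using integrable_mult_of_squares[OF assms] by (rule integrable_abs)
  have "ennreal ((\<integral>x. \<bar>f x * g x\<bar> \<partial>M)\<^sup>2) = (\<integral>\<^sup>+x. ennreal \<bar>f x\<bar> * ennreal \<bar>g x\<bar> \<partial>M)\<^sup>2"
    using nn_integral_eq_integral[OF ifg]
    by (simp add: ennreal_mult abs_mult ennreal_power)
  also have "\<dots> \<le> (\<integral>\<^sup>+x. (ennreal \<bar>f x\<bar>)\<^sup>2 \<partial>M) * (\<integral>\<^sup>+x. (ennreal \<bar>g x\<bar>)\<^sup>2 \<partial>M)"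
    by (rule Cauchy_Schwarz_nn_integral) auto
  also have "\<dots> = ennreal ((\<integral>x. (f x)\<^sup>2 \<partial>M) * (\<integral>x. (g x)\<^sup>2 \<partial>M))"
    using nn_integral_eq_integral[OF i(1)] nn_integral_eq_integral[OF i(2)]
    by (simp add: ennreal_power ennreal_mult)
  finally have "(\<integral>x. \<bar>f x * g x\<bar> \<partial>M)\<^sup>2 \<le> (\<integral>x. (f x)\<^sup>2 \<partial>M) * (\<integral>x. (g x)\<^sup>2 \<partial>M)"
    by (subst (asm) ennreal_le_iff) auto
  then show ?thesis by (simp add: real_le_rsqrt flip: real_sqrt_mult)
qed

text \<open>The functions live on the whole line; the set A of the two cases enters only through the
  requirement that functions vanish outside it.\<close>

locale orthonormal_seq =
  fixes e :: "nat \<Rightarrow> real \<Rightarrow> real"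
  assumes e_meas [measurable]: "\<And>j. e j \<in> borel_measurable lborel"
    and e_sq: "\<And>j. integrable lborel (\<lambda>x. (e j x)\<^sup>2)"
    and e_orth: "\<And>i j. (\<integral>x. e i x * e j x \<partial>lborel) = (if i = j then 1 else 0)"
begin

lemma e_mult_integrable: "integrable lborel (\<lambda>x. e i x * e j x)"
  by (rule integrable_mult_of_squares) (auto intro: e_sq)

lemma comb_meas [measurable]: "(\<lambda>x. \<Sum>j<m. a j * e j x) \<in> borel_measurable lborel"
  by measurable

lemma comb_square_integral:
  "integrable lborel (\<lambda>x. (\<Sum>j\<in>{..<m}. a j * e j x)\<^sup>2)"
  "(\<integral>x. (\<Sum>j\<in>{..<m}. a j * e j x)\<^sup>2 \<partial>lborel) = (\<Sum>j<m. (a j)\<^sup>2)"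
proof -
  have eq: "(\<Sum>j\<in>{..<m}. a j * e j x)\<^sup>2 = (\<Sum>i<m. \<Sum>j<m. (a i * a j) * (e i x * e j x))" for x
    unfolding power2_eq_square sum_product by (simp add: mult_ac)
  show "integrable lborel (\<lambda>x. (\<Sum>j\<in>{..<m}. a j * e j x)\<^sup>2)"
    unfolding eq by (intro Bochner_Integration.integrable_sum integrable_mult_right e_mult_integrable)
  have "(\<integral>x. (\<Sum>j\<in>{..<m}. a j * e j x)\<^sup>2 \<partial>lborel) = (\<Sum>i<m. \<Sum>j<m. (a i * a j) * (if i = j then 1 else 0))"
    unfolding eq
    by (subst Bochner_Integration.integral_sum Bochner_Integration.integral_sum;
        (intro Bochner_Integration.integrable_sum integrable_mult_right e_mult_integrable)?)
       (simp add: e_orth e_mult_integrable Bochner_Integration.integral_sum)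
  also have "\<dots> = (\<Sum>j<m. (a j)\<^sup>2)"
    by (intro sum.cong refl) (simp add: power2_eq_square if_distrib cong: if_cong)
  finally show "(\<integral>x. (\<Sum>j\<in>{..<m}. a j * e j x)\<^sup>2 \<partial>lborel) = (\<Sum>j<m. (a j)\<^sup>2)" .
qed

lemma comb_inner:
  assumes [measurable]: "f \<in> borel_measurable lborel" and "integrable lborel (\<lambda>x. (f x)\<^sup>2)"
  shows "integrable lborel (\<lambda>x. f x * (\<Sum>j<m. a j * e j x))"
    "(\<integral>x. f x * (\<Sum>j<m. a j * e j x) \<partial>lborel) = (\<Sum>j<m. a j * (\<integral>x. f x * e j x \<partial>lborel))"
proof -
  have eq: "f x * (\<Sum>j<m. a j * e j x) = (\<Sum>j<m. a j * (f x * e j x))" for x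
    by (simp add: sum_distrib_left mult_ac)
  have i: "integrable lborel (\<lambda>x. f x * e j x)" for j
    by (rule integrable_mult_of_squares) (use assms e_sq in auto)
  show "integrable lborel (\<lambda>x. f x * (\<Sum>j<m. a j * e j x))"
    unfolding eq by (intro Bochner_Integration.integrable_sum integrable_mult_right i)
  show "(\<integral>x. f x * (\<Sum>j<m. a j * e j x) \<partial>lborel) = (\<Sum>j<m. a j * (\<integral>x. f x * e j x \<partial>lborel))"
    unfolding eq by (simp add: Bochner_Integration.integral_sum i)
qed

text \<open>Pythagoras: the first sum is the error within the span of the first \<open>m\<close>
  functions, the bracket the squared distance of \<open>f\<close> to that span.\<close>

lemma square_dist_comb:
  assumes [measurable]: "f \<in> borel_measurable lborel" and f2: "integrable lborel (\<lambda>x. (f x)\<^sup>2)"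
  defines "a \<equiv> \<lambda>j. \<integral>x. f x * e j x \<partial>lborel"
  shows "(\<integral>x. ((\<Sum>j<m. u j * e j x) - f x)\<^sup>2 \<partial>lborel)
    = (\<Sum>j<m. (u j - a j)\<^sup>2) + ((\<integral>x. (f x)\<^sup>2 \<partial>lborel) - (\<Sum>j<m. (a j)\<^sup>2))"
proof -
  have "((\<Sum>j<m. u j * e j x) - f x)\<^sup>2 = (\<Sum>j<m. u j * e j x)\<^sup>2 + (f x)\<^sup>2 - 2 * (f x * (\<Sum>j<m. u j * e j x))" for x
    by (simp add: power2_diff mult_ac)
  then have "(\<integral>x. ((\<Sum>j<m. u j * e j x) - f x)\<^sup>2 \<partial>lborel) =
     (\<Sum>j<m. (u j)\<^sup>2) + (\<integral>x. (f x)\<^sup>2 \<partial>lborel) - 2 * (\<Sum>j<m. u j * a j)"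
    using comb_square_integral[where m=m and a=u] comb_inner[OF assms(1) f2, where m=m and a=u] f2 by (simp add: a_def)
  also have "\<dots> = (\<Sum>j<m. (u j - a j)\<^sup>2) + ((\<integral>x. (f x)\<^sup>2 \<partial>lborel) - (\<Sum>j<m. (a j)\<^sup>2))"
    by (simp add: power2_diff sum.distrib sum_subtractf sum_distrib_left algebra_simps)
  finally show ?thesis .
qed

text \<open>The limit in \<open>L\<^sup>2\<close> of the partial sums is found from completeness of \<open>L\<^sup>1\<close> after weighting with
  a Gaussian density; Fatou's lemma then bounds the remainders.\<close>

lemma parseval:
  assumes [measurable]: "f \<in> borel_measurable lborel" and f2: "integrable lborel (\<lambda>x. (f x)\<^sup>2)"
    and supp: "\<And>x. x \<notin> A \<Longrightarrow> f x = 0" "\<And>j x. x \<notin> A \<Longrightarrow> e j x = 0"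
    and complete: "\<And>g. g \<in> borel_measurable lborel \<Longrightarrow> integrable lborel (\<lambda>x. (g x)\<^sup>2) \<Longrightarrow>
        (\<And>x. x \<notin> A \<Longrightarrow> g x = 0) \<Longrightarrow> (\<And>j. (\<integral>x. g x * e j x \<partial>lborel) = 0) \<Longrightarrow> AE x in lborel. g x = 0"
  shows "(\<lambda>j. (\<integral>x. f x * e j x \<partial>lborel)\<^sup>2) sums (\<integral>x. (f x)\<^sup>2 \<partial>lborel)"
proof -
  define a where "a = (\<lambda>j. \<integral>x. f x * e j x \<partial>lborel)"
  define F where "F = (\<integral>x. (f x)\<^sup>2 \<partial>lborel)"
  define s where "s = (\<lambda>m x. \<Sum>j<m. a j * e j x)"
  have bessel: "(\<Sum>j<m. (a j)\<^sup>2) \<le> F" for m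
  proof -
    have "0 \<le> (\<integral>x. ((\<Sum>j<m. a j * e j x) - f x)\<^sup>2 \<partial>lborel)" by (rule Bochner_Integration.integral_nonneg) simp
    then show ?thesis unfolding square_dist_comb[OF assms(1) f2] by (simp add: a_def F_def)
  qed
  have sm: "summable (\<lambda>j. (a j)\<^sup>2)"
  proof (rule bounded_imp_summable[where B=F])
    show "(\<Sum>k\<le>n. (a k)\<^sup>2) \<le> F" for n using bessel[of "Suc n"] unfolding lessThan_Suc_atMost .
  qed simp
  define T where "T = (\<lambda>m. (\<Sum>j. (a j)\<^sup>2) - (\<Sum>j<m. (a j)\<^sup>2))"
  have T0: "T \<longlonglongrightarrow> 0"
    unfolding T_def using summable_LIMSEQ[OF sm] by (auto intro!: tendsto_eq_intros)
  have Tn: "T m \<ge> 0" for m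
    unfolding T_def using sum_le_suminf[OF sm, of "{..<m}"] by auto
  have [measurable]: "s m \<in> borel_measurable lborel" for m unfolding s_def by measurable
  have s2: "integrable lborel (\<lambda>x. (s m x)\<^sup>2)" for m
    unfolding s_def by (rule comb_square_integral)
  have sd2: "(\<integral>x. (s i x - s m x)\<^sup>2 \<partial>lborel) \<le> T m" "integrable lborel (\<lambda>x. (s i x - s m x)\<^sup>2)"
    if "m \<le> i" for m i
  proof -
    \<comment> \<open>Zeroing the first coefficients, rather than summing over a block, keeps the
      difference in the form of \<open>comb_square_integral\<close>.\<close>
    have eq: "s i x - s m x = (\<Sum>j<i. (if j < m then 0 else a j) * e j x)" for x
    proof -
      have "s i x - s m x = (\<Sum>j\<in>{..<i} - {..<m}. a j * e j x)"
        unfolding s_def using that by (subst sum_diff) auto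
      also have "\<dots> = (\<Sum>j<i. (if j < m then 0 else a j) * e j x)"
        by (rule sum.mono_neutral_cong_left) auto
      finally show ?thesis .
    qed
    have "(\<integral>x. (s i x - s m x)\<^sup>2 \<partial>lborel) = (\<Sum>j<i. (if j < m then 0 else a j)\<^sup>2)"
      unfolding eq by (rule comb_square_integral)
    also have "\<dots> = (\<Sum>j\<in>{..<i} - {..<m}. (a j)\<^sup>2)"
      by (rule sum.mono_neutral_cong_right) auto
    also have "\<dots> = (\<Sum>j<i. (a j)\<^sup>2) - (\<Sum>j<m. (a j)\<^sup>2)"
      using that by (subst sum_diff) auto
    also have "\<dots> \<le> T m" unfolding T_def using sum_le_suminf[OF sm, of "{..<i}"] by auto
    finally show "(\<integral>x. (s i x - s m x)\<^sup>2 \<partial>lborel) \<le> T m" .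
    show "integrable lborel (\<lambda>x. (s i x - s m x)\<^sup>2)" unfolding eq by (rule comb_square_integral)
  qed
  define w where "w = std_normal_density"
  have [measurable]: "w \<in> borel_measurable lborel" unfolding w_def by measurable
  have w0: "w x > 0" for x unfolding w_def by (simp add: std_normal_density_def)
  have w1: "w x \<le> 1" for x
  proof -
    have "1 \<le> sqrt (2 * pi)" using pi_gt3 by (simp add: real_le_rsqrt)
    then show ?thesis unfolding w_def std_normal_density_def
      by (intro mult_le_one) (auto simp: divide_le_eq)
  qed
  have iw: "integrable lborel w" unfolding w_def by (simp add: integrable_normal_density)
  have w2: "integrable lborel (\<lambda>x. (w x)\<^sup>2)"
    by (rule Bochner_Integration.integrable_bound[OF iw])
       (use w0 w1 in \<open>auto intro!: AE_I2 simp: power2_eq_square less_imp_le mult_left_le abs_mult\<close>)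
  define c where "c = sqrt (\<integral>x. (w x)\<^sup>2 \<partial>lborel) + 1"
  have c0: "c > 0" unfolding c_def by (simp add: add_nonneg_pos Bochner_Integration.integral_nonneg)
  have L1: "(\<integral>x. norm (s i x * w x - s m x * w x) \<partial>lborel) \<le> sqrt (T m) * c" if "m \<le> i" for m i
  proof -
    have "(\<integral>x. \<bar>(s i x - s m x) * w x\<bar> \<partial>lborel)
        \<le> sqrt (\<integral>x. (s i x - s m x)\<^sup>2 \<partial>lborel) * sqrt (\<integral>x. (w x)\<^sup>2 \<partial>lborel)"
      by (rule abs_integral_mult_le) (use sd2[OF that] w2 in auto)
    also have "\<dots> \<le> sqrt (T m) * c"
      unfolding c_def using sd2[OF that] Tn by (intro mult_mono) (auto simp: Bochner_Integration.integral_nonneg)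
    finally show ?thesis by (simp add: left_diff_distrib)
  qed
  obtain r where r: "strict_mono r" "AE x in lborel. Cauchy (\<lambda>i. s (r i) x * w x)"
  proof (rule cauchy_L1_AE_cauchy_subseq[of lborel "\<lambda>m x. s m x * w x"])
    show "integrable lborel (\<lambda>x. s n x * w x)" for n
      by (rule integrable_mult_of_squares) (use s2 w2 in auto)
    fix d :: real assume "d > 0"
    then have "(d / c)\<^sup>2 > 0" using c0 by simp
    then obtain N where N: "\<And>m. m \<ge> N \<Longrightarrow> T m < (d / c)\<^sup>2"
      using order_tendstoD(2)[OF T0] unfolding eventually_sequentially by blast
    have sN: "sqrt (T m) * c < d" if "m \<ge> N" for m
    proof -
      have "sqrt (T m) < d / c" using N[OF that] \<open>d > 0\<close> c0 real_less_lsqrt Tn by (metis divide_pos_pos less_imp_le)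
      then show ?thesis using c0 by (simp add: field_simps)
    qed
    show "\<exists>N. \<forall>i\<ge>N. \<forall>j\<ge>N. LINT x|lborel. norm (s i x * w x - s j x * w x) < d"
    proof (intro exI allI impI)
      fix i j assume "N \<le> i" "N \<le> j"
      show "(LINT x|lborel. norm (s i x * w x - s j x * w x)) < d"
      proof (cases "j \<le> i")
        case True then show ?thesis using L1[OF True] sN[OF \<open>N \<le> j\<close>] by linarith
      next
        case False
        then have "(LINT x|lborel. norm (s j x * w x - s i x * w x)) < d"
          using L1[of i j] sN[OF \<open>N \<le> i\<close>] by linarith
        then show ?thesis by (simp add: abs_minus_commute)
      qed
    qed
  qed
  \<comment> \<open>A pointwise \<open>lim\<close> is measurable without any convergence assumption,
    and it is exactly 0 off \<open>A\<close>, where all partial sums vanish.\<close>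
  define g where "g = (\<lambda>x. lim (\<lambda>i. s (r i) x))"
  have [measurable]: "g \<in> borel_measurable lborel" unfolding g_def by measurable
  have lim: "AE x in lborel. (\<lambda>i. s (r i) x) \<longlonglongrightarrow> g x"
    using r(2)
  proof eventually_elim
    fix x assume "Cauchy (\<lambda>i. s (r i) x * w x)"
    then obtain l where "(\<lambda>i. s (r i) x * w x) \<longlonglongrightarrow> l"
      by (auto simp: Cauchy_convergent_iff convergent_def)
    then have "(\<lambda>i. s (r i) x * w x / w x) \<longlonglongrightarrow> l / w x"
      using w0[of x] by (intro tendsto_intros) auto
    then have "convergent (\<lambda>i. s (r i) x * w x / w x)" by (rule convergentI)
    then have "convergent (\<lambda>i. s (r i) x)" using w0[of x] by simp
    then show "(\<lambda>i. s (r i) x) \<longlonglongrightarrow> g x" unfolding g_def by (simp add: convergent_LIMSEQ_iff)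
  qed
  have gs: "(\<integral>\<^sup>+x. ennreal ((g x - s m x)\<^sup>2) \<partial>lborel) \<le> ennreal (T m)" for m
  proof -
    have "(\<integral>\<^sup>+x. ennreal ((g x - s m x)\<^sup>2) \<partial>lborel)
        = (\<integral>\<^sup>+x. liminf (\<lambda>i. ennreal ((s (r i) x - s m x)\<^sup>2)) \<partial>lborel)"
    proof (rule nn_integral_cong_AE, use lim in eventually_elim)
      fix x assume "(\<lambda>i. s (r i) x) \<longlonglongrightarrow> g x"
      then have "(\<lambda>i. ennreal ((s (r i) x - s m x)\<^sup>2)) \<longlonglongrightarrow> ennreal ((g x - s m x)\<^sup>2)"
        by (intro tendsto_ennrealI tendsto_intros)
      then show "ennreal ((g x - s m x)\<^sup>2) = liminf (\<lambda>i. ennreal ((s (r i) x - s m x)\<^sup>2))"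
        by (rule lim_imp_Liminf[OF trivial_limit_sequentially, symmetric])
    qed
    also have "\<dots> \<le> liminf (\<lambda>i. \<integral>\<^sup>+x. ennreal ((s (r i) x - s m x)\<^sup>2) \<partial>lborel)"
      by (rule nn_integral_liminf) measurable
    also have "\<dots> \<le> ennreal (T m)"
    proof (rule Liminf_le)
      show "\<forall>\<^sub>F i in sequentially. (\<integral>\<^sup>+x. ennreal ((s (r i) x - s m x)\<^sup>2) \<partial>lborel) \<le> ennreal (T m)"
        unfolding eventually_sequentially
      proof (intro exI allI impI)
        fix i assume "m \<le> i"
        then have mi: "m \<le> r i" using seq_suble[OF r(1), of i] by linarith
        show "(\<integral>\<^sup>+x. ennreal ((s (r i) x - s m x)\<^sup>2) \<partial>lborel) \<le> ennreal (T m)"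
          using sd2[OF mi] by (subst nn_integral_eq_integral) (auto intro: ennreal_leI)
      qed
    qed auto
    finally show ?thesis .
  qed
  have gsi: "integrable lborel (\<lambda>x. (g x - s m x)\<^sup>2)" for m
  proof (rule integrableI_nonneg)
    show "(\<integral>\<^sup>+x. ennreal ((g x - s m x)\<^sup>2) \<partial>lborel) < \<infinity>"
      using gs[of m] by (rule order_le_less_trans) simp
  qed auto
  have gsT: "(\<integral>x. (g x - s m x)\<^sup>2 \<partial>lborel) \<le> T m" for m
    using gs[of m] Tn[of m] by (subst (asm) nn_integral_eq_integral) (auto intro: gsi)
  have g2: "integrable lborel (\<lambda>x. (g x)\<^sup>2)" using gsi[of 0] by (simp add: s_def)
  have gcoef: "(\<integral>x. g x * e j x \<partial>lborel) = a j" for j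
  proof -
    have "norm ((\<integral>x. g x * e j x \<partial>lborel) - a j) \<le> sqrt (T m)" if "m > j" for m
    proof -
      have i1: "integrable lborel (\<lambda>x. g x * e j x)" "integrable lborel (\<lambda>x. s m x * e j x)"
        by (rule integrable_mult_of_squares; use g2 s2 e_sq in auto)+
      have "(\<integral>x. s m x * e j x \<partial>lborel) = a j"
      proof -
        have "(\<integral>x. e j x * s m x \<partial>lborel) = (\<Sum>i<m. a i * (if j = i then 1 else 0))"
          unfolding s_def comb_inner(2)[OF e_meas e_sq] by (simp add: e_orth)
        also have "\<dots> = a j" using that by (simp add: if_distrib cong: if_cong)
        finally show ?thesis by (simp add: mult.commute)
      qed
      then have "(\<integral>x. g x * e j x \<partial>lborel) - a j = (\<integral>x. (g x - s m x) * e j x \<partial>lborel)"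
        using i1 by (simp add: left_diff_distrib)
      also have "norm \<dots> \<le> (\<integral>x. \<bar>(g x - s m x) * e j x\<bar> \<partial>lborel)"
        using integral_norm_bound[of lborel "\<lambda>x. (g x - s m x) * e j x"] by simp
      also have "\<dots> \<le> sqrt (\<integral>x. (g x - s m x)\<^sup>2 \<partial>lborel) * sqrt (\<integral>x. (e j x)\<^sup>2 \<partial>lborel)"
        by (rule abs_integral_mult_le) (use gsi e_sq in auto)
      also have "\<dots> = sqrt (\<integral>x. (g x - s m x)\<^sup>2 \<partial>lborel)" using e_orth[of j j] by (simp add: power2_eq_square)
      also have "\<dots> \<le> sqrt (T m)" using gsT[of m] by simp
      finally show ?thesis .
    qed
    then have "\<forall>\<^sub>F m in sequentially. norm ((\<integral>x. g x * e j x \<partial>lborel) - a j) \<le> sqrt (T m)"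
      using eventually_gt_at_top[of j] by (rule eventually_mono[rotated])
    moreover have "(\<lambda>m. sqrt (T m)) \<longlonglongrightarrow> 0" using tendsto_real_sqrt[OF T0] by simp
    ultimately have "norm ((\<integral>x. g x * e j x \<partial>lborel) - a j) \<le> 0"
      by (intro tendsto_lowerbound) auto
    then show ?thesis by simp
  qed
  have "AE x in lborel. f x - g x = 0"
  proof (rule complete)
    show "integrable lborel (\<lambda>x. (f x - g x)\<^sup>2)" by (rule integrable_square_diff) (use f2 g2 in auto)
    show "f x - g x = 0" if "x \<notin> A" for x
      using supp(1)[OF that] supp(2)[OF that] by (simp add: g_def s_def)
    fix j
    have "integrable lborel (\<lambda>x. g x * e j x)" "integrable lborel (\<lambda>x. f x * e j x)"
      by (rule integrable_mult_of_squares; use g2 f2 e_sq in auto)+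
    then show "(\<integral>x. (f x - g x) * e j x \<partial>lborel) = 0"
      using gcoef[of j] by (simp add: left_diff_distrib a_def)
  qed measurable
  then have ae: "AE x in lborel. g x = f x" by eventually_elim simp
  have FT: "F - (\<Sum>j<m. (a j)\<^sup>2) \<le> T m" for m
  proof -
    have "(\<integral>x. (g x - s m x)\<^sup>2 \<partial>lborel) = (\<integral>x. (s m x - f x)\<^sup>2 \<partial>lborel)"
      by (rule integral_cong_AE) (use ae in \<open>auto simp: power2_commute\<close>)
    also have "\<dots> = F - (\<Sum>j<m. (a j)\<^sup>2)"
      unfolding s_def square_dist_comb[OF assms(1) f2] by (simp add: a_def F_def)
    finally show ?thesis using gsT[of m] by simp
  qed
  have "F = (\<Sum>j. (a j)\<^sup>2)"
  proof (rule antisym)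
    \<comment> \<open>At \<open>m = 0\<close> the partial sum is empty and the bound on the
      remainder is the missing half of Parseval's identity.\<close>
    show "F \<le> (\<Sum>j. (a j)\<^sup>2)" using FT[of 0] by (simp add: T_def)
    show "(\<Sum>j. (a j)\<^sup>2) \<le> F" by (rule suminf_le_const[OF sm]) (rule bessel)
  qed
  then have "(\<lambda>j. (a j)\<^sup>2) sums F" using summable_sums[OF sm] by simp
  then show ?thesis unfolding a_def F_def .
qed

end

subsection \<open>The moment problem\<close>

lemma exp_partial_sum_le:
  fixes y :: real
  assumes "0 \<le> y"
  shows "(\<Sum>m<N. y ^ m / fact m) \<le> exp y"
proof -
  have "(\<Sum>m<N. y ^ m / fact m) \<le> (\<Sum>m. y ^ m / fact m)"
    using assms summable_exp[of y] by (intro sum_le_suminf) (auto simp: field_simps)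
  then show ?thesis by (simp add: exp_def field_simps)
qed

lemma power_div_fact_le_exp:
  fixes y :: real
  assumes "0 \<le> y"
  shows "y ^ m / fact m \<le> exp y"
proof -
  have "y ^ m / fact m \<le> (\<Sum>k<Suc m. y ^ k / fact k)"
    using assms by (intro member_le_sum) auto
  then show ?thesis using exp_partial_sum_le[OF assms, of "Suc m"] by linarith
qed

text \<open>A finite exponential moment of order \<open>c\<close> bounds the n-th absolute moment by
  a multiple of n! / c^n. The Taylor remainder of the characteristic function at \<open>t\<close> is
  then of order (|t| / c)^n and tends to zero for c > |t|, while the Taylor polynomials of both
  distributions agree.\<close>

lemma moments_determine_distribution:
  assumes "real_distribution M1" "real_distribution M2"
    and e1: "\<And>c::real. integrable M1 (\<lambda>x. exp (c * \<bar>x\<bar>))"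
    and e2: "\<And>c::real. integrable M2 (\<lambda>x. exp (c * \<bar>x\<bar>))"
    and mom: "\<And>n. (\<integral>x. x ^ n \<partial>M1) = (\<integral>x. x ^ n \<partial>M2)"
  shows "M1 = M2"
proof (rule Levy_uniqueness[OF assms(1,2)], rule ext)
  fix t :: real
  \<comment> \<open>Any positive value above |t| would do; the summand 1 takes care of
    \<open>t = 0\<close>.\<close>
  define c where "c = 2 * \<bar>t\<bar> + 1"
  have c0: "c > 0" by (simp add: c_def)
  have abs_mom: "integrable M (\<lambda>x. \<bar>x\<bar> ^ n)" "(\<integral>x. \<bar>x\<bar> ^ n \<partial>M) \<le> fact n / c ^ n * (\<integral>x. exp (c * \<bar>x\<bar>) \<partial>M)"
      "integrable M (\<lambda>x. x ^ n)"
    if "real_distribution M" "integrable M (\<lambda>x. exp (c * \<bar>x\<bar>))" for M n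
  proof -
    interpret real_distribution M by fact
    have pw: "\<bar>x\<bar> ^ n \<le> fact n / c ^ n * exp (c * \<bar>x\<bar>)" for x :: real
      using power_div_fact_le_exp[of "c * \<bar>x\<bar>" n] c0 by (simp add: power_mult_distrib field_simps)
    have i: "integrable M (\<lambda>x. fact n / c ^ n * exp (c * \<bar>x\<bar>))" using that(2) by simp
    show 1: "integrable M (\<lambda>x. \<bar>x\<bar> ^ n)"
      by (rule Bochner_Integration.integrable_bound[OF i])
        (use pw c0 in \<open>auto intro!: AE_I2 simp: abs_mult\<close>)
    show "(\<integral>x. \<bar>x\<bar> ^ n \<partial>M) \<le> fact n / c ^ n * (\<integral>x. exp (c * \<bar>x\<bar>) \<partial>M)"
      using integral_mono[OF 1 i pw] by simp
    show "integrable M (\<lambda>x. x ^ n)"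
      by (rule Bochner_Integration.integrable_bound[OF 1]) (auto simp: power_abs)
  qed
  define E where "E = (\<integral>x. exp (c * \<bar>x\<bar>) \<partial>M1) + (\<integral>x. exp (c * \<bar>x\<bar>) \<partial>M2)"
  have "cmod (char M1 t - char M2 t) \<le> 2 * (\<bar>t\<bar> / c) ^ n * E" for n
  proof -
    define S where "S = (\<lambda>M :: real measure. \<Sum>k\<le>n. ((\<i> * t)^k / fact k) * (\<integral>x. x^k \<partial>M))"
    have ap: "cmod (char M t - S M) \<le> 2 * (\<bar>t\<bar> / c) ^ n * (\<integral>x. exp (c * \<bar>x\<bar>) \<partial>M)"
      if "real_distribution M" "integrable M (\<lambda>x. exp (c * \<bar>x\<bar>))" for M
    proof -
      have "cmod (char M t - S M) \<le> (2*\<bar>t\<bar>^n / fact n) * (\<integral>x. \<bar>x\<bar>^n \<partial>M)"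
        unfolding S_def by (rule real_distribution.char_approx1[OF that(1)]) (rule abs_mom[OF that])
      also have "\<dots> \<le> (2*\<bar>t\<bar>^n / fact n) * (fact n / c ^ n * (\<integral>x. exp (c * \<bar>x\<bar>) \<partial>M))"
        by (intro mult_left_mono abs_mom[OF that]) auto
      finally show ?thesis by (simp add: power_divide)
    qed
    have "S M1 = S M2" unfolding S_def by (simp add: mom)
    then have "char M1 t - char M2 t = (char M1 t - S M1) - (char M2 t - S M2)" by simp
    also have "cmod \<dots> \<le> cmod (char M1 t - S M1) + cmod (char M2 t - S M2)" by (rule norm_triangle_ineq4)
    also have "\<dots> \<le> 2 * (\<bar>t\<bar> / c) ^ n * E"
      using ap[OF assms(1) e1] ap[OF assms(2) e2] by (simp add: E_def distrib_left)
    finally show ?thesis .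
  qed
  moreover have "(\<lambda>n. 2 * (\<bar>t\<bar> / c) ^ n * E) \<longlonglongrightarrow> 2 * 0 * E"
    by (intro tendsto_intros LIMSEQ_realpow_zero) (use c0 in \<open>auto simp: c_def field_simps\<close>)
  ultimately have "cmod (char M1 t - char M2 t) \<le> 0"
    by (intro tendsto_lowerbound[where f="\<lambda>n. 2 * (\<bar>t\<bar> / c) ^ n * E"]) auto
  then show "char M1 t = char M2 t" by simp
qed

text \<open>The positive and the negative part of \<open>G\<close> have the same mass. Normalised
  and transported by \<open>Y\<close> they become distributions with equal moments, hence equal
  distributions. As \<open>V\<close> recovers \<open>x\<close> from \<open>Y x\<close> where
  \<open>G\<close> is nonzero, the sign of \<open>G x\<close> is a function of \<open>Y x\<close>,
  so the two distributions live on disjoint sets; this is impossible unless the mass is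
  zero.\<close>

lemma zero_moments_imp_AE_zero:
  fixes G Y V :: "real \<Rightarrow> real"
  assumes [measurable]: "G \<in> borel_measurable borel" "Y \<in> borel_measurable borel" "V \<in> borel_measurable borel"
    and inj: "\<And>x. G x \<noteq> 0 \<Longrightarrow> V (Y x) = x"
    and ex: "\<And>c. integrable lborel (\<lambda>x. G x * exp (c * \<bar>Y x\<bar>))"
    and mom: "\<And>n. (\<integral>x. G x * Y x ^ n \<partial>lborel) = 0"
  shows "AE x in lborel. G x = 0"
proof -
  \<comment> \<open>The sign \<open>s\<close> is 1 or -1 and selects the positive or negative part,
    so that one argument serves both.\<close>
  define pp where "pp = (\<lambda>s x. max 0 (s * G x) :: real)"
  have [measurable]: "pp s \<in> borel_measurable borel" for s unfolding pp_def by measurable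
  have p0: "pp s x \<ge> 0" for s x unfolding pp_def by simp
  have pG: "\<bar>pp s x\<bar> \<le> \<bar>G x\<bar>" if "\<bar>s\<bar> = 1" for s x
    using that unfolding pp_def by (auto simp: max_def abs_if split: if_splits)
  have diff: "G x = pp 1 x - pp (-1) x" for x unfolding pp_def by auto
  have iex: "integrable lborel (\<lambda>x. pp s x * exp (c * \<bar>Y x\<bar>))" if "\<bar>s\<bar> = 1" for s c
    by (rule Bochner_Integration.integrable_bound[OF ex[of c]])
       (use pG[OF that] in \<open>auto simp: abs_mult\<close>)
  have iY: "integrable lborel (\<lambda>x. pp s x * Y x ^ n)" if "\<bar>s\<bar> = 1" for s n
  proof (rule Bochner_Integration.integrable_bound)
    show "integrable lborel (\<lambda>x. fact n * (pp s x * exp (1 * \<bar>Y x\<bar>)))"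
      using iex[OF that, of 1] by auto
    show "AE x in lborel. norm (pp s x * Y x ^ n) \<le> norm (fact n * (pp s x * exp (1 * \<bar>Y x\<bar>)))"
    proof (rule AE_I2)
      fix x
      have "\<bar>Y x\<bar> ^ n \<le> fact n * exp \<bar>Y x\<bar>"
        using power_div_fact_le_exp[of "\<bar>Y x\<bar>" n] by (simp add: field_simps)
      then have "pp s x * \<bar>Y x\<bar> ^ n \<le> pp s x * (fact n * exp \<bar>Y x\<bar>)" by (intro mult_left_mono p0)
      then show "norm (pp s x * Y x ^ n) \<le> norm (fact n * (pp s x * exp (1 * \<bar>Y x\<bar>)))"
        using p0[of s x] by (simp add: abs_mult power_abs mult_ac)
    qed
  qed measurable
  have eqm: "(\<integral>x. pp 1 x * Y x ^ n \<partial>lborel) = (\<integral>x. pp (-1) x * Y x ^ n \<partial>lborel)" for n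
    using mom[of n] iY[of 1 n] iY[of "-1" n] unfolding diff by (simp add: left_diff_distrib)
  define m where "m = (\<integral>x. pp 1 x \<partial>lborel)"
  have m': "m = (\<integral>x. pp (-1) x \<partial>lborel)" using eqm[of 0] by (simp add: m_def)
  have ip: "integrable lborel (pp s)" if "\<bar>s\<bar> = 1" for s using iY[OF that, of 0] by simp
  have m0: "m \<ge> 0" unfolding m_def by (rule Bochner_Integration.integral_nonneg) (rule p0)
  have mm: "(\<integral>x. pp s x \<partial>lborel) = m" if "s = 1 \<or> s = -1" for s using that m_def m' by auto
  show ?thesis
  proof (cases "m = 0")
    case True
    \<comment> \<open>With zero mass there is nothing to normalise, and each part vanishes on its
      own.\<close>
    have "AE x in lborel. pp s x = 0" if "s = 1 \<or> s = -1" for s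
      using integral_nonneg_eq_0_iff_AE[OF ip, of s] that mm[OF that] True p0 by auto
    from this[of 1] this[of "-1"] show ?thesis unfolding diff by auto
  next
    case False
    then have m0: "m > 0" using m0 by simp
    define D where "D = (\<lambda>s. density lborel (\<lambda>x. ennreal (pp s x / m)))"
    define M where "M = (\<lambda>s. distr (D s) borel Y)"
    have [measurable_cong]: "sets (D s) = sets borel" for s by (simp add: D_def)
    have DI: "integrable (D s) h \<longleftrightarrow> integrable lborel (\<lambda>x. pp s x / m * h x)"
         "(\<integral>x. h x \<partial>D s) = (\<integral>x. pp s x / m * h x \<partial>lborel)"
      if [measurable]: "h \<in> borel_measurable borel" for s and h :: "real \<Rightarrow> real"
      unfolding D_def using p0 m0 by (auto simp: integrable_real_density integral_real_density)
    have dist: "real_distribution (M s)" if "s = 1 \<or> s = -1" for s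
    proof -
      have "(\<integral>\<^sup>+x. ennreal (pp s x / m) \<partial>lborel) = ennreal (\<integral>x. pp s x / m \<partial>lborel)"
        using ip[of s] that p0 m0 by (intro nn_integral_eq_integral) auto
      also have "\<dots> = 1" using mm[OF that] m0 by simp
      finally have "prob_space (D s)" unfolding D_def by (intro prob_spaceI) (simp add: emeasure_density)
      then interpret prob_space "D s" .
      show ?thesis unfolding M_def
        by (simp add: real_distribution_def real_distribution_axioms_def prob_space_distr)
    qed
    have "M 1 = M (-1)"
    proof (rule moments_determine_distribution)
      have ii: "integrable (M s) (\<lambda>x. exp (c * \<bar>x\<bar>))" if "\<bar>s\<bar> = 1" for s c
        unfolding M_def using iex[OF that, of c] by (subst integrable_distr_eq) (auto simp: DI)
      show "integrable (M 1) (\<lambda>x. exp (c * \<bar>x\<bar>))" "integrable (M (-1)) (\<lambda>x. exp (c * \<bar>x\<bar>))" for c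
        by (rule ii; simp)+
      show "(\<integral>x. x ^ n \<partial>M 1) = (\<integral>x. x ^ n \<partial>M (-1))" for n
        unfolding M_def using eqm[of n] by (simp add: integral_distr DI)
    qed (use dist in auto)
    then have "measure (M 1) B = measure (M (-1)) B" for B by simp
    then have eqB: "(\<integral>x. pp 1 x * indicator B (Y x) \<partial>lborel) = (\<integral>x. pp (-1) x * indicator B (Y x) \<partial>lborel)"
      if [measurable]: "B \<in> sets borel" for B
    proof -
      have "measure (M s) B = (\<integral>x. pp s x * indicator B (Y x) \<partial>lborel) / m" if "s = 1 \<or> s = -1" for s
      proof -
        have "measure (M s) B = (\<integral>x. indicator B x \<partial>M s)" by (simp add: M_def)
        also have "\<dots> = (\<integral>x. indicator B (Y x) \<partial>D s)" unfolding M_def by (rule integral_distr) auto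
        also have "\<dots> = (\<integral>x. pp s x * indicator B (Y x) \<partial>lborel) / m" by (subst DI) auto
        finally show ?thesis .
      qed
      then show ?thesis using \<open>measure (M 1) B = measure (M (-1)) B\<close> m0 by simp
    qed
    have "AE x in lborel. pp s x = 0" if s: "s = 1 \<or> s = -1" for s
    proof -
      \<comment> \<open>The set of values of \<open>Y\<close> at which \<open>G\<close> has sign
        \<open>s\<close>: its indicator keeps \<open>pp s\<close> and kills
        \<open>pp (-s)\<close>.\<close>
      define B where "B = {y. s * G (V y) > 0}"
      have [measurable]: "B \<in> sets borel" unfolding B_def by measurable
      have 1: "pp s x * indicator B (Y x) = pp s x" "pp (-s) x * indicator B (Y x) = 0" for x
        using inj[of x] s by (cases "G x = 0"; auto simp: pp_def B_def indicator_def max_def)+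
      have "(\<integral>x. pp s x * indicator B (Y x) \<partial>lborel) = (\<integral>x. pp (-s) x * indicator B (Y x) \<partial>lborel)"
        using eqB[of B] s by auto
      then have "(\<integral>x. pp s x \<partial>lborel) = 0" unfolding 1 by simp
      then show ?thesis using mm[OF s] m0 by simp
    qed
    from this[of 1] this[of "-1"] show ?thesis unfolding diff by auto
  qed
qed

text \<open>A sequence with one polynomial of each degree spans all polynomials: removing the
  leading term lowers the degree or leaves 0. This serves completeness of both bases and, with
  monomials, Gaussian integration by parts.\<close>

lemma linear_functional_zero_on_polys:
  fixes P :: "nat \<Rightarrow> real poly" and \<Phi> :: "real poly \<Rightarrow> real"
  assumes deg: "\<And>j. degree (P j) = j" "\<And>j. P j \<noteq> 0"
    and add: "\<And>p q. \<Phi> (p + q) = \<Phi> p + \<Phi> q" and smult: "\<And>c p. \<Phi> (smult c p) = c * \<Phi> p"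
    and zero: "\<And>j. \<Phi> (P j) = 0"
  shows "\<Phi> p = 0"
proof (induction "degree p" arbitrary: p rule: less_induct)
  case less
  define c where "c = lead_coeff p / lead_coeff (P (degree p))"
  define r where "r = p - smult c (P (degree p))"
  have "coeff (P (degree p)) (degree p) \<noteq> 0"
    using deg[of "degree p"] leading_coeff_0_iff[of "P (degree p)"] by simp
  then have "coeff r (degree p) = 0"
    using deg(1)[of "degree p"] by (simp add: r_def c_def)
  moreover have "degree r \<le> degree p" unfolding r_def
    by (rule degree_diff_le) (use deg(1)[of "degree p"] degree_smult_le[of c "P (degree p)"] in auto)
  ultimately have "r = 0 \<or> degree r < degree p"
    by (metis leading_coeff_0_iff order_le_less)
  then have "\<Phi> r = 0" using less[of r] smult[of 0 0] by auto
  have "\<Phi> p = \<Phi> (r + smult c (P (degree p)))" by (simp add: r_def)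
  also have "\<dots> = 0" using \<open>\<Phi> r = 0\<close> by (simp add: add smult zero)
  finally show ?case .
qed

lemma integrable_poly_mult:
  fixes w :: "real \<Rightarrow> real"
  assumes "\<And>n. integrable lborel (\<lambda>x. x ^ n * w x)"
  shows "integrable lborel (\<lambda>x. poly p x * w x)"
proof -
  have "poly p x * w x = (\<Sum>i\<le>degree p. coeff p i * (x ^ i * w x))" for x
    by (simp add: poly_altdef sum_distrib_left mult_ac)
  then show ?thesis using assms by auto
qed

subsection \<open>Hermite functions\<close>

text \<open>The recursion is the raising operator 2 x - d/dx: up to sign, this is how
  differentiating p(x) exp (- x^2) acts on p.\<close>

fun herm :: "nat \<Rightarrow> real poly" where
  "herm 0 = 1"
| "herm (Suc j) = [:0, 2:] * herm j - pderiv (herm j)"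

lemma herm_degree: "degree (herm j) = j \<and> lead_coeff (herm j) = 2 ^ j"
proof (induction j)
  case (Suc j)
  then have nz: "herm j \<noteq> 0" by (metis leading_coeff_0_iff power_not_zero zero_neq_numeral)
  have d: "degree ([:0, 2:] * herm j) = Suc j" using nz Suc by (subst degree_mult_eq) auto
  have d': "degree (pderiv (herm j)) < Suc j" using Suc by (simp add: degree_pderiv)
  have "degree (herm (Suc j)) = Suc j"
    using d d' degree_add_eq_left[of "- pderiv (herm j)" "[:0, 2:] * herm j"] by simp
  moreover have "coeff (herm (Suc j)) (Suc j) = 2 ^ Suc j"
    using conjunct1[OF Suc] conjunct2[OF Suc] d' by (simp add: coeff_eq_0 coeff_pCons)
  ultimately show ?case by simp
qed auto

lemma higher_deriv_gauss:
  "(deriv ^^ j) (\<lambda>y. exp (- (y\<^sup>2))) = (\<lambda>x::real. (- 1) ^ j * poly (herm j) x * exp (- (x\<^sup>2)))"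
proof (induction j)
  case (Suc j)
  have "((\<lambda>x. (- 1) ^ j * poly (herm j) x * exp (- (x\<^sup>2))) has_real_derivative
      (- 1) ^ Suc j * poly (herm (Suc j)) x * exp (- (x\<^sup>2))) (at x)" for x :: real
    by (auto intro!: derivative_eq_intros simp: algebra_simps)
  then show ?case using Suc by (auto intro!: DERIV_imp_deriv)
qed simp

lemma hermite_poly_eq: "hermite_poly j x = poly (herm j) x"
proof -
  have "((- 1 :: real) ^ j) * ((- 1) ^ j) = 1" by (simp flip: power_add mult_2)
  moreover have "exp (x\<^sup>2) * exp (- (x\<^sup>2)) = 1" by (simp flip: exp_add)
  ultimately have "((- 1) ^ j * (- 1) ^ j) * poly (herm j) x * (exp (x\<^sup>2) * exp (- (x\<^sup>2))) = poly (herm j) x" by simp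
  then show ?thesis unfolding hermite_poly_def higher_deriv_gauss by (simp only: mult_ac)
qed

lemma hermite_fun_eq:
  "hermite_fun j x = poly (herm j) x * exp (- (x\<^sup>2) / 2) / sqrt (2 ^ j * fact j * sqrt pi)"
  unfolding hermite_fun_def hermite_poly_eq by simp

lemma gauss_moment:
  "has_bochner_integral lborel (\<lambda>x::real. x ^ n * exp (- (x\<^sup>2)))
     (if even n then sqrt pi * (fact n / (2 ^ n * fact (n div 2))) else 0)"
proof (cases "even n")
  case True
  then obtain k where n: "n = 2 * k" by auto
  have "has_bochner_integral lborel (\<lambda>x::real. exp (- (x\<^sup>2)) * x ^ (2 * k))
     (2 *\<^sub>R ((sqrt pi / 2) * (fact (2 * k) / (2 ^ (2 * k) * fact k))))"
    by (rule has_bochner_integral_even_function[OF gaussian_moment_even_pos]) simp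
  then show ?thesis using n by (simp add: mult.commute)
next
  case False
  then obtain k where n: "n = 2 * k + 1" by (auto elim: oddE)
  have "has_bochner_integral lborel (\<lambda>x::real. exp (- (x\<^sup>2)) * x ^ (2 * k + 1)) 0"
    by (rule has_bochner_integral_odd_function[OF gaussian_moment_odd_pos]) simp
  then show ?thesis using n by (simp add: mult.commute)
qed

definition gaussint :: "real poly \<Rightarrow> real" where
  "gaussint p = (\<integral>x. poly p x * exp (- (x\<^sup>2)) \<partial>lborel)"

lemma integrable_poly_gauss: "integrable lborel (\<lambda>x. poly (p :: real poly) x * exp (- (x\<^sup>2)))"
  by (rule integrable_poly_mult) (use gauss_moment in \<open>auto intro: integrable.intros\<close>)

lemma gaussint_add: "gaussint (p + q) = gaussint p + gaussint q"
  and gaussint_diff: "gaussint (p - q) = gaussint p - gaussint q"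
  and gaussint_smult: "gaussint (smult c p) = c * gaussint p"
  unfolding gaussint_def
  using integrable_poly_gauss[of p] integrable_poly_gauss[of q]
  by (simp_all add: distrib_right left_diff_distrib mult.assoc)

lemma gaussint_monom:
  "gaussint (monom 1 n) = (if even n then sqrt pi * (fact n / (2 ^ n * fact (n div 2))) else 0)"
  using gauss_moment[of n] unfolding gaussint_def
  by (auto simp: poly_monom dest: has_bochner_integral_integral_eq)

text \<open>Integration by parts against the Gaussian weight, read off from the moments.\<close>

lemma gaussint_pderiv: "gaussint (pderiv p) = gaussint ([:0, 2:] * p)"
proof -
  have "gaussint (pderiv p) - gaussint ([:0, 2:] * p) = 0"
  proof (rule linear_functional_zero_on_polys[where P="\<lambda>j. monom 1 j" and p=p])
    show "gaussint (pderiv (p + q)) - gaussint ([:0, 2:] * (p + q)) =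
       gaussint (pderiv p) - gaussint ([:0, 2:] * p) + (gaussint (pderiv q) - gaussint ([:0, 2:] * q))" for p q
      unfolding pderiv_add distrib_left gaussint_add by simp
    show "gaussint (pderiv (smult c p)) - gaussint ([:0, 2:] * smult c p) =
       c * (gaussint (pderiv p) - gaussint ([:0, 2:] * p))" for c p
      unfolding pderiv_smult mult_smult_right gaussint_smult by (simp add: right_diff_distrib)
    fix j :: nat
    have m: "[:0, 2:] * monom 1 j = smult 2 (monom 1 (Suc j) :: real poly)"
      by (simp add: monom_Suc)
    show "gaussint (pderiv (monom 1 j)) - gaussint ([:0, 2:] * monom 1 j) = 0"
    proof (cases j)
      case 0
      then show ?thesis unfolding m gaussint_smult gaussint_monom
        by (simp add: pderiv_monom gaussint_def)
    next
      case (Suc i)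
      have "pderiv (monom 1 j) = smult (real j) (monom 1 i :: real poly)"
        using Suc by (simp add: pderiv_monom smult_monom)
      then have "gaussint (pderiv (monom 1 j)) = real j * gaussint (monom 1 i)"
        by (simp only: gaussint_smult)
      moreover have "real j * gaussint (monom 1 i) = 2 * gaussint (monom 1 (Suc j))"
      proof (cases "even i")
        case True
        then obtain b where b: "i = 2 * b" by auto
        \<comment> \<open>The recurrence of the Gaussian moments as an identity of real variables: A
          is 2 b + 1, B is b + 1, P is 2^(2 b), f is (2 b)! and g is b!.\<close>
        have ac: "A * (s * (f / (P * g))) = 2 * (s * ((2 * B * (A * f)) / (4 * P * (B * g))))"
          if "B > 0" "P > 0" "g > 0" for A B P f g s :: real
          using that by (simp add: field_simps)
        have e1: "gaussint (monom 1 i) = sqrt pi * (fact (2 * b) / (2 ^ (2 * b) * fact b))"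
          unfolding gaussint_monom b by simp
        have eqs: "fact (Suc (Suc (2 * b))) = 2 * real (Suc b) * (real (Suc (2 * b)) * fact (2 * b))"
          "(2 :: real) ^ Suc (Suc (2 * b)) = 4 * 2 ^ (2 * b)" "fact (Suc b) = real (Suc b) * fact b"
          "Suc (Suc (2 * b)) div 2 = Suc b" "even (Suc (Suc (2 * b))) = True" by simp_all
        have e2: "gaussint (monom 1 (Suc j)) = sqrt pi * ((2 * real (Suc b) * (real (Suc (2 * b)) * fact (2 * b)))
            / (4 * 2 ^ (2 * b) * (real (Suc b) * fact b)))"
          unfolding gaussint_monom Suc b eqs if_True ..
        show ?thesis unfolding e1 e2 unfolding Suc b by (rule ac) simp_all
      qed (use Suc in \<open>simp add: gaussint_monom\<close>)
      ultimately show ?thesis unfolding m gaussint_smult by simp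
    qed
  qed (auto simp: degree_monom_eq monom_eq_0_iff)
  then show ?thesis by simp
qed

text \<open>Integration by parts undoes the raising operator and trades each Hermite index for one
  derivative of \<open>q\<close>. Orthogonality follows, since \<open>j\<close> derivatives
  annihilate every polynomial of smaller degree.\<close>

lemma gaussint_herm: "gaussint (q * herm j) = gaussint ((pderiv ^^ j) q)"
proof (induction j arbitrary: q)
  case (Suc j)
  have "gaussint (q * herm (Suc j)) = gaussint ([:0, 2:] * (q * herm j)) - gaussint (q * pderiv (herm j))"
    by (simp only: herm.simps right_diff_distrib gaussint_diff mult.left_commute)
  also have "\<dots> = gaussint (pderiv q * herm j)"
    unfolding gaussint_pderiv[symmetric] pderiv_mult gaussint_add by (simp add: mult.commute)
  also have "\<dots> = gaussint ((pderiv ^^ Suc j) q)" using Suc by (simp add: funpow_swap1)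
  finally show ?case .
qed simp

lemma higher_pderiv_degree:
  fixes p :: "real poly"
  assumes "degree p \<le> j"
  shows "(pderiv ^^ j) p = [:fact j * coeff p j:]"
proof (rule poly_eqI)
  fix n
  show "coeff ((pderiv ^^ j) p) n = coeff [:fact j * coeff p j:] n"
  proof (cases n)
    case 0 then show ?thesis by (simp add: coeff_higher_pderiv pochhammer_fact)
  next
    case (Suc m) then show ?thesis using assms by (simp add: coeff_higher_pderiv coeff_eq_0)
  qed
qed

lemma gaussint_const: "gaussint [:c:] = c * sqrt pi"
  using gaussint_monom[of 0] gaussint_smult[of c "monom 1 0"] by (simp add: smult_monom monom_0)

lemma gaussint_herm_herm:
  "gaussint (herm i * herm j) = (if i = j then 2 ^ j * fact j * sqrt pi else 0)"
proof -
  have lt: "gaussint (herm i * herm j) = 0" if "i < j" for i j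
    unfolding gaussint_herm using that herm_degree[of i]
    by (subst higher_pderiv_degree) (auto simp: coeff_eq_0 gaussint_const[of 0, simplified])
  have eq: "gaussint (herm j * herm j) = 2 ^ j * fact j * sqrt pi" for j
    unfolding gaussint_herm using herm_degree[of j]
    by (subst higher_pderiv_degree) (auto simp: gaussint_const)
  show ?thesis using lt[of i j] lt[of j i] eq[of j] by (cases i j rule: linorder_cases) (auto simp: mult.commute)
qed

lemma hermite_mult: "hermite_fun i x * hermite_fun j x =
    poly (herm i * herm j) x * exp (- (x\<^sup>2)) * (1 / (sqrt (2 ^ i * fact i * sqrt pi) * sqrt (2 ^ j * fact j * sqrt pi)))"
proof -
  have "exp (- (x\<^sup>2) / 2) * exp (- (x\<^sup>2) / 2) = exp (- (x\<^sup>2))" by (simp flip: exp_add)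
  then show ?thesis unfolding hermite_fun_eq by (simp add: mult_ac)
qed

lemma hermite_orthonormal: "orthonormal_seq hermite_fun"
proof
  fix i j :: nat
  show "hermite_fun j \<in> borel_measurable lborel"
    unfolding hermite_fun_eq[abs_def] poly_altdef by measurable
  have sq: "(hermite_fun j x)\<^sup>2 = hermite_fun j x * hermite_fun j x" for x by (rule power2_eq_square)
  show "integrable lborel (\<lambda>x. (hermite_fun j x)\<^sup>2)"
    unfolding sq hermite_mult by (intro integrable_mult_left integrable_poly_gauss)
  have "(\<integral>x. hermite_fun i x * hermite_fun j x \<partial>lborel) = gaussint (herm i * herm j) *
     (1 / (sqrt (2 ^ i * fact i * sqrt pi) * sqrt (2 ^ j * fact j * sqrt pi)))"
    unfolding hermite_mult gaussint_def by (rule integral_mult_left_zero)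
  also have "\<dots> = (if i = j then 1 else 0)"
    unfolding gaussint_herm_herm by auto
  finally show "(\<integral>x. hermite_fun i x * hermite_fun j x \<partial>lborel) = (if i = j then 1 else 0)" .
qed

text \<open>A function orthogonal to all Hermite functions has vanishing integrals against all
  polynomials times exp (- x^2 / 2). The moment problem applies to \<open>g\<close> times this
  weight with \<open>Y\<close> the identity, because the Gaussian dominates exp (c |x|) for every
  \<open>c\<close>.\<close>

lemma hermite_complete:
  assumes [measurable]: "g \<in> borel_measurable lborel" and g2: "integrable lborel (\<lambda>x. (g x)\<^sup>2)"
    and orth: "\<And>j. (\<integral>x. g x * hermite_fun j x \<partial>lborel) = 0"
  shows "AE x in lborel. g x = 0"
proof -
  have half: "(exp (- (x\<^sup>2) / 2))\<^sup>2 = exp (- (x\<^sup>2))" for x :: real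
    by (simp add: power2_eq_square flip: exp_add)
  have ig: "integrable lborel (\<lambda>x. g x * (poly p x * exp (- (x\<^sup>2) / 2)))" for p
  proof (rule integrable_mult_of_squares[OF _ _ g2])
    show "(\<lambda>x. poly p x * exp (- (x\<^sup>2) / 2)) \<in> borel_measurable lborel" unfolding poly_altdef by measurable
    have "(poly p x * exp (- (x\<^sup>2) / 2))\<^sup>2 = poly (p * p) x * exp (- (x\<^sup>2))" for x
      unfolding power_mult_distrib half by (simp add: power2_eq_square)
    then show "integrable lborel (\<lambda>x. (poly p x * exp (- (x\<^sup>2) / 2))\<^sup>2)" by (simp only: integrable_poly_gauss)
  qed measurable
  define \<Phi> where "\<Phi> = (\<lambda>p. \<integral>x. g x * (poly p x * exp (- (x\<^sup>2) / 2)) \<partial>lborel)"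
  have \<Phi>0: "\<Phi> p = 0" for p
  proof (rule linear_functional_zero_on_polys[where P=herm])
    show "degree (herm j) = j" "herm j \<noteq> 0" for j
      using herm_degree[of j] by (auto simp: leading_coeff_0_iff[symmetric] simp del: leading_coeff_0_iff)
    show "\<Phi> (p + q) = \<Phi> p + \<Phi> q" for p q
      unfolding \<Phi>_def using ig[of p] ig[of q] by (simp add: distrib_right distrib_left)
    show "\<Phi> (smult c p) = c * \<Phi> p" for c p
      unfolding \<Phi>_def by (simp add: mult_ac)
    fix j
    have "(\<integral>x. g x * hermite_fun j x \<partial>lborel) = \<Phi> (herm j) / sqrt (2 ^ j * fact j * sqrt pi)"
      unfolding \<Phi>_def hermite_fun_eq by simp
    then show "\<Phi> (herm j) = 0" using orth[of j] by simp
  qed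
  have "AE x in lborel. g x * exp (- (x\<^sup>2) / 2) = 0"
  proof (rule zero_moments_imp_AE_zero[where Y="\<lambda>x. x" and V="\<lambda>x. x"])
    show "(\<integral>x. g x * exp (- (x\<^sup>2) / 2) * x ^ n \<partial>lborel) = 0" for n
      using \<Phi>0[of "monom 1 n"] unfolding \<Phi>_def by (simp add: poly_monom mult_ac)
    fix c :: real
    have "integrable lborel (\<lambda>x. g x * (exp (- (x\<^sup>2) / 2) * exp (c * \<bar>x\<bar>)))"
    proof (rule integrable_mult_of_squares[OF _ _ g2])
      \<comment> \<open>Completing the square gives 2 c |x| \<le> 2 c^2 + x^2 / 2, so a Gaussian of
        doubled variance remains. It is written with \<open>0 + (1 / sqrt 2) * x\<close> to match
        the affine substitution rule.\<close>
      have i: "integrable lborel (\<lambda>x. exp (2 * c\<^sup>2) * exp (- ((0 + (1 / sqrt 2) * x)\<^sup>2)))"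
        using lborel_integrable_real_affine_iff[of "1 / sqrt 2" "\<lambda>x. exp (- (x\<^sup>2))" 0] integrable_poly_gauss[of 1] by simp
      show "integrable lborel (\<lambda>x. (exp (- (x\<^sup>2) / 2) * exp (c * \<bar>x\<bar>))\<^sup>2)"
      proof (rule Bochner_Integration.integrable_bound[OF i])
        have "(exp (- (x\<^sup>2) / 2) * exp (c * \<bar>x\<bar>))\<^sup>2 \<le> exp (2 * c\<^sup>2) * exp (- ((0 + (1 / sqrt 2) * x)\<^sup>2))" for x :: real
        proof -
          have "2 * (2 * c) * \<bar>x\<bar> \<le> (2 * c)\<^sup>2 + x\<^sup>2" using sum_squares_bound[of "2 * c" "\<bar>x\<bar>"] by simp
          then have "2 * c * \<bar>x\<bar> - x\<^sup>2 \<le> 2 * c\<^sup>2 - x\<^sup>2 / 2" by (simp add: power2_eq_square)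
          moreover have "(exp (- (x\<^sup>2) / 2) * exp (c * \<bar>x\<bar>))\<^sup>2 = exp (2 * c * \<bar>x\<bar> - x\<^sup>2)"
            by (simp add: power2_eq_square flip: exp_add)
          moreover have "exp (2 * c\<^sup>2) * exp (- ((0 + (1 / sqrt 2) * x)\<^sup>2)) = exp (2 * c\<^sup>2 - x\<^sup>2 / 2)"
            by (simp add: power_mult_distrib power_divide flip: exp_add)
          ultimately show ?thesis by simp
        qed
        then show "AE x in lborel. norm ((exp (- (x\<^sup>2) / 2) * exp (c * \<bar>x\<bar>))\<^sup>2)
           \<le> norm (exp (2 * c\<^sup>2) * exp (- ((0 + (1 / sqrt 2) * x)\<^sup>2)))" by simp
      qed measurable
    qed measurable
    then show "integrable lborel (\<lambda>x. g x * exp (- (x\<^sup>2) / 2) * exp (c * \<bar>x\<bar>))" by (simp add: mult.assoc)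
  qed (use assms(1) in auto)
  then show ?thesis by eventually_elim simp
qed

subsection \<open>Laguerre functions\<close>

definition lag :: "nat \<Rightarrow> real poly" where
  "lag j = (\<Sum>k\<le>j. monom ((- 1) ^ k * real (j choose k) / fact k) k)"

lemma laguerre_poly_eq: "laguerre_poly j x = poly (lag j) x"
  unfolding laguerre_poly_def lag_def by (simp add: poly_sum poly_monom)

lemma coeff_lag: "coeff (lag j) k = (- 1) ^ k * real (j choose k) / fact k"
  unfolding lag_def coeff_sum by (auto simp: coeff_monom binomial_eq_0)

lemma degree_lag: "degree (lag j) = j" "lag j \<noteq> 0"
proof -
  have "coeff (lag j) j \<noteq> 0" by (simp add: coeff_lag)
  moreover have "degree (lag j) \<le> j" by (rule degree_le) (simp add: coeff_lag binomial_eq_0)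
  ultimately show "degree (lag j) = j" "lag j \<noteq> 0" using le_degree[of "lag j" j] by auto
qed

text \<open>Up to sign the left side is the j-th difference of \<open>a choose m\<close> in
  \<open>a\<close>. By Pascal's rule each difference lowers the lower index by one, and nothing is
  left once it would become negative.\<close>

lemma alternating_binomial_sum:
  "(\<Sum>k\<le>j. (- 1) ^ k * real (j choose k) * real ((a + k) choose m))
    = (if j \<le> m then (- 1) ^ j * real (a choose (m - j)) else 0)"
proof (induction j arbitrary: a)
  case (Suc j)
  define T where "T = (\<lambda>j a. \<Sum>k\<le>j. (- 1) ^ k * real (j choose k) * real ((a + k) choose m))"
  have "T (Suc j) a = real (a choose m) + (\<Sum>k\<le>j. (- 1) ^ Suc k * real (Suc j choose Suc k) * real ((a + Suc k) choose m))"
    unfolding T_def by (subst sum.atMost_Suc_shift) simp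
  also have "(\<Sum>k\<le>j. (- 1) ^ Suc k * real (Suc j choose Suc k) * real ((a + Suc k) choose m))
      = (\<Sum>k\<le>j. (- 1) ^ Suc k * real (j choose Suc k) * real ((a + Suc k) choose m)) - T j (Suc a)"
  proof -
    have "(- 1) ^ Suc k * real (Suc j choose Suc k) * real ((a + Suc k) choose m)
      = (- 1) ^ Suc k * real (j choose Suc k) * real ((a + Suc k) choose m)
        - (- 1) ^ k * real (j choose k) * real ((Suc a + k) choose m)" for k
      by (simp add: algebra_simps)
    then show ?thesis unfolding T_def by (simp only: sum_subtractf)
  qed
  also have "(\<Sum>k\<le>j. (- 1) ^ Suc k * real (j choose Suc k) * real ((a + Suc k) choose m)) = T j a - real (a choose m)"
  proof -
    have "T j a = (\<Sum>k\<le>Suc j. (- 1) ^ k * real (j choose k) * real ((a + k) choose m))"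
      unfolding T_def by (simp add: binomial_eq_0)
    then show ?thesis by (subst (asm) sum.atMost_Suc_shift) simp
  qed
  finally have "T (Suc j) a = T j a - T j (Suc a)" by simp
  then have T: "T (Suc j) a = (if j \<le> m then (- 1) ^ j * (real (a choose (m - j)) - real (Suc a choose (m - j))) else 0)"
    using Suc[of a] Suc[of "Suc a"] unfolding T_def by (simp add: right_diff_distrib)
  show ?case
  proof (cases "Suc j \<le> m")
    case True
    then have "m - j = Suc (m - Suc j)" by simp
    then show ?thesis using T True unfolding T_def by simp
  next
    case False
    then show ?thesis using T unfolding T_def by (cases "j = m") auto
  qed
qed auto

definition expint :: "real poly \<Rightarrow> real" where
  "expint p = (\<integral>x. poly p x * (exp (- x) * indicator {0<..} x) \<partial>lborel)"

lemma exp_moment: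
  "has_bochner_integral lborel (\<lambda>x::real. x ^ n * (exp (- x) * indicator {0<..} x)) (fact n)"
proof (rule has_bochner_integral_nn_integral)
  have "(\<integral>\<^sup>+x. ennreal (x ^ n * (exp (- x) * indicator {0<..} x)) \<partial>lborel)
     = (\<integral>\<^sup>+x. ennreal (x ^ n * exp (- x)) * indicator {0 ..} x \<partial>lborel)"
    by (rule nn_integral_cong_AE) (use AE_lborel_singleton[of 0] in eventually_elim, auto split: split_indicator)
  then show "(\<integral>\<^sup>+x. ennreal (x ^ n * (exp (- x) * indicator {0<..} x)) \<partial>lborel) = ennreal (fact n)"
    by (simp add: nn_intergal_power_times_exp_Ici)
qed (auto split: split_indicator)

lemma integrable_exp_moment: "integrable lborel (\<lambda>x::real. x ^ n * (exp (- x) * indicator {0<..} x))"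
  and integral_exp_moment: "(\<integral>x. (x::real) ^ n * (exp (- x) * indicator {0<..} x) \<partial>lborel) = fact n"
  using exp_moment[of n] by (auto simp: has_bochner_integral_iff)

lemma integrable_poly_exp: "integrable lborel (\<lambda>x. poly (p :: real poly) x * (exp (- x) * indicator {0<..} x))"
  by (rule integrable_poly_mult) (rule integrable_exp_moment)

lemma expint_add: "expint (p + q) = expint p + expint q"
  and expint_smult: "expint (smult c p) = c * expint p"
  unfolding expint_def
  using integrable_poly_exp[of p] integrable_poly_exp[of q]
  by (simp_all add: distrib_right mult.assoc)

text \<open>The moments are factorials, and (m + k)! / k! = m! times \<open>(m + k) choose m\<close>
  turns the integral into a finite difference of order \<open>j\<close>, which vanishes for
  \<open>m < j\<close>.\<close>

lemma expint_monom_lag: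
  "expint (monom 1 m * lag j) = (if j \<le> m then (- 1) ^ j * fact m * real (m choose j) else 0)"
proof -
  define c where "c = (\<lambda>k. (- 1) ^ k * real (j choose k) / fact k)"
  have "expint (monom 1 m * lag j) = (\<integral>x. (\<Sum>k\<le>j. c k * (x ^ (m + k) * (exp (- x) * indicator {0<..} x))) \<partial>lborel)"
  proof -
    have "poly (lag j) x = (\<Sum>k\<le>j. c k * x ^ k)" for x
      unfolding lag_def c_def by (simp add: poly_sum poly_monom)
    then have "poly (monom 1 m * lag j) x * W = (\<Sum>k\<le>j. c k * (x ^ (m + k) * W))" for x W
      by (simp add: poly_monom sum_distrib_left power_add mult_ac)
    then show ?thesis unfolding expint_def by (simp only:)
  qed
  also have "\<dots> = (\<Sum>k\<le>j. c k * fact (m + k))"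
    by (subst Bochner_Integration.integral_sum)
       (auto intro!: integrable_mult_right integrable_exp_moment simp: integral_exp_moment)
  also have "\<dots> = (\<Sum>k\<le>j. (- 1) ^ k * real (j choose k) / fact k * fact (m + k))"
    by (simp add: c_def)
  also have "\<dots> = (\<Sum>k\<le>j. fact m * ((- 1) ^ k * real (j choose k) * real ((m + k) choose m)))"
    by (intro sum.cong refl) (simp add: binomial_fact field_simps)
  also have "\<dots> = fact m * (if j \<le> m then (- 1) ^ j * real (m choose (m - j)) else 0)"
    by (simp only: sum_distrib_left[symmetric] alternating_binomial_sum)
  also have "\<dots> = (if j \<le> m then (- 1) ^ j * fact m * real (m choose j) else 0)"
    by (simp add: binomial_symmetric[of j m])
  finally show ?thesis .
qed

text \<open>Among the monomials of degree at most \<open>j\<close> only the top one survives. This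
  contains orthogonality and normalisation, the leading coefficient of \<open>lag j\<close> being
  (-1)^j / j!.\<close>

lemma expint_poly_lag:
  assumes "degree q \<le> j"
  shows "expint (q * lag j) = (- 1) ^ j * fact j * coeff q j"
proof -
  define n where "n = degree q"
  have sum_ei: "expint ((\<Sum>i\<in>A. smult (c i) (p i))) = (\<Sum>i\<in>A. c i * expint (p i))" if "finite A" for A :: "nat set" and c p
    using that by induction (simp_all add: expint_add expint_smult, simp add: expint_def)
  have "q = (\<Sum>i\<le>n. smult (coeff q i) (monom 1 i))"
    unfolding n_def using poly_as_sum_of_monoms[of q] by (simp add: smult_monom)
  then have "q * lag j = (\<Sum>i\<le>n. smult (coeff q i) (monom 1 i * lag j))"
    by (metis (no_types, lifting) mult_smult_left sum.cong sum_distrib_right)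
  then have "expint (q * lag j) = (\<Sum>i\<le>n. coeff q i * expint (monom 1 i * lag j))"
    by (simp add: sum_ei)
  also have "\<dots> = (\<Sum>i\<le>n. if i = j then (- 1) ^ j * fact j * coeff q j else 0)"
    by (intro sum.cong refl) (use assms in \<open>auto simp: expint_monom_lag n_def\<close>)
  also have "\<dots> = (- 1) ^ j * fact j * coeff q j"
    using assms by (auto simp: n_def coeff_eq_0)
  finally show ?thesis .
qed

lemma expint_lag_lag: "expint (lag i * lag j) = (if i = j then 1 else 0)"
proof -
  have lt: "expint (lag i * lag j) = 0" if "i < j" for i j
    using that by (subst expint_poly_lag) (auto simp: degree_lag coeff_lag binomial_eq_0)
  have eq: "expint (lag j * lag j) = 1" for j
    by (subst expint_poly_lag) (auto simp: degree_lag coeff_lag simp flip: power_add mult_2)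
  show ?thesis using lt[of i j] lt[of j i] eq[of j] by (cases i j rule: linorder_cases) (auto simp: mult.commute)
qed

lemma laguerre_fun_eq: "laguerre_fun j x = sqrt 2 * (poly (lag j) (2 * x) * (exp (- x) * indicator {0<..} x))"
  unfolding laguerre_fun_def laguerre_poly_eq by simp

text \<open>The argument \<open>0 + 2 * x\<close> and the factor 2 are those of the affine
  substitution that leads to the weight exp (- x).\<close>

lemma laguerre_mult: "laguerre_fun i x * laguerre_fun j x =
    2 * (poly (lag i * lag j) (0 + 2 * x) * (exp (- (0 + 2 * x)) * indicator {0<..} (0 + 2 * x)))"
proof -
  have "exp (- x) * exp (- x) = exp (- (2 * x))" by (simp flip: exp_add)
  then show ?thesis unfolding laguerre_fun_eq by (simp add: mult_ac split: split_indicator)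
qed

lemma laguerre_orthonormal: "orthonormal_seq laguerre_fun"
proof
  fix i j :: nat
  show "laguerre_fun j \<in> borel_measurable lborel"
    unfolding laguerre_fun_eq[abs_def] poly_altdef by measurable
  show "integrable lborel (\<lambda>x. (laguerre_fun j x)\<^sup>2)"
    unfolding power2_eq_square laguerre_mult
    using lborel_integrable_real_affine[OF integrable_poly_exp[of "lag j * lag j"], of 2 0] by (intro integrable_mult_right) simp
  have "(\<integral>x. laguerre_fun i x * laguerre_fun j x \<partial>lborel) = expint (lag i * lag j)"
    unfolding laguerre_mult expint_def
    by (subst lborel_integral_real_affine[of 2 "\<lambda>x. poly (lag i * lag j) x * (exp (- x) * indicator {0<..} x)" 0]) auto
  then show "(\<integral>x. laguerre_fun i x * laguerre_fun j x \<partial>lborel) = (if i = j then 1 else 0)"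
    unfolding expint_lag_lag .
qed

text \<open>Only exponential moments of small order are available here, so the moment problem is solved for
  the bounded variable \<open>exp (- x / 2)\<close> instead of \<open>x\<close>: its moments are obtained one factor at a time
  by expanding the exponential.\<close>

lemma laguerre_complete:
  assumes [measurable]: "g \<in> borel_measurable lborel" and g2: "integrable lborel (\<lambda>x. (g x)\<^sup>2)"
    and supp: "\<And>x. x \<notin> {0<..} \<Longrightarrow> g x = 0"
    and orth: "\<And>j. (\<integral>x. g x * laguerre_fun j x \<partial>lborel) = 0"
  shows "AE x in lborel. g x = 0"
proof -
  have iw: "integrable lborel (\<lambda>x. g x * (poly p x * (exp (- x / 2) * indicator {0<..} x)))" for p
  proof (rule integrable_mult_of_squares[OF _ _ g2])
    show "(\<lambda>x. poly p x * (exp (- x / 2) * indicator {0<..} x)) \<in> borel_measurable lborel" unfolding poly_altdef by measurable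
    have "(poly p x * (exp (- x / 2) * indicator {0<..} x))\<^sup>2 = poly (p * p) x * (exp (- x) * indicator {0<..} x)" for x
      by (simp add: power2_eq_square mult_ac flip: exp_add split: split_indicator)
    then show "integrable lborel (\<lambda>x. (poly p x * (exp (- x / 2) * indicator {0<..} x))\<^sup>2)" by (simp only: integrable_poly_exp)
  qed measurable
  define G where "G = (\<lambda>x. g x * exp (- x))"
  have [measurable]: "G \<in> borel_measurable borel" unfolding G_def using assms(1) by simp
  have Gs: "G x = 0" if "x \<le> 0" for x using supp[of x] that by (simp add: G_def)
  \<comment> \<open>Half of the decay exp (- x) is held in reserve: exp (x / 2) dominates all
    partial sums of the series of exp (- x / 2) on the half-line.\<close>
  have iG: "integrable lborel (\<lambda>x. G x * poly p x * exp (x / 2))" for p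
  proof -
    have "G x * poly p x * exp (x / 2) = g x * (poly p x * (exp (- x / 2) * indicator {0<..} x))" for x
    proof -
      have "exp (- x) * exp (x / 2) = exp (- x / 2)" by (simp flip: exp_add)
      then show ?thesis using supp[of x] unfolding G_def by (auto split: split_indicator)
    qed
    then have "(\<lambda>x. G x * poly p x * exp (x / 2)) = (\<lambda>x. g x * (poly p x * (exp (- x / 2) * indicator {0<..} x)))"
      by (rule ext)
    then show ?thesis using iw[of p] by (simp only:)
  qed
  have iG': "integrable lborel (\<lambda>x. G x * poly p x * h x)"
    if [measurable]: "h \<in> borel_measurable borel" and h: "\<And>x. x > 0 \<Longrightarrow> \<bar>h x\<bar> \<le> exp (x / 2)" for p h
  proof (rule Bochner_Integration.integrable_bound[OF iG[of p]])
    show "(\<lambda>x. G x * poly p x * h x) \<in> borel_measurable lborel" unfolding poly_altdef by measurable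
    have "norm (G x * poly p x * h x) \<le> norm (G x * poly p x * exp (x / 2))" for x
      using h[of x] Gs[of x] by (cases "x > 0") (auto simp: abs_mult intro!: mult_left_mono)
    then show "AE x in lborel. norm (G x * poly p x * h x) \<le> norm (G x * poly p x * exp (x / 2))" by simp
  qed
  define \<Phi> where "\<Phi> = (\<lambda>p. \<integral>x. G x * poly p (2 * x) \<partial>lborel)"
  have iG2: "integrable lborel (\<lambda>x. G x * poly p (2 * x))" for p
    using iG'[of "\<lambda>_. 1" "pcompose p [:0, 2:]"] by (simp add: poly_pcompose mult.commute)
  have \<Phi>0: "\<Phi> p = 0" for p
  proof (rule linear_functional_zero_on_polys[where P=lag])
    show "\<Phi> (p + q) = \<Phi> p + \<Phi> q" for p q
      unfolding \<Phi>_def using iG2[of p] iG2[of q] by (simp add: distrib_left)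
    show "\<Phi> (smult c p) = c * \<Phi> p" for c p
      unfolding \<Phi>_def by (simp add: mult_ac)
    fix j
    have "g x * laguerre_fun j x = sqrt 2 * (G x * poly (lag j) (2 * x))" for x
      using supp[of x] unfolding laguerre_fun_eq G_def by (auto split: split_indicator)
    then have "(\<integral>x. g x * laguerre_fun j x \<partial>lborel) = sqrt 2 * \<Phi> (lag j)"
      unfolding \<Phi>_def by simp
    then show "\<Phi> (lag j) = 0" using orth[of j] by simp
  qed (rule degree_lag)+
  \<comment> \<open>The induction on \<open>k\<close> needs all powers \<open>n\<close> at once:
    expanding one factor exp (- x / 2) produces terms with \<open>k\<close> unchanged and arbitrary
    higher powers of x, all zero by hypothesis; dominated convergence passes to the limit.\<close>
  have mom: "(\<integral>x. G x * x ^ n * exp (- x / 2) ^ k \<partial>lborel) = 0" for n k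
  proof (induction k arbitrary: n)
    case 0
    have "G x * poly (monom 1 n) (2 * x) = 2 ^ n * (G x * x ^ n)" for x
      by (simp add: poly_monom power_mult_distrib)
    then have "(2::real) ^ n * (\<integral>x. G x * x ^ n \<partial>lborel) = \<Phi> (monom 1 n)"
      unfolding \<Phi>_def by (simp only: integral_mult_right_zero)
    then show ?case using \<Phi>0 by simp
  next
    case (Suc k)
    define S where "S = (\<lambda>N x :: real. \<Sum>m<N. (- x / 2) ^ m / fact m)"
    define H where "H = (\<lambda>x. G x * x ^ n * exp (- x / 2) ^ k)"
    have [measurable]: "H \<in> borel_measurable borel" "S N \<in> borel_measurable borel" for N
      unfolding H_def S_def by measurable
    have ek: "exp (- x / 2) ^ k \<le> 1" if "x > 0" for x :: real
      using that by (intro power_le_one) auto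
    have Sb: "\<bar>S N x\<bar> \<le> exp (x / 2)" if "x > 0" for N x
    proof -
      have "\<bar>S N x\<bar> \<le> (\<Sum>m<N. \<bar>(- x / 2) ^ m / fact m\<bar>)" unfolding S_def by (rule sum_abs)
      also have "\<dots> = (\<Sum>m<N. (x / 2) ^ m / fact m)" using that by (simp add: power_abs abs_divide)
      also have "\<dots> \<le> exp (x / 2)" by (rule exp_partial_sum_le) (use that in simp)
      finally show ?thesis .
    qed
    have iHm: "integrable lborel (\<lambda>x. H x * (- x / 2) ^ m)" for m
    proof -
      have "H x * (- x / 2) ^ m = G x * poly (monom ((- 1 / 2) ^ m) (n + m)) x * exp (- x / 2) ^ k" for x
        unfolding H_def by (simp add: poly_monom power_add power_divide power_mult_distrib[symmetric] field_simps)
      moreover have "integrable lborel (\<lambda>x. G x * poly (monom ((- 1 / 2) ^ m) (n + m)) x * exp (- x / 2) ^ k)"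
      proof (rule iG')
        fix x :: real assume x: "x > 0"
        have "exp (- x / 2) ^ k \<le> exp (x / 2)" by (rule order_trans[OF ek[OF x]]) (use x in simp)
        then show "\<bar>exp (- x / 2) ^ k\<bar> \<le> exp (x / 2)" by simp
      qed measurable
      ultimately show ?thesis by simp
    qed
    have "(\<integral>x. H x * S N x \<partial>lborel) = 0" for N
    proof -
      have "(\<integral>x. H x * S N x \<partial>lborel) = (\<Sum>m<N. (\<integral>x. H x * (- x / 2) ^ m \<partial>lborel) / fact m)"
        unfolding S_def sum_distrib_left using iHm by (subst Bochner_Integration.integral_sum) auto
      also have "\<dots> = 0"
      proof (intro sum.neutral ballI)
        fix m
        have "H x * (- x / 2) ^ m = (- 1 / 2) ^ m * (G x * x ^ (n + m) * exp (- x / 2) ^ k)" for x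
        proof -
          have "(- x / 2) ^ m = (- 1 / 2) ^ m * x ^ m" by (simp flip: power_mult_distrib)
          then show ?thesis unfolding H_def by (simp add: power_add)
        qed
        then show "(\<integral>x. H x * (- x / 2) ^ m \<partial>lborel) / fact m = 0" using Suc[of "n + m"] by simp
      qed
      finally show ?thesis .
    qed
    moreover have "(\<lambda>N. \<integral>x. H x * S N x \<partial>lborel) \<longlonglongrightarrow> (\<integral>x. H x * exp (- x / 2) \<partial>lborel)"
    proof (rule integral_dominated_convergence[where w="\<lambda>x. \<bar>G x * poly (monom 1 n) x * exp (x / 2)\<bar>"])
      show "integrable lborel (\<lambda>x. \<bar>G x * poly (monom 1 n) x * exp (x / 2)\<bar>)"
        by (rule integrable_abs) (rule iG)
      show "AE x in lborel. (\<lambda>N. H x * S N x) \<longlonglongrightarrow> H x * exp (- x / 2)"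
      proof (rule AE_I2, rule tendsto_mult_left)
        fix x :: real
        show "(\<lambda>N. S N x) \<longlonglongrightarrow> exp (- x / 2)"
          using summable_LIMSEQ[OF summable_exp_generic[of "- x / 2"]]
          unfolding S_def exp_def by (simp add: field_simps)
      qed
      show "AE x in lborel. norm (H x * S N x) \<le> \<bar>G x * poly (monom 1 n) x * exp (x / 2)\<bar>" for N
      proof (rule AE_I2)
        fix x
        show "norm (H x * S N x) \<le> \<bar>G x * poly (monom 1 n) x * exp (x / 2)\<bar>"
        proof (cases "x > 0")
          case True
          have "\<bar>exp (- x / 2) ^ k * S N x\<bar> \<le> 1 * exp (x / 2)"
            unfolding abs_mult using ek[OF True] Sb[OF True] by (intro mult_mono) auto
          then have "\<bar>G x * x ^ n\<bar> * \<bar>exp (- x / 2) ^ k * S N x\<bar> \<le> \<bar>G x * x ^ n\<bar> * exp (x / 2)"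
            by (intro mult_left_mono) auto
          then show ?thesis unfolding H_def by (simp add: poly_monom abs_mult mult_ac)
        next
          case False then show ?thesis using Gs[of x] by (simp add: H_def)
        qed
      qed
    qed measurable
    ultimately have "(\<integral>x. H x * exp (- x / 2) \<partial>lborel) = 0"
      by (simp add: LIMSEQ_const_iff)
    then show ?case unfolding H_def by (simp add: mult_ac)
  qed
  have "AE x in lborel. G x = 0"
  proof (rule zero_moments_imp_AE_zero[where Y="\<lambda>x. exp (- x / 2)" and V="\<lambda>y. - 2 * ln y"])
    show "(\<integral>x. G x * exp (- x / 2) ^ n \<partial>lborel) = 0" for n using mom[of 0 n] by simp
    fix c :: real
    have i1: "integrable lborel (\<lambda>x. \<bar>G x\<bar> * exp \<bar>c\<bar>)"
      using iG'[of "\<lambda>_. 1" 1] by (intro integrable_mult_left integrable_abs) simp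
    show "integrable lborel (\<lambda>x. G x * exp (c * \<bar>exp (- x / 2)\<bar>))"
    proof (rule Bochner_Integration.integrable_bound[OF i1])
      have "norm (G x * exp (c * \<bar>exp (- x / 2)\<bar>)) \<le> norm (\<bar>G x\<bar> * exp \<bar>c\<bar>)" for x
      proof (cases "x > 0")
        case True
        have "c * exp (- x / 2) \<le> \<bar>c\<bar> * 1"
          using True by (intro mult_mono) auto
        then show ?thesis by (auto simp: abs_mult intro!: mult_left_mono)
      next
        case False then show ?thesis using Gs[of x] by simp
      qed
      then show "AE x in lborel. norm (G x * exp (c * \<bar>exp (- x / 2)\<bar>)) \<le> norm (\<bar>G x\<bar> * exp \<bar>c\<bar>)" by simp
    qed measurable
  qed (auto)
  then show ?thesis unfolding G_def by eventually_elim simp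
qed

subsection \<open>The basis and the sampling model\<close>

lemma nn_integral_PiM_sum_square:
  fixes g :: "'b \<Rightarrow> real" and I :: "'i set"
  assumes "prob_space M" "finite I" and [measurable]: "g \<in> borel_measurable M"
    and g2: "integrable M (\<lambda>x. (g x)\<^sup>2)" and g0: "(\<integral>x. g x \<partial>M) = 0"
  shows "(\<integral>\<^sup>+X. ennreal ((\<Sum>i\<in>I. g (X i))\<^sup>2) \<partial>PiM I (\<lambda>_. M))
    = ennreal (real (card I) * (\<integral>x. (g x)\<^sup>2 \<partial>M))"
  using assms(2)
proof (induction I rule: finite_induct)
  case empty
  then show ?case by (simp add: PiM_empty nn_integral_count_space_finite)
next
  case (insert i I)
  interpret prob_space M by fact
  interpret P: prob_space "PiM I (\<lambda>_. M)" by (rule prob_space_PiM) (rule prob_space_axioms)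
  have ig: "integrable M g" using square_integrable_imp_integrable[OF assms(3) g2] .
  define V where "V = (\<integral>x. (g x)\<^sup>2 \<partial>M)"
  have V0: "V \<ge> 0" unfolding V_def by simp
  have [measurable]: "(\<lambda>X. g (X i')) \<in> borel_measurable (PiM I' (\<lambda>_. M))" if "i' \<in> I'" for i' I'
    using that by measurable
  have inner: "(\<integral>\<^sup>+y. ennreal ((s + g y)\<^sup>2) \<partial>M) = ennreal (s\<^sup>2) + ennreal V" for s :: real
  proof -
    have i: "integrable M (\<lambda>y. (s + g y)\<^sup>2)" unfolding power2_sum using ig g2 by auto
    then have "(\<integral>\<^sup>+y. ennreal ((s + g y)\<^sup>2) \<partial>M) = ennreal (\<integral>y. (s + g y)\<^sup>2 \<partial>M)"
      by (rule nn_integral_eq_integral) auto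
    also have "(\<integral>y. (s + g y)\<^sup>2 \<partial>M) = s\<^sup>2 + V"
      unfolding power2_sum V_def using ig g2 g0 by (simp add: prob_space)
    finally show ?thesis using V0 by simp
  qed
  have "(\<integral>\<^sup>+X. ennreal ((\<Sum>i\<in>insert i I. g (X i))\<^sup>2) \<partial>PiM (insert i I) (\<lambda>_. M))
      = (\<integral>\<^sup>+X. (\<integral>\<^sup>+y. ennreal (((\<Sum>i'\<in>I. g (X i')) + g y)\<^sup>2) \<partial>M) \<partial>PiM I (\<lambda>_. M))"
    using nn_integral_PiM_insert_sum[OF assms(1) insert(1,2), where g="\<lambda>x (_ :: unit). g x"
        and F="\<lambda>S. ennreal ((S ())\<^sup>2)"] by simp
  also have "\<dots> = (\<integral>\<^sup>+X. ennreal ((\<Sum>i'\<in>I. g (X i'))\<^sup>2) \<partial>PiM I (\<lambda>_. M)) + ennreal V"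
    unfolding inner by (subst nn_integral_add) (auto simp: P.emeasure_space_1)
  also have "\<dots> = ennreal (real (card (insert i I)) * V)"
    unfolding insert.IH V_def[symmetric] using insert(1,2) V0 by (simp add: distrib_right flip: ennreal_plus)
  finally show ?case unfolding V_def .
qed

lemma nn_integral_PiM_sum:
  fixes g :: "'b \<Rightarrow> ennreal" and I :: "'i set"
  assumes "prob_space M" "finite I" and [measurable]: "g \<in> borel_measurable M"
  shows "(\<integral>\<^sup>+X. (\<Sum>i\<in>I. g (X i)) \<partial>PiM I (\<lambda>_. M)) = of_nat (card I) * (\<integral>\<^sup>+x. g x \<partial>M)"
proof -
  interpret product_prob_space "\<lambda>_::'i. M" I
    by (simp add: product_prob_space_def product_prob_space_axioms_def product_sigma_finite_def
        assms(1) prob_space_imp_sigma_finite)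
  have "(\<integral>\<^sup>+X. (\<Sum>i\<in>I. g (X i)) \<partial>PiM I (\<lambda>_. M)) = (\<Sum>i\<in>I. \<integral>\<^sup>+X. g (X i) \<partial>PiM I (\<lambda>_. M))"
    by (rule nn_integral_sum) measurable
  also have "\<dots> = (\<Sum>i\<in>I. \<integral>\<^sup>+x. g x \<partial>M)"
  proof (rule sum.cong[OF refl])
    fix i assume i: "i \<in> I"
    have "(\<integral>\<^sup>+x. g x \<partial>distr (PiM I (\<lambda>_. M)) M (\<lambda>X. X i)) = (\<integral>\<^sup>+X. g (X i) \<partial>PiM I (\<lambda>_. M))"
      by (rule nn_integral_distr) (use i in measurable)
    then show "(\<integral>\<^sup>+X. g (X i) \<partial>PiM I (\<lambda>_. M)) = (\<integral>\<^sup>+x. g x \<partial>M)"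
      using PiM_component[OF i] by simp
  qed
  finally show ?thesis by simp
qed

section \<open>Both cases as one complete orthonormal system\<close>

lemma phi_orthonormal: "orthonormal_seq (phi c)"
  using hermite_orthonormal laguerre_orthonormal by (cases c) (simp_all)

lemma phi_outside: "x \<notin> supp c \<Longrightarrow> phi c j x = 0"
  by (cases c) (auto simp: laguerre_fun_def)

lemma supp_borel [measurable]: "supp c \<in> sets borel"
  by (cases c) auto

lemma phi_complete:
  assumes "g \<in> borel_measurable lborel" "integrable lborel (\<lambda>x. (g x)\<^sup>2)"
    and "\<And>x. x \<notin> supp c \<Longrightarrow> g x = 0" "\<And>j. (\<integral>x. g x * phi c j x \<partial>lborel) = 0"
  shows "AE x in lborel. g x = 0"
  using assms hermite_complete[of g] laguerre_complete[of g] by (cases c) auto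

lemma l2_inner_eq:
  assumes "\<And>x. x \<notin> A \<Longrightarrow> g x * h x = 0"
  shows "l2_inner A g h = (\<integral>x. g x * h x \<partial>lborel)"
  unfolding l2_inner_def set_lebesgue_integral_def
  by (rule Bochner_Integration.integral_cong) (use assms in \<open>auto split: split_indicator\<close>)

lemma l2_norm_square:
  assumes "\<And>x. x \<notin> A \<Longrightarrow> g x = 0"
  shows "(l2_norm A g)\<^sup>2 = (\<integral>x. (g x)\<^sup>2 \<partial>lborel)"
  unfolding l2_norm_def using l2_inner_eq[of A g g] assms by (simp add: power2_eq_square)

locale density_model =
  fixes c :: basis_case and f :: "real \<Rightarrow> real"
  assumes dens: "l2_density (supp c) f"
begin

sublocale orthonormal_seq "phi c" by (rule phi_orthonormal)

lemma phi_borel [measurable]: "phi c j \<in> borel_measurable borel" using e_meas by simp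

lemma f_borel [measurable]: "f \<in> borel_measurable borel"
  and f_nonneg: "f x \<ge> 0" and f_outside: "x \<notin> supp c \<Longrightarrow> f x = 0"
  and f_mass: "(\<integral>\<^sup>+x. ennreal (f x) \<partial>lborel) = 1"
  using dens by (auto simp: l2_density_def)

lemma f_square: "integrable lborel (\<lambda>x. (f x)\<^sup>2)"
proof -
  have "integrable lborel (\<lambda>x. indicator (supp c) x *\<^sub>R (f x)\<^sup>2)"
    using dens by (simp add: l2_density_def set_integrable_def)
  also have "(\<lambda>x. indicator (supp c) x *\<^sub>R (f x)\<^sup>2) = (\<lambda>x. (f x)\<^sup>2)"
    using f_outside by (auto simp: fun_eq_iff split: split_indicator)
  finally show ?thesis .
qed

abbreviation "a \<equiv> coef c f"

lemma coef_eq: "a j = (\<integral>x. f x * phi c j x \<partial>lborel)"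
  unfolding coef_def by (rule l2_inner_eq) (simp add: f_outside)

lemma f_norm: "(l2_norm (supp c) f)\<^sup>2 = (\<integral>x. (f x)\<^sup>2 \<partial>lborel)"
  by (rule l2_norm_square) (rule f_outside)

lemma coef_sums: "(\<lambda>j. (a j)\<^sup>2) sums (l2_norm (supp c) f)\<^sup>2"
  unfolding coef_eq f_norm
  by (rule parseval[where A="supp c"]) (use f_square f_outside phi_outside phi_complete[of _ c] in auto)

lemma coef_sum_le: "(\<Sum>j<k. (a j)\<^sup>2) \<le> (l2_norm (supp c) f)\<^sup>2"
  using sum_le_suminf[OF sums_summable[OF coef_sums], of "{..<k}"] sums_unique[OF coef_sums] by simp

lemma dist_square:
  "(l2_norm (supp c) (\<lambda>x. (\<Sum>j<m. u j * phi c j x) - f x))\<^sup>2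
    = (\<Sum>j<m. (u j - a j)\<^sup>2) + ((l2_norm (supp c) f)\<^sup>2 - (\<Sum>j<m. (a j)\<^sup>2))"
proof -
  have "(l2_norm (supp c) (\<lambda>x. (\<Sum>j<m. u j * phi c j x) - f x))\<^sup>2
     = (\<integral>x. ((\<Sum>j<m. u j * phi c j x) - f x)\<^sup>2 \<partial>lborel)"
    by (rule l2_norm_square) (simp add: phi_outside f_outside)
  also have "\<dots> = (\<Sum>j<m. (u j - a j)\<^sup>2) + ((l2_norm (supp c) f)\<^sup>2 - (\<Sum>j<m. (a j)\<^sup>2))"
    using square_dist_comb[where f=f and m=m and u=u] f_square by (simp add: coef_eq f_norm)
  finally show ?thesis .
qed

lemma prob_space_law: "prob_space (law f)"
  unfolding law_def by (rule prob_spaceI) (simp add: emeasure_density f_mass)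

sublocale L: prob_space "law f" by (rule prob_space_law)

lemma sets_law [simp, measurable_cong]: "sets (law f) = sets borel" by (simp add: law_def)

lemma space_law [simp]: "space (law f) = UNIV" by (simp add: law_def)

lemma prob_law_UNIV [simp]: "measure (law f) UNIV = 1" using L.prob_space by simp

lemma integrable_law:
  "h \<in> borel_measurable borel \<Longrightarrow> integrable (law f) h \<longleftrightarrow> integrable lborel (\<lambda>x. f x * h x)"
  unfolding law_def by (rule integrable_real_density) (auto simp: f_nonneg)

lemma integral_law:
  "h \<in> borel_measurable borel \<Longrightarrow> (\<integral>x. h x \<partial>law f) = (\<integral>x. f x * h x \<partial>lborel)"
  unfolding law_def by (rule integral_real_density) (auto simp: f_nonneg)

lemma AE_law: "AE x in lborel. x \<in> supp c \<longrightarrow> P x \<Longrightarrow> AE x in law f. P x"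
  unfolding law_def
  by (subst AE_density) (use f_outside in \<open>auto elim!: eventually_mono\<close>)

lemma phi_mean: "(\<integral>x. phi c j x \<partial>law f) = a j"
  by (simp add: integral_law coef_eq)

end

text \<open>Real numbers replace the extended quantities of the statement: \<open>v\<close> is the
  value of \<open>vf c f\<close>, and \<open>s\<close> an almost sure bound on \<open>f\<close>. The
  class bounds the square of the sup norm by C, so \<open>s\<close> becomes sqrt C in the
  end.\<close>

locale basis_model = density_model +
  fixes C\<phi> v s :: real
  assumes basis: "basis_const c C\<phi>"
    and vf: "vf c f = ennreal v" and v0: "v \<ge> 0"
    and sup: "AE x in lborel. f x \<le> s" and s1: "s \<ge> 1"
begin

lemma C1: "C\<phi> \<ge> 1" using basis by (simp add: basis_const_def)

lemma v1: "v \<ge> 1"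
proof -
  have "1 \<le> ennreal v" unfolding vf[symmetric] vf_def by simp
  then show ?thesis using v0 by (simp add: ennreal_ge_1)
qed

lemma phi_sq_integrable: "integrable (law f) (\<lambda>x. (phi c j x)\<^sup>2)"
  and phi_sq_sum: "k \<ge> 1 \<Longrightarrow> (\<Sum>j<k. \<integral>x. (phi c j x)\<^sup>2 \<partial>law f) \<le> C\<phi> * v * sqrt (real k)"
proof -
  have b: "(\<Sum>j<k. \<integral>\<^sup>+x. ennreal ((phi c j x)\<^sup>2) \<partial>law f) \<le> ennreal (C\<phi> * v * sqrt (real k))" if "k \<ge> 1" for k
  proof -
    have "(\<Sum>j<k. \<integral>\<^sup>+x. ennreal ((phi c j x)\<^sup>2) \<partial>law f) \<le> ennreal C\<phi> * vf c f * ennreal (sqrt (real k))"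
      using basis dens that unfolding basis_const_def by blast
    also have "\<dots> = ennreal (C\<phi> * v * sqrt (real k))" using C1 v0 vf by (simp add: ennreal_mult)
    finally show ?thesis .
  qed
  \<comment> \<open>The square of one basis function is a summand of the sum up to
    \<open>Suc j\<close>, whose expectation has a finite bound.\<close>
  have i: "integrable (law f) (\<lambda>x. (phi c j x)\<^sup>2)" for j
  proof (rule integrableI_nonneg)
    have "(\<integral>\<^sup>+x. ennreal ((phi c j x)\<^sup>2) \<partial>law f) \<le> (\<Sum>j<Suc j. \<integral>\<^sup>+x. ennreal ((phi c j x)\<^sup>2) \<partial>law f)"
      by simp
    also have "\<dots> \<le> ennreal (C\<phi> * v * sqrt (real (Suc j)))" by (rule b) simp
    finally show "(\<integral>\<^sup>+x. ennreal ((phi c j x)\<^sup>2) \<partial>law f) < \<infinity>" by (rule order_le_less_trans) simp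
  qed auto
  show "integrable (law f) (\<lambda>x. (phi c j x)\<^sup>2)" by (rule i)
  assume k: "k \<ge> 1"
  have "ennreal (\<Sum>j<k. \<integral>x. (phi c j x)\<^sup>2 \<partial>law f) = (\<Sum>j<k. \<integral>\<^sup>+x. ennreal ((phi c j x)\<^sup>2) \<partial>law f)"
  proof -
    have "(\<Sum>j<k. \<integral>\<^sup>+x. ennreal ((phi c j x)\<^sup>2) \<partial>law f) = (\<Sum>j<k. ennreal (\<integral>x. (phi c j x)\<^sup>2 \<partial>law f))"
      by (intro sum.cong nn_integral_eq_integral i) auto
    also have "\<dots> = ennreal (\<Sum>j<k. \<integral>x. (phi c j x)\<^sup>2 \<partial>law f)" by (rule sum_ennreal) simp
    finally show ?thesis by simp
  qed
  then have "ennreal (\<Sum>j<k. \<integral>x. (phi c j x)\<^sup>2 \<partial>law f) \<le> ennreal (C\<phi> * v * sqrt (real k))"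
    using b[OF k] by simp
  then show "(\<Sum>j<k. \<integral>x. (phi c j x)\<^sup>2 \<partial>law f) \<le> C\<phi> * v * sqrt (real k)"
    using C1 v0 by (subst (asm) ennreal_le_iff) auto
qed

lemma phi_integrable: "integrable (law f) (phi c j)"
  by (rule L.square_integrable_imp_integrable) (auto intro: phi_sq_integrable)

section \<open>One centred observation: sup bound, total variance, weak variance\<close>

definition "Y = (\<lambda>x j. phi c j x - a j)"

lemma Y_measurable [measurable]: "(\<lambda>x. Y x j) \<in> borel_measurable (law f)"
  unfolding Y_def by measurable

lemma Y_mean: "(\<integral>x. Y x j \<partial>law f) = 0"
  unfolding Y_def using phi_integrable[of j] phi_mean[of j] by (simp add: L.prob_space)

lemma Y_square: "(\<integral>x. (Y x j)\<^sup>2 \<partial>law f) \<le> (\<integral>x. (phi c j x)\<^sup>2 \<partial>law f)"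
  "integrable (law f) (\<lambda>x. (Y x j)\<^sup>2)"
proof -
  have "(Y x j)\<^sup>2 = (phi c j x)\<^sup>2 - 2 * a j * phi c j x + (a j)\<^sup>2" for x
    unfolding Y_def by (simp add: power2_diff)
  then show "(\<integral>x. (Y x j)\<^sup>2 \<partial>law f) \<le> (\<integral>x. (phi c j x)\<^sup>2 \<partial>law f)"
    "integrable (law f) (\<lambda>x. (Y x j)\<^sup>2)"
    using phi_integrable[of j] phi_sq_integrable[of j] phi_mean[of j]
    by (auto simp: L.prob_space power2_eq_square)
qed

lemma Y_total:
  assumes "k \<ge> 1"
  shows "(\<integral>x. (\<Sum>j<k. (Y x j)\<^sup>2) \<partial>law f) \<le> C\<phi> * v * sqrt (real k)"
proof -
  have "(\<integral>x. (\<Sum>j<k. (Y x j)\<^sup>2) \<partial>law f) = (\<Sum>j<k. \<integral>x. (Y x j)\<^sup>2 \<partial>law f)"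
    by (rule Bochner_Integration.integral_sum) (rule Y_square)
  also have "\<dots> \<le> (\<Sum>j<k. \<integral>x. (phi c j x)\<^sup>2 \<partial>law f)" by (intro sum_mono Y_square)
  also have "\<dots> \<le> C\<phi> * v * sqrt (real k)" by (rule phi_sq_sum[OF assms])
  finally show ?thesis .
qed

lemma phi_sup:
  assumes "k \<ge> 1"
  shows "AE x in law f. (\<Sum>j<k. (phi c j x)\<^sup>2) \<le> C\<phi> * real k powr dexp c"
proof (rule AE_law)
  let ?g = "\<lambda>x. ennreal (\<bar>\<Sum>j<k. (phi c j x)\<^sup>2\<bar> * indicator (supp c) x)"
  have "AE x in lborel. ?g x \<le> esssup lborel ?g" by (rule esssup_AE)
  moreover have "esssup lborel ?g \<le> ennreal (C\<phi> * real k powr dexp c)"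
    using basis assms by (simp add: basis_const_def linf_norm_def)
  ultimately have "AE x in lborel. ?g x \<le> ennreal (C\<phi> * real k powr dexp c)"
    by (auto elim!: eventually_mono intro: order_trans)
  then show "AE x in lborel. x \<in> supp c \<longrightarrow> (\<Sum>j<k. (phi c j x)\<^sup>2) \<le> C\<phi> * real k powr dexp c"
  proof eventually_elim
    fix x assume "?g x \<le> ennreal (C\<phi> * real k powr dexp c)"
    moreover have "0 \<le> C\<phi> * real k powr dexp c" using C1 by simp
    ultimately show "x \<in> supp c \<longrightarrow> (\<Sum>j<k. (phi c j x)\<^sup>2) \<le> C\<phi> * real k powr dexp c"
      by (auto simp: ennreal_le_iff sum_nonneg)
  qed
qed

text \<open>Centring at most doubles the norm: each squared coefficient is at most the mean of the
  squared basis function, so the vector of means obeys the same bound as the observations.\<close>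

lemma Y_sup:
  assumes "k \<ge> 1"
  shows "AE x in law f. (\<Sum>j<k. (Y x j)\<^sup>2) \<le> (2 * sqrt (C\<phi> * real k powr dexp c))\<^sup>2"
proof -
  define B where "B = C\<phi> * real k powr dexp c"
  have B0: "B \<ge> 0" using C1 by (simp add: B_def)
  have a2: "(\<Sum>j<k. (a j)\<^sup>2) \<le> B"
  proof -
    have "(\<Sum>j<k. (a j)\<^sup>2) \<le> (\<Sum>j<k. \<integral>x. (phi c j x)\<^sup>2 \<partial>law f)"
    proof (rule sum_mono)
      fix j
      have "0 \<le> (\<integral>x. (Y x j)\<^sup>2 \<partial>law f)" by (rule Bochner_Integration.integral_nonneg) simp
      also have "(\<integral>x. (Y x j)\<^sup>2 \<partial>law f) = (\<integral>x. (phi c j x)\<^sup>2 - 2 * a j * phi c j x + (a j)\<^sup>2 \<partial>law f)"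
        unfolding Y_def by (simp add: power2_diff algebra_simps)
      also have "\<dots> = (\<integral>x. (phi c j x)\<^sup>2 \<partial>law f) - (a j)\<^sup>2"
        using phi_integrable[of j] phi_sq_integrable[of j] phi_mean[of j]
        by (simp add: L.prob_space power2_eq_square)
      finally show "(a j)\<^sup>2 \<le> (\<integral>x. (phi c j x)\<^sup>2 \<partial>law f)" by simp
    qed
    also have "\<dots> = (\<integral>x. (\<Sum>j<k. (phi c j x)\<^sup>2) \<partial>law f)"
      by (rule Bochner_Integration.integral_sum[symmetric]) (rule phi_sq_integrable)
    also have "\<dots> \<le> (\<integral>x. B \<partial>law f)"
      by (rule integral_mono_AE) (use phi_sup[OF assms] phi_sq_integrable in \<open>auto simp: B_def\<close>)
    also have "\<dots> = B" by (simp add: L.prob_space)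
    finally show ?thesis .
  qed
  show ?thesis using phi_sup[OF assms] unfolding B_def[symmetric]
  proof eventually_elim
    fix x assume x: "(\<Sum>j<k. (phi c j x)\<^sup>2) \<le> B"
    have "(\<Sum>j<k. (Y x j)\<^sup>2) \<le> (\<Sum>j<k. 2 * (phi c j x)\<^sup>2 + 2 * (a j)\<^sup>2)"
    proof (rule sum_mono)
      fix j
      show "(Y x j)\<^sup>2 \<le> 2 * (phi c j x)\<^sup>2 + 2 * (a j)\<^sup>2"
        unfolding Y_def power2_diff using sum_squares_bound[of "phi c j x" "- a j"] by simp
    qed
    also have "\<dots> = 2 * (\<Sum>j<k. (phi c j x)\<^sup>2) + 2 * (\<Sum>j<k. (a j)\<^sup>2)" by (simp add: sum.distrib sum_distrib_left)
    also have "\<dots> \<le> (2 * sqrt B)\<^sup>2" using x a2 B0 by (simp add: power_mult_distrib)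
    finally show "(\<Sum>j<k. (Y x j)\<^sup>2) \<le> (2 * sqrt B)\<^sup>2" .
  qed
qed

text \<open>By orthonormality a combination with coefficients of length at most one has L2 norm at
  most one, so a bound on the density bounds its second moment. The bound is independent of
  \<open>k\<close>, in contrast to the total variance.\<close>

lemma Y_weak:
  assumes u: "(\<Sum>j<k. (u j)\<^sup>2) \<le> 1"
  shows "(\<integral>x. (\<Sum>j<k. u j * Y x j)\<^sup>2 \<partial>law f) \<le> s"
proof -
  define g where "g = (\<lambda>x. \<Sum>j<k. u j * phi c j x)"
  define m where "m = (\<Sum>j<k. u j * a j)"
  have [measurable]: "g \<in> borel_measurable borel" unfolding g_def by measurable
  have gi: "integrable (law f) g" unfolding g_def
    by (intro Bochner_Integration.integrable_sum integrable_mult_right phi_integrable)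
  have g2: "integrable lborel (\<lambda>x. (g x)\<^sup>2)" "(\<integral>x. (g x)\<^sup>2 \<partial>lborel) \<le> 1"
    unfolding g_def using comb_square_integral[of u k] u by auto
  have fg: "AE x in lborel. f x * (g x)\<^sup>2 \<le> s * (g x)\<^sup>2"
    using sup by eventually_elim (auto intro: mult_right_mono)
  have i: "integrable lborel (\<lambda>x. f x * (g x)\<^sup>2)"
    by (rule Bochner_Integration.integrable_bound[of _ "\<lambda>x. s * (g x)\<^sup>2"])
       (use fg g2 f_nonneg s1 in \<open>auto simp: abs_mult elim!: eventually_mono\<close>)
  then have g2l: "integrable (law f) (\<lambda>x. (g x)\<^sup>2)" by (simp add: integrable_law)
  have mg: "(\<integral>x. g x \<partial>law f) = m"
    unfolding g_def m_def using phi_integrable phi_mean by (simp add: Bochner_Integration.integral_sum)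
  have "(\<integral>x. (\<Sum>j<k. u j * Y x j)\<^sup>2 \<partial>law f) = (\<integral>x. (g x - m)\<^sup>2 \<partial>law f)"
    unfolding g_def m_def Y_def by (simp add: right_diff_distrib sum_subtractf)
  also have "\<dots> = (\<integral>x. (g x)\<^sup>2 \<partial>law f) - m\<^sup>2"
    unfolding power2_diff using gi g2l mg by (simp add: L.prob_space power2_eq_square)
  also have "\<dots> \<le> (\<integral>x. f x * (g x)\<^sup>2 \<partial>lborel)" by (simp add: integral_law)
  also have "\<dots> \<le> (\<integral>x. s * (g x)\<^sup>2 \<partial>lborel)"
    by (rule integral_mono_AE) (use i fg g2 in auto)
  also have "\<dots> \<le> s" using g2 s1 by (simp add: mult_left_le)
  finally show ?thesis .
qed

definition "Z = (\<lambda>n X k. \<Sum>j<k. (coef_est c n X j - a j)\<^sup>2)"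

text \<open>By independence and \<open>Y_total\<close> this bounds the expectation of
  \<open>Z n X k\<close>.\<close>

definition "H = (\<lambda>n k. C\<phi> * v * sqrt (real k) / real n)"

abbreviation "excess n X k \<equiv> max 0 (Z n X k - 9 * H n k)"

lemma Z_eq:
  assumes "n \<ge> 1"
  shows "Z n X k = (\<Sum>j<k. (\<Sum>i\<in>{1..n}. Y (X i) j)\<^sup>2) / (real n)\<^sup>2"
proof -
  have eq: "coef_est c n X j - a j = (\<Sum>i\<in>{1..n}. Y (X i) j) / real n" for j
    using assms unfolding coef_est_def Y_def by (simp add: sum_subtractf field_simps)
  show ?thesis unfolding Z_def eq by (simp only: power_divide sum_divide_distrib[symmetric])
qed

text \<open>The exponent in \<open>expected_excess\<close> is limited by the weak variance
  (\<open>l1\<close>) and by the sup bound (\<open>l2\<close>). The smaller limit is one of the two,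
  so adding both resulting bounds avoids a case distinction. The constant C\<phi> cancels in the
  second exponent because it occurs in the variance and in the sup bound alike.\<close>

lemma excess_expectation:
  assumes n: "n \<ge> 1" and k: "k \<ge> 1" "k \<le> n\<^sup>2" and d: "dexp c \<le> 1"
  shows "(\<integral>\<^sup>+X. ennreal (excess n X k) \<partial>joint_law n f)
    \<le> ennreal (256 * s\<^sup>2 / real n * exp (- (sqrt (real k) / (8 * s)))
        + 256 * C\<phi> * exp (- (sqrt (real n) * real k powr (1 / 4 - dexp c / 2) / 8)))"
proof -
  define t where "t = C\<phi> * v * sqrt (real k)"
  define h where "h = sqrt (real n * t)"
  define b where "b = 2 * sqrt (C\<phi> * real k powr dexp c)"
  have Cv: "C\<phi> * v \<ge> 1" using C1 v1 by (simp add: mult_ge1_I)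
  have sk: "sqrt (real k) \<ge> 1" using k by simp
  have t1: "t \<ge> sqrt (real k)" "t \<ge> 1" unfolding t_def using Cv sk
    by (auto simp: mult_ge1_I mult_right_mono[of 1 "C\<phi> * v" "sqrt (real k)", simplified])
  have h2: "h\<^sup>2 = real n * t" unfolding h_def using t1 by simp
  have h0: "h > 0" unfolding h_def using t1 n by simp
  have b2: "b\<^sup>2 = 4 * (C\<phi> * real k powr dexp c)" unfolding b_def using C1 by (simp add: power_mult_distrib)
  have b0: "b > 0" unfolding b_def using C1 k by simp
  have kd: "real k powr dexp c \<le> real k" using k d powr_mono[of "dexp c" 1 "real k"] by simp
  have kn: "sqrt (real k) \<le> real n"
    using k(2) by (intro real_le_lsqrt) (auto simp flip: of_nat_power)
  \<comment> \<open>This is where \<open>k \<le> n^2\<close> and the bound 1 on the exponent of the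
    sup norm enter: together they give k^d \<le> n * sqrt k.\<close>
  have bh: "b \<le> 2 * h"
  proof (rule power2_le_imp_le)
    have "real k powr dexp c \<le> sqrt (real k) * sqrt (real k)" using kd by simp
    also have "\<dots> \<le> real n * (v * sqrt (real k))"
      using kn v1 sk by (intro mult_mono) (auto simp: mult_right_mono[of 1 v "sqrt (real k)", simplified])
    finally have "C\<phi> * real k powr dexp c \<le> C\<phi> * (real n * (v * sqrt (real k)))" using C1 by (intro mult_left_mono) auto
    then show "b\<^sup>2 \<le> (2 * h)\<^sup>2" using b2 h2 by (simp add: power_mult_distrib t_def mult_ac)
  qed (use h0 in simp)
  define l1 where "l1 = h / (4 * real n * s)"
  define l2 where "l2 = 1 / (2 * b)"
  define r where "r = min l1 l2"
  have r0: "r > 0" "l1 > 0" "l2 > 0" unfolding r_def l1_def l2_def using h0 b0 n s1 by auto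
  have rb: "2 * b * r \<le> 1"
  proof -
    have "2 * b * r \<le> 2 * b * l2" using b0 by (intro mult_left_mono) (auto simp: r_def)
    then show ?thesis using b0 by (simp add: l2_def)
  qed
  have rs: "4 * real (card {1..n}) * s * r \<le> h"
  proof -
    have "4 * real n * s * r \<le> 4 * real n * s * l1" using s1 by (intro mult_left_mono) (auto simp: r_def)
    then show ?thesis using s1 n by (simp add: l1_def)
  qed
  let ?W = "\<lambda>X. \<Sum>j<k. (\<Sum>i\<in>{1..n}. Y (X i) j)\<^sup>2"
  have ex: "(\<integral>\<^sup>+X. ennreal (max 0 (?W X - 9 * h\<^sup>2)) \<partial>PiM {1..n} (\<lambda>_. law f))
       \<le> ennreal (16 / r\<^sup>2 * exp (- (r * h / 2)))"
  proof (rule expected_excess[where \<tau>=t and \<sigma>=s and b=b])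
    show "AE x in law f. (\<Sum>j<k. (Y x j)\<^sup>2) \<le> b\<^sup>2" unfolding b_def by (rule Y_sup[OF k(1)])
    show "(\<integral>x. (\<Sum>j<k. (Y x j)\<^sup>2) \<partial>law f) \<le> t" unfolding t_def by (rule Y_total[OF k(1)])
    show "real (card {1..n}) * t \<le> h\<^sup>2" using h2 by simp
    show "2 * b * r \<le> 1" by (rule rb)
    show "4 * real (card {1..n}) * s * r \<le> h" by (rule rs)
  qed (use Y_weak Y_mean prob_space_law h0 r0 b0 bh in auto)
  have nn: "(real n)\<^sup>2 > 0" using n by simp
  have "(\<integral>\<^sup>+X. ennreal (excess n X k) \<partial>joint_law n f)
     = (\<integral>\<^sup>+X. ennreal (1 / (real n)\<^sup>2) * ennreal (max 0 (?W X - 9 * h\<^sup>2)) \<partial>PiM {1..n} (\<lambda>_. law f))"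
    unfolding joint_law_def
  proof (rule nn_integral_cong)
    fix X
    have "9 * H n k = (9 * h\<^sup>2) / (real n)\<^sup>2" unfolding H_def h2 t_def using n by (simp add: power2_eq_square)
    then have "Z n X k - 9 * H n k = (?W X - 9 * h\<^sup>2) / (real n)\<^sup>2"
      using Z_eq[OF n] by (simp add: diff_divide_distrib)
    then have "excess n X k = 1 / (real n)\<^sup>2 * max 0 (?W X - 9 * h\<^sup>2)"
      using nn by (simp add: max_def divide_le_0_iff zero_le_divide_iff)
    then show "ennreal (excess n X k) = ennreal (1 / (real n)\<^sup>2) * ennreal (max 0 (?W X - 9 * h\<^sup>2))"
      by (simp only: ennreal_mult'')
  qed
  also have "\<dots> = ennreal (1 / (real n)\<^sup>2) * (\<integral>\<^sup>+X. ennreal (max 0 (?W X - 9 * h\<^sup>2)) \<partial>PiM {1..n} (\<lambda>_. law f))"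
  proof (rule nn_integral_cmult)
    have [measurable]: "(\<lambda>X. Y (X i) j) \<in> borel_measurable (PiM {1..n} (\<lambda>_. law f))" if "i \<in> {1..n}" for i j
      using that by measurable
    show "(\<lambda>X. ennreal (max 0 (?W X - 9 * h\<^sup>2))) \<in> borel_measurable (PiM {1..n} (\<lambda>_. law f))"
      by measurable
  qed
  also have "\<dots> \<le> ennreal (1 / (real n)\<^sup>2) * ennreal (16 / r\<^sup>2 * exp (- (r * h / 2)))"
    by (intro mult_left_mono ex) auto
  also have "\<dots> = ennreal (1 / (real n)\<^sup>2 * (16 / r\<^sup>2 * exp (- (r * h / 2))))"
    by (rule ennreal_mult[symmetric]) auto
  also have "\<dots> \<le> ennreal (256 * s\<^sup>2 / real n * exp (- (sqrt (real k) / (8 * s)))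
        + 256 * C\<phi> * exp (- (sqrt (real n) * real k powr (1 / 4 - dexp c / 2) / 8)))"
  proof (rule ennreal_leI)
    define F where "F = (\<lambda>l. 1 / (real n)\<^sup>2 * (16 / l\<^sup>2 * exp (- (l * h / 2))))"
    have F1: "F l1 \<le> 256 * s\<^sup>2 / real n * exp (- (sqrt (real k) / (8 * s)))"
    proof -
      have "1 / (real n)\<^sup>2 * (16 / l1\<^sup>2) = 256 * s\<^sup>2 / h\<^sup>2"
        unfolding l1_def using n s1 h0 by (simp add: power_divide power_mult_distrib field_simps)
      also have "\<dots> \<le> 256 * s\<^sup>2 / real n"
        unfolding h2 using t1 n by (intro divide_left_mono) (auto simp: mult_left_le[of 1 t])
      finally have 1: "1 / (real n)\<^sup>2 * (16 / l1\<^sup>2) \<le> 256 * s\<^sup>2 / real n" .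
      have "l1 * h / 2 = h\<^sup>2 / (8 * real n * s)" unfolding l1_def by (simp add: power2_eq_square)
      also have "\<dots> = t / (8 * s)" unfolding h2 using n by simp
      also have "\<dots> \<ge> sqrt (real k) / (8 * s)" using t1 s1 by (intro divide_right_mono) auto
      finally have 2: "exp (- (l1 * h / 2)) \<le> exp (- (sqrt (real k) / (8 * s)))" by simp
      have "F l1 = (1 / (real n)\<^sup>2 * (16 / l1\<^sup>2)) * exp (- (l1 * h / 2))" unfolding F_def by simp
      also have "\<dots> \<le> 256 * s\<^sup>2 / real n * exp (- (sqrt (real k) / (8 * s)))"
        by (intro mult_mono 1 2) auto
      finally show ?thesis .
    qed
    have F2: "F l2 \<le> 256 * C\<phi> * exp (- (sqrt (real n) * real k powr (1 / 4 - dexp c / 2) / 8))"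
    proof -
      have "1 / (real n)\<^sup>2 * (16 / l2\<^sup>2) = 256 * C\<phi> * (real k powr dexp c / (real n)\<^sup>2)"
        unfolding l2_def using b2 by (simp add: power_divide power_mult_distrib)
      also have "\<dots> \<le> 256 * C\<phi> * 1"
      proof (rule mult_left_mono)
        have "real k powr dexp c \<le> (real n)\<^sup>2" using kd k(2) by (simp flip: of_nat_power)
        then show "real k powr dexp c / (real n)\<^sup>2 \<le> 1" using nn by (simp add: divide_le_eq)
      qed (use C1 in simp)
      finally have 1: "1 / (real n)\<^sup>2 * (16 / l2\<^sup>2) \<le> 256 * C\<phi>" by simp
      have "sqrt (real n) * real k powr (1 / 4 - dexp c / 2) / 8 \<le> l2 * h / 2"
      proof (rule power2_le_imp_le)
        have kp: "(real k powr (1 / 4 - dexp c / 2))\<^sup>2 = sqrt (real k) / real k powr dexp c"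
          using k by (simp add: power2_eq_square powr_half_sqrt[symmetric] flip: powr_add powr_diff)
        have "(l2 * h / 2)\<^sup>2 = h\<^sup>2 / (16 * b\<^sup>2)" unfolding l2_def by (simp add: power_divide power_mult_distrib)
        also have "\<dots> = real n * (C\<phi> * v * sqrt (real k)) / (64 * (C\<phi> * real k powr dexp c))"
          unfolding h2 b2 t_def by simp
        also have "\<dots> = v * (real n * sqrt (real k) / (64 * real k powr dexp c))"
          using C1 by (simp add: field_simps)
        also have "\<dots> \<ge> 1 * (real n * sqrt (real k) / (64 * real k powr dexp c))"
          using v1 by (intro mult_right_mono) auto
        finally show "(sqrt (real n) * real k powr (1 / 4 - dexp c / 2) / 8)\<^sup>2 \<le> (l2 * h / 2)\<^sup>2"
          unfolding power_divide power_mult_distrib kp by simp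
        show "0 \<le> l2 * h / 2" using r0 h0 by simp
      qed
      then have 2: "exp (- (l2 * h / 2)) \<le> exp (- (sqrt (real n) * real k powr (1 / 4 - dexp c / 2) / 8))" by simp
      have "F l2 = (1 / (real n)\<^sup>2 * (16 / l2\<^sup>2)) * exp (- (l2 * h / 2))" unfolding F_def by simp
      also have "\<dots> \<le> 256 * C\<phi> * exp (- (sqrt (real n) * real k powr (1 / 4 - dexp c / 2) / 8))"
        using C1 by (intro mult_mono 1 2) auto
      finally show ?thesis .
    qed
    have "F r = F l1 \<or> F r = F l2" unfolding r_def min_def by auto
    moreover have "F l1 \<ge> 0" "F l2 \<ge> 0" unfolding F_def by auto
    ultimately have "F r \<le> F l1 + F l2" by linarith
    then show "1 / (real n)\<^sup>2 * (16 / r\<^sup>2 * exp (- (r * h / 2)))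
      \<le> 256 * s\<^sup>2 / real n * exp (- (sqrt (real k) / (8 * s)))
        + 256 * C\<phi> * exp (- (sqrt (real n) * real k powr (1 / 4 - dexp c / 2) / 8))"
      using F1 F2 unfolding F_def by linarith
  qed
  finally show ?thesis .
qed

end

subsection \<open>The oracle inequality\<close>

text \<open>The entropy of the weights is at most ln of their number, by ln x \<le> x - 1. For Gibbs
  weights the entropy equals \<beta> times the mean of \<gamma> plus ln \<open>W\<close>, and
  \<open>W\<close> is at least its summand at \<open>k0\<close>.\<close>

lemma gibbs_weights_mean:
  fixes \<gamma> :: "'k \<Rightarrow> real"
  assumes "finite A" "k0 \<in> A" "\<beta> > 0"
  defines "W \<equiv> \<Sum>l\<in>A. exp (- \<beta> * \<gamma> l)"
  shows "(\<Sum>k\<in>A. exp (- \<beta> * \<gamma> k) / W * \<gamma> k) \<le> \<gamma> k0 + ln (real (card A)) / \<beta>"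
proof -
  define N where "N = real (card A)"
  define w where "w = (\<lambda>k. exp (- \<beta> * \<gamma> k) / W)"
  have N0: "N > 0" using assms(1,2) by (auto simp: N_def card_gt_0_iff)
  have Wge: "W \<ge> exp (- \<beta> * \<gamma> k0)"
    unfolding W_def by (rule member_le_sum) (use assms in auto)
  have W0: "W > 0" using Wge by (rule order_less_le_trans[rotated]) simp
  have w0: "w k > 0" for k using W0 by (simp add: w_def)
  have w1: "(\<Sum>k\<in>A. w k) = 1" using W0 by (simp add: w_def W_def flip: sum_divide_distrib)
  have lnw: "ln (1 / (N * w k)) = \<beta> * \<gamma> k + ln W - ln N" for k
    using N0 W0 by (simp add: w_def ln_div ln_mult)
  have "(\<Sum>k\<in>A. w k * (\<beta> * \<gamma> k + ln W - ln N)) \<le> (\<Sum>k\<in>A. 1 / N - w k)"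
  proof (rule sum_mono)
    fix k
    have "ln (1 / (N * w k)) \<le> 1 / (N * w k) - 1"
      using ln_le_minus_one[of "1 / (N * w k)"] N0 w0[of k] by simp
    then have "w k * ln (1 / (N * w k)) \<le> w k * (1 / (N * w k) - 1)"
      using w0[of k] by (intro mult_left_mono) auto
    also have "\<dots> = 1 / N - w k" using w0[of k] N0 by (simp add: field_simps)
    finally show "w k * (\<beta> * \<gamma> k + ln W - ln N) \<le> 1 / N - w k" unfolding lnw .
  qed
  also have "\<dots> = 0" using N0 w1 by (simp add: sum_subtractf N_def)
  finally have "(\<Sum>k\<in>A. w k * (\<beta> * \<gamma> k + ln W - ln N)) \<le> 0" .
  moreover have "(\<Sum>k\<in>A. w k * (\<beta> * \<gamma> k + ln W - ln N)) = \<beta> * (\<Sum>k\<in>A. w k * \<gamma> k) + (\<Sum>k\<in>A. w k) * (ln W - ln N)"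
    by (simp add: sum_distrib_left sum_distrib_right distrib_left right_diff_distrib sum.distrib sum_subtractf algebra_simps)
  ultimately have "\<beta> * (\<Sum>k\<in>A. w k * \<gamma> k) \<le> ln N - ln W" unfolding w1 by simp
  moreover have "ln W \<ge> - \<beta> * \<gamma> k0" using Wge W0 by (simp add: ln_ge_iff)
  ultimately have "\<beta> * (\<Sum>k\<in>A. w k * \<gamma> k) \<le> \<beta> * (\<gamma> k0 + ln N / \<beta>)"
    using assms(3) by (simp add: distrib_left)
  then show ?thesis using assms(3) unfolding w_def N_def by (simp add: mult_le_cancel_left)
qed

text \<open>These three properties are all that the risk bound uses, which is why both kinds of
  weights share one proof. In the Bayesian case \<kappa> \<ge> 1 makes the inverse temperature at
  least \<open>n\<close>.\<close>

lemma weight_properties: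
  assumes n: "n \<ge> 1" and M: "max_dim c n \<ge> 1" and \<kappa>: "\<kappa> \<ge> 1"
  shows weight_nonneg: "weight w c \<Delta> \<kappa> n X k \<ge> 0"
    and weight_sum: "(\<Sum>k=1..max_dim c n. weight w c \<Delta> \<kappa> n X k) = 1"
    and weight_contrast: "k0 \<in> {1..max_dim c n} \<Longrightarrow>
      (\<Sum>k=1..max_dim c n. weight w c \<Delta> \<kappa> n X k * contrast c \<Delta> n X k)
        \<le> contrast c \<Delta> n X k0 + ln (real (max_dim c n)) / real n"
proof -
  define M where "M = max_dim c n"
  define \<gamma> where "\<gamma> = contrast c \<Delta> n X"
  have M1: "M \<ge> 1" using assms by (simp add: M_def)
  have "weight w c \<Delta> \<kappa> n X k \<ge> 0 \<and> (\<Sum>k=1..M. weight w c \<Delta> \<kappa> n X k) = 1 \<and>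
    (k0 \<in> {1..M} \<longrightarrow> (\<Sum>k=1..M. weight w c \<Delta> \<kappa> n X k * \<gamma> k) \<le> \<gamma> k0 + ln (real M) / real n)"
  proof (cases w)
    case Bayesian
    define \<beta> where "\<beta> = \<kappa> * real n"
    have b: "\<beta> > 0" "\<beta> \<ge> real n" using n \<kappa> by (auto simp: \<beta>_def mult_right_mono[of 1 \<kappa> "real n", simplified])
    have W: "(\<Sum>l=1..M. exp (- \<beta> * \<gamma> l)) > 0" using M1 by (intro sum_pos) auto
    have eq: "weight w c \<Delta> \<kappa> n X k = exp (- \<beta> * \<gamma> k) / (\<Sum>l=1..M. exp (- \<beta> * \<gamma> l))" for k
      unfolding Bayesian \<beta>_def \<gamma>_def M_def by simp
    have "(\<Sum>k=1..M. weight w c \<Delta> \<kappa> n X k * \<gamma> k) \<le> \<gamma> k0 + ln (real M) / real n" if "k0 \<in> {1..M}"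
    proof -
      have "(\<Sum>k=1..M. weight w c \<Delta> \<kappa> n X k * \<gamma> k) \<le> \<gamma> k0 + ln (real (card {1..M})) / \<beta>"
        unfolding eq by (rule gibbs_weights_mean) (use that b in auto)
      also have "ln (real (card {1..M})) / \<beta> \<le> ln (real M) / real n"
        using b n M1 by (simp add: divide_left_mono)
      finally show ?thesis by simp
    qed
    then show ?thesis unfolding eq using W by (auto simp flip: sum_divide_distrib)
  next
    case Model_Selection
    define m where "m = selected_dim c \<Delta> n X"
    have "\<exists>k. k \<in> {1..M} \<and> (\<forall>l\<in>{1..M}. \<gamma> k \<le> \<gamma> l)"
      using ex_min_if_finite[of "\<gamma> ` {1..M}"] M1 by (auto simp: not_less)
    then have m: "m \<in> {1..M} \<and> (\<forall>l\<in>{1..M}. \<gamma> m \<le> \<gamma> l)"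
      unfolding m_def selected_dim_def \<gamma>_def M_def by (rule LeastI_ex)
    have eq: "weight w c \<Delta> \<kappa> n X k = (if k = m then 1 else 0)" for k
      unfolding Model_Selection m_def by simp
    have "ln (real M) / real n \<ge> 0" using M1 by simp
    moreover have "(\<Sum>k=1..M. weight w c \<Delta> \<kappa> n X k * \<gamma> k) = \<gamma> m"
    proof -
      have "weight w c \<Delta> \<kappa> n X k * \<gamma> k = (if k = m then \<gamma> m else 0)" for k unfolding eq by simp
      then show ?thesis using m by simp
    qed
    moreover have "(\<Sum>k=1..M. weight w c \<Delta> \<kappa> n X k) = 1" unfolding eq using m by simp
    ultimately show ?thesis unfolding eq using m by (auto intro: add_increasing2)
  qed
  then show "weight w c \<Delta> \<kappa> n X k \<ge> 0"
    "(\<Sum>k=1..max_dim c n. weight w c \<Delta> \<kappa> n X k) = 1"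
    "k0 \<in> {1..max_dim c n} \<Longrightarrow>
      (\<Sum>k=1..max_dim c n. weight w c \<Delta> \<kappa> n X k * contrast c \<Delta> n X k)
        \<le> contrast c \<Delta> n X k0 + ln (real (max_dim c n)) / real n"
    unfolding M_def \<gamma>_def by auto
qed

text \<open>Jensen's inequality; the gap is the variance of \<open>x\<close> under the
  weights.\<close>

lemma convex_mean_square:
  fixes w x :: "'k \<Rightarrow> real"
  assumes "\<And>k. k \<in> A \<Longrightarrow> w k \<ge> 0" "(\<Sum>k\<in>A. w k) = 1"
  shows "((\<Sum>k\<in>A. w k * x k) - b)\<^sup>2 \<le> (\<Sum>k\<in>A. w k * (x k - b)\<^sup>2)"
proof -
  define m where "m = (\<Sum>k\<in>A. w k * x k)"
  have "0 \<le> (\<Sum>k\<in>A. w k * (x k - m)\<^sup>2)" using assms by (intro sum_nonneg) auto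
  also have "\<dots> = (\<Sum>k\<in>A. w k * (x k - b)\<^sup>2) - (m - b)\<^sup>2"
  proof -
    have "w k * (x k - m)\<^sup>2 = w k * (x k - b)\<^sup>2 + (m\<^sup>2 - b\<^sup>2) * w k - 2 * (m - b) * (w k * x k)" for k
      by (simp add: power2_eq_square algebra_simps)
    then have "(\<Sum>k\<in>A. w k * (x k - m)\<^sup>2) = (\<Sum>k\<in>A. w k * (x k - b)\<^sup>2) + (m\<^sup>2 - b\<^sup>2) * (\<Sum>k\<in>A. w k) - 2 * (m - b) * m"
      unfolding m_def by (simp add: sum.distrib sum_subtractf sum_distrib_left)
    then show ?thesis using assms(2) by (simp add: power2_eq_square algebra_simps)
  qed
  finally show ?thesis by (simp add: m_def)
qed

text \<open>Both cases compare the blocks of coefficients between \<open>k\<close> and \<open>k0\<close>, by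
  \<open>(a + e)\<^sup>2 \<le> 3 / 2 * a\<^sup>2 + 3 * e\<^sup>2\<close> and \<open>(a + e)\<^sup>2 \<ge> a\<^sup>2 / 2 - e\<^sup>2\<close> respectively.\<close>

lemma contrast_comparison:
  fixes a h :: "nat \<Rightarrow> real" and F :: real
  defines "Z \<equiv> \<lambda>k. \<Sum>j<k. (h j - a j)\<^sup>2" and "B \<equiv> \<lambda>k. F - (\<Sum>j<k. (a j)\<^sup>2)"
  assumes B: "\<And>k. B k \<ge> 0"
  shows "B k / 2 - 3 * Z k \<le> (\<Sum>j<k0. (h j)\<^sup>2) - (\<Sum>j<k. (h j)\<^sup>2) + 3 / 2 * B k0 + 2 * Z k0"
proof -
  have split: "(\<Sum>j<m. g j) = (\<Sum>j<l. g j) + (\<Sum>j\<in>{l..<m}. g j)" if "l \<le> m" for l m and g :: "nat \<Rightarrow> real"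
    using that by (simp add: lessThan_atLeast0 sum.atLeastLessThan_concat)
  have Z0: "Z l \<ge> 0" for l unfolding Z_def by (simp add: sum_nonneg)
  show ?thesis
  proof (cases "k0 \<le> k")
    case True
    have "(\<Sum>j\<in>{k0..<k}. (h j)\<^sup>2) \<le> (\<Sum>j\<in>{k0..<k}. 3 / 2 * (a j)\<^sup>2 + 3 * (h j - a j)\<^sup>2)"
    proof (rule sum_mono)
      fix j
      have "0 \<le> (a j - 2 * (h j - a j))\<^sup>2" by simp
      then show "(h j)\<^sup>2 \<le> 3 / 2 * (a j)\<^sup>2 + 3 * (h j - a j)\<^sup>2" by (simp add: power2_eq_square algebra_simps)
    qed
    also have "\<dots> = 3 / 2 * (\<Sum>j\<in>{k0..<k}. (a j)\<^sup>2) + 3 * (\<Sum>j\<in>{k0..<k}. (h j - a j)\<^sup>2)"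
      by (simp add: sum.distrib sum_distrib_left)
    finally have 1: "(\<Sum>j\<in>{k0..<k}. (h j)\<^sup>2) \<le> 3 / 2 * (\<Sum>j\<in>{k0..<k}. (a j)\<^sup>2) + 3 * (\<Sum>j\<in>{k0..<k}. (h j - a j)\<^sup>2)" .
    show ?thesis using 1 B[of k] Z0[of k0] split[OF True, of "\<lambda>j. (h j)\<^sup>2"] split[OF True, of "\<lambda>j. (a j)\<^sup>2"]
        split[OF True, of "\<lambda>j. (h j - a j)\<^sup>2"]
      unfolding Z_def B_def by argo
  next
    case False
    then have le: "k \<le> k0" by simp
    have "(\<Sum>j\<in>{k..<k0}. 1 / 2 * (a j)\<^sup>2 - (h j - a j)\<^sup>2) \<le> (\<Sum>j\<in>{k..<k0}. (h j)\<^sup>2)"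
    proof (rule sum_mono)
      fix j
      have "0 \<le> (a j + 2 * (h j - a j))\<^sup>2" by simp
      then show "1 / 2 * (a j)\<^sup>2 - (h j - a j)\<^sup>2 \<le> (h j)\<^sup>2" by (simp add: power2_eq_square algebra_simps)
    qed
    then have 1: "1 / 2 * (\<Sum>j\<in>{k..<k0}. (a j)\<^sup>2) - (\<Sum>j\<in>{k..<k0}. (h j - a j)\<^sup>2) \<le> (\<Sum>j\<in>{k..<k0}. (h j)\<^sup>2)"
      by (simp add: sum_subtractf sum_distrib_left)
    show ?thesis using 1 B[of k0] Z0[of k] Z0[of k0] split[OF le, of "\<lambda>j. (h j)\<^sup>2"] split[OF le, of "\<lambda>j. (a j)\<^sup>2"]
        split[OF le, of "\<lambda>j. (h j - a j)\<^sup>2"]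
      unfolding Z_def B_def by argo
  qed
qed

lemma contrast_eq:
  "contrast c \<Delta> n X k = - (\<Sum>j<k. (coef_est c n X j)\<^sup>2) + pen_est c \<Delta> n X k"
proof -
  interpret orthonormal_seq "phi c" by (rule phi_orthonormal)
  have "(l2_norm (supp c) (\<lambda>x. \<Sum>j<k. coef_est c n X j * phi c j x))\<^sup>2 = (\<Sum>j<k. (coef_est c n X j)\<^sup>2)"
    by (subst l2_norm_square) (simp_all add: phi_outside comb_square_integral)
  then show ?thesis unfolding contrast_def series_est_def[abs_def] by simp
qed

section \<open>Loss of the aggregated estimator\<close>

context basis_model
begin

definition "F = (l2_norm (supp c) f)\<^sup>2"

text \<open>The squared bias of the projection on the first \<open>k\<close> basis
  functions.\<close>

definition "B = (\<lambda>k. F - (\<Sum>j<k. (a j)\<^sup>2))"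

abbreviation "loss w \<Delta> \<kappa> n X \<equiv> (l2_norm (supp c) (\<lambda>x. aggregated_est w c \<Delta> \<kappa> n X x - f x))\<^sup>2"

lemma F_nonneg: "F \<ge> 0" by (simp add: F_def)

lemma B_nonneg: "B k \<ge> 0" using coef_sum_le by (simp add: B_def F_def)

lemma B_le: "B k \<le> F" by (simp add: B_def sum_nonneg)

lemma Z_nonneg: "Z n X k \<ge> 0" by (simp add: Z_def sum_nonneg)

lemma H_nonneg: "H n k \<ge> 0" using C1 v0 by (simp add: H_def)

text \<open>All estimators are padded with zero coefficients to dimension \<open>M\<close>, where
  Jensen's inequality applies coordinatewise. The true coefficients between \<open>k\<close> and
  \<open>M\<close>, estimated by zero, turn \<open>B M\<close> back into \<open>B k\<close>.\<close>

lemma loss_le: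
  assumes n: "n \<ge> 1" and M: "max_dim c n \<ge> 1" and \<kappa>: "\<kappa> \<ge> 1"
  shows "loss w \<Delta> \<kappa> n X
    \<le> (\<Sum>k=1..max_dim c n. weight w c \<Delta> \<kappa> n X k * (Z n X k + B k))"
proof -
  define M where "M = max_dim c n"
  define p where "p = weight w c \<Delta> \<kappa> n X"
  define h where "h = coef_est c n X"
  define g where "g = (\<lambda>k j. if j < k then h j else 0)"
  have p0: "p k \<ge> 0" for k unfolding p_def by (rule weight_nonneg[OF assms])
  have p1: "(\<Sum>k\<in>{1..M}. p k) = 1" unfolding p_def M_def by (rule weight_sum[OF assms])
  have ser: "series_est c n X k x = (\<Sum>j<M. g k j * phi c j x)" if "k \<in> {1..M}" for k x
  proof -
    have "(\<Sum>j<k. h j * phi c j x) = (\<Sum>j<M. g k j * phi c j x)"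
      using that by (intro sum.mono_neutral_cong_left) (auto simp: g_def)
    then show ?thesis by (simp add: series_est_def h_def)
  qed
  have "aggregated_est w c \<Delta> \<kappa> n X x = (\<Sum>j<M. (\<Sum>k\<in>{1..M}. p k * g k j) * phi c j x)" for x
  proof -
    have "aggregated_est w c \<Delta> \<kappa> n X x = (\<Sum>k\<in>{1..M}. p k * (\<Sum>j<M. g k j * phi c j x))"
      unfolding aggregated_est_def p_def[symmetric] M_def[symmetric]
      by (rule sum.cong) (simp_all add: ser)
    also have "\<dots> = (\<Sum>k\<in>{1..M}. \<Sum>j<M. p k * g k j * phi c j x)"
      by (simp add: sum_distrib_left mult.assoc)
    also have "\<dots> = (\<Sum>j<M. \<Sum>k\<in>{1..M}. p k * g k j * phi c j x)" by (rule sum.swap)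
    finally show ?thesis by (simp add: sum_distrib_right)
  qed
  then have "loss w \<Delta> \<kappa> n X
    = (\<Sum>j<M. ((\<Sum>k\<in>{1..M}. p k * g k j) - a j)\<^sup>2) + B M"
    using dist_square[where m=M and u="\<lambda>j. \<Sum>k\<in>{1..M}. p k * g k j"] by (simp add: B_def F_def)
  also have "\<dots> \<le> (\<Sum>j<M. \<Sum>k\<in>{1..M}. p k * (g k j - a j)\<^sup>2) + B M"
    by (intro add_mono sum_mono convex_mean_square order_refl) (use p0 p1 in auto)
  also have "(\<Sum>j<M. \<Sum>k\<in>{1..M}. p k * (g k j - a j)\<^sup>2) = (\<Sum>k\<in>{1..M}. p k * (\<Sum>j<M. (g k j - a j)\<^sup>2))"
    by (subst sum.swap) (simp add: sum_distrib_left)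
  also have "B M = (\<Sum>k\<in>{1..M}. p k * B M)" using p1 by (simp flip: sum_distrib_right)
  also have "(\<Sum>k\<in>{1..M}. p k * (\<Sum>j<M. (g k j - a j)\<^sup>2)) + (\<Sum>k\<in>{1..M}. p k * B M)
     = (\<Sum>k\<in>{1..M}. p k * (Z n X k + B k))"
    unfolding sum.distrib[symmetric]
  proof (rule sum.cong[OF refl])
    fix k assume k: "k \<in> {1..M}"
    have sp: "(\<Sum>j<M. q j) = (\<Sum>j<k. q j) + (\<Sum>j\<in>{k..<M}. q j)" for q :: "nat \<Rightarrow> real"
      using k by (simp add: lessThan_atLeast0 sum.atLeastLessThan_concat)
    have "(\<Sum>j<M. (g k j - a j)\<^sup>2) = Z n X k + (\<Sum>j\<in>{k..<M}. (a j)\<^sup>2)"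
      unfolding sp[of "\<lambda>j. (g k j - a j)\<^sup>2"] by (simp add: Z_def g_def h_def)
    then show "p k * (\<Sum>j<M. (g k j - a j)\<^sup>2) + p k * B M = p k * (Z n X k + B k)"
      using sp[of "\<lambda>j. (a j)\<^sup>2"] by (simp add: B_def flip: distrib_left)
  qed
  finally show ?thesis unfolding p_def M_def .
qed

text \<open>If the random penalty is at least half its expectation, it dominates the fluctuation of
  every \<open>Z k\<close>, and the weighted mean of the contrast can be compared with its value at
  \<open>k0\<close>. Otherwise the crudest bound on the loss is multiplied by a factor that exceeds
  1 there, which makes the inequality hold pointwise, without splitting the sample space.\<close>

lemma loss_oracle:
  assumes n: "n \<ge> 1" and M: "max_dim c n \<ge> 1" and \<kappa>: "\<kappa> \<ge> 1" and \<Delta>: "\<Delta> \<ge> 84 * C\<phi>"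
    and k0: "k0 \<in> {1..max_dim c n}"
  defines "D \<equiv> \<lambda>X. \<Sum>k=1..max_dim c n. excess n X k"
  shows "loss w \<Delta> \<kappa> n X
    \<le> 3 * B k0 + 36 * H n k0 + 2 * ln (real (max_dim c n)) / real n + 2 * pen_est c \<Delta> n X k0 + 13 * D X
      + 4 * (9 * H n (max_dim c n) + F) * (v_est c n X - v)\<^sup>2"
proof -
  define M where "M = max_dim c n"
  define p where "p = weight w c \<Delta> \<kappa> n X"
  define h where "h = coef_est c n X"
  define R where "R = (\<Sum>k\<in>{1..M}. p k * (Z n X k + B k))"
  define pen where "pen = pen_est c \<Delta> n X"
  have D0: "D X \<ge> 0" unfolding D_def by (simp add: sum_nonneg)
  have DZ: "Z n X k \<le> 9 * H n k + D X" if "k \<in> {1..M}" for k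
  proof -
    have "excess n X k \<le> D X"
      unfolding D_def by (rule member_le_sum) (use that M_def in auto)
    then show ?thesis by linarith
  qed
  have p0: "p k \<ge> 0" for k unfolding p_def by (rule weight_nonneg[OF n M \<kappa>])
  have p1: "(\<Sum>k\<in>{1..M}. p k) = 1" unfolding p_def M_def by (rule weight_sum[OF n M \<kappa>])
  have pc: "(\<Sum>k\<in>{1..M}. p k * q) = q" for q using p1 by (simp flip: sum_distrib_right)
  have lM: "ln (real M) / real n \<ge> 0" using M by (simp add: M_def)
  have v_est1: "v_est c n X \<ge> 1" unfolding v_est_def by (simp add: sum_nonneg)
  have penp: "pen k \<ge> 0" for k
    unfolding pen_def pen_est_def using \<Delta> C1 v_est1 by simp
  have le: "loss w \<Delta> \<kappa> n X \<le> R"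
    unfolding R_def p_def M_def by (rule loss_le[OF n M \<kappa>])
  have q0: "0 \<le> 4 * (9 * H n M + F)" using H_nonneg[of n M] F_nonneg by simp
  show ?thesis
  proof (cases "v_est c n X \<ge> v / 2")
    case True
    \<comment> \<open>Half of 84 leaves 42, more than the 36 claimed; the comparison below uses 7/2
      * 9 = 63/2 of it.\<close>
    have penk: "36 * H n k \<le> pen k" for k
    proof -
      have "36 * (C\<phi> * v) \<le> (84 * C\<phi>) * (v / 2)" using C1 v0 by simp
      also have "\<dots> \<le> \<Delta> * v_est c n X" using \<Delta> True C1 v0 by (intro mult_mono) auto
      finally have "36 * (C\<phi> * v) * (sqrt (real k) / real n) \<le> \<Delta> * v_est c n X * (sqrt (real k) / real n)"
        by (rule mult_right_mono) simp
      then show ?thesis by (simp add: H_def pen_def pen_est_def)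
    qed
    define S where "S = (\<lambda>k. \<Sum>j<k. (h j)\<^sup>2)"
    have con: "contrast c \<Delta> n X k = pen k - S k" for k
      unfolding contrast_eq S_def h_def pen_def by simp
    have "(\<Sum>k\<in>{1..M}. p k * contrast c \<Delta> n X k) \<le> contrast c \<Delta> n X k0 + ln (real M) / real n"
      unfolding p_def M_def by (rule weight_contrast[OF n M \<kappa> k0])
    then have W: "(\<Sum>k\<in>{1..M}. p k * (pen k - S k)) \<le> pen k0 - S k0 + ln (real M) / real n" unfolding con .
    have "R / 2 \<le> (\<Sum>k\<in>{1..M}. p k * ((S k0 + pen k0 + 3 / 2 * B k0 + 2 * Z n X k0 + 4 * D X - pen k0) + (pen k - S k)))"
      unfolding R_def sum_divide_distrib
    proof (rule sum_mono)
      fix k assume k: "k \<in> {1..M}"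
      have c: "B k / 2 - 3 * Z n X k \<le> S k0 - S k + 3 / 2 * B k0 + 2 * Z n X k0"
        unfolding S_def B_def Z_def h_def
        by (rule contrast_comparison) (use B_nonneg in \<open>simp add: B_def\<close>)
      have "(Z n X k + B k) / 2 \<le> S k0 + pen k0 + 3 / 2 * B k0 + 2 * Z n X k0 + 4 * D X - pen k0 + (pen k - S k)"
        \<comment> \<open>The comparison leaves \<open>7 / 2 * Z\<close>, namely 3 from the contrast
          and 1/2 from the loss. It is at most \<open>63 / 2 * H\<close> plus
          \<open>7 / 2 * D\<close>, covered by the penalty and \<open>4 * D\<close>.\<close>
        using c DZ[OF k] penk[of k] Z_nonneg[of n X k] D0 H_nonneg[of n k] by argo
      then have "p k * ((Z n X k + B k) / 2) \<le> p k * (S k0 + pen k0 + 3 / 2 * B k0 + 2 * Z n X k0 + 4 * D X - pen k0 + (pen k - S k))"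
        by (rule mult_left_mono) (rule p0)
      then show "p k * (Z n X k + B k) / 2 \<le> p k * (S k0 + pen k0 + 3 / 2 * B k0 + 2 * Z n X k0 + 4 * D X - pen k0 + (pen k - S k))"
        by simp
    qed
    also have "\<dots> = (S k0 + pen k0 + 3 / 2 * B k0 + 2 * Z n X k0 + 4 * D X - pen k0) + (\<Sum>k\<in>{1..M}. p k * (pen k - S k))"
      unfolding distrib_left sum.distrib pc ..
    also have "\<dots> \<le> 3 / 2 * B k0 + 2 * Z n X k0 + 4 * D X + pen k0 + ln (real M) / real n"
      using W by linarith
    finally have "R \<le> 3 * B k0 + 4 * Z n X k0 + 8 * D X + 2 * pen k0 + 2 * (ln (real M) / real n)" by linarith
    also have "\<dots> \<le> 3 * B k0 + 36 * H n k0 + 2 * (ln (real M) / real n) + 2 * pen k0 + 13 * D X"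
      using DZ[of k0] k0 D0 by (simp add: M_def)
    finally have "R \<le> 3 * B k0 + 36 * H n k0 + 2 * ln (real M) / real n + 2 * pen k0 + 13 * D X" by simp
    moreover have "0 \<le> 4 * (9 * H n M + F) * (v_est c n X - v)\<^sup>2" using q0 by simp
    ultimately show ?thesis using le unfolding M_def pen_def by linarith
  next
    case False
    have "R \<le> (\<Sum>k\<in>{1..M}. p k * (9 * H n M + D X + F))"
      unfolding R_def
    proof (intro sum_mono mult_left_mono p0)
      fix k assume k: "k \<in> {1..M}"
      have "H n k \<le> H n M" unfolding H_def using k C1 v0
        by (intro divide_right_mono mult_left_mono) auto
      then show "Z n X k + B k \<le> 9 * H n M + D X + F" using DZ[OF k] B_le[of k] by linarith
    qed
    also have "\<dots> = 9 * H n M + D X + F" by (rule pc)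
    finally have 1: "R \<le> 9 * H n M + D X + F" .
    \<comment> \<open>Since \<open>v \<ge> 1\<close>, falling below half of \<open>v\<close> means a
      deviation of at least 1/2. Inserting 1 \<le> 4 * (deviation)^2 is Chebyshev's inequality
      before integration.\<close>
    have "1 / 2 \<le> v - v_est c n X" using False v1 by simp
    then have "(1 / 2)\<^sup>2 \<le> (v - v_est c n X)\<^sup>2" by (rule power_mono) simp
    then have "(1 / 2)\<^sup>2 \<le> (v_est c n X - v)\<^sup>2" by (simp only: power2_commute)
    then have "1 \<le> 4 * (v_est c n X - v)\<^sup>2" by (simp add: power_one_over)
    then have "(9 * H n M + F) * 1 \<le> (9 * H n M + F) * (4 * (v_est c n X - v)\<^sup>2)"
      using q0 by (intro mult_left_mono) auto
    then have "9 * H n M + F \<le> 4 * (9 * H n M + F) * (v_est c n X - v)\<^sup>2"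
      by (simp only: mult_1_left mult_1_right mult_ac)
    moreover have "0 \<le> 3 * B k0 + 36 * H n k0 + 2 * ln (real M) / real n + 2 * pen k0 + 12 * D X"
      using B_nonneg[of k0] H_nonneg[of n k0] lM penp[of k0] D0 by simp
    ultimately show ?thesis using le 1 unfolding M_def pen_def by linarith
  qed
qed

section \<open>Expectations of the random penalty and of the risk\<close>

lemma coef_est_measurable [measurable]: "(\<lambda>X. coef_est c n X j) \<in> borel_measurable (joint_law n f)"
proof -
  have [measurable]: "(\<lambda>X. phi c j (X i)) \<in> borel_measurable (joint_law n f)" if "i \<in> {1..n}" for i
    unfolding joint_law_def using that by measurable
  show ?thesis unfolding coef_est_def by measurable
qed

lemma v_est_measurable [measurable]: "(\<lambda>X. v_est c n X) \<in> borel_measurable (joint_law n f)"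
proof -
  have [measurable]: "(\<lambda>X. \<bar>X i\<bar> powr alpha c) \<in> borel_measurable (joint_law n f)" if "i \<in> {1..n}" for i
    unfolding joint_law_def using that by measurable
  show ?thesis unfolding v_est_def by measurable
qed

lemma prob_space_joint: "prob_space (joint_law n f)"
  unfolding joint_law_def by (rule prob_space_PiM) (rule prob_space_law)

lemma alpha_integrable: "integrable (law f) (\<lambda>x. \<bar>x\<bar> powr alpha c)"
  and alpha_mean: "(\<integral>x. \<bar>x\<bar> powr alpha c \<partial>law f) = v - 1"
proof -
  have "1 + moment (alpha c) f = 1 + ennreal (v - 1)"
    using vf v1 unfolding vf_def by (simp add: add.commute flip: ennreal_plus ennreal_1)
  then have m: "(\<integral>\<^sup>+x. ennreal (\<bar>x\<bar> powr alpha c) \<partial>law f) = ennreal (v - 1)"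
    by (simp add: moment_def ennreal_add_left_cancel)
  show i: "integrable (law f) (\<lambda>x. \<bar>x\<bar> powr alpha c)"
    by (rule integrableI_nonneg) (auto simp: m)
  show "(\<integral>x. \<bar>x\<bar> powr alpha c \<partial>law f) = v - 1"
    using nn_integral_eq_integral[OF i] m v1 by simp
qed

lemma v_est_mean:
  assumes "n \<ge> 1"
  shows "(\<integral>\<^sup>+X. ennreal (v_est c n X) \<partial>joint_law n f) = ennreal v"
proof -
  interpret J: prob_space "joint_law n f" by (rule prob_space_joint)
  have [measurable]: "(\<lambda>X. \<bar>X i\<bar> powr alpha c) \<in> borel_measurable (joint_law n f)" if "i \<in> {1..n}" for i
    unfolding joint_law_def using that by measurable
  have "ennreal (v_est c n X) = 1 + ennreal (1 / real n) * (\<Sum>i\<in>{1..n}. ennreal (\<bar>X i\<bar> powr alpha c))" for X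
  proof -
    have "ennreal (v_est c n X) = ennreal 1 + ennreal (1 / real n * (\<Sum>i\<in>{1..n}. \<bar>X i\<bar> powr alpha c))"
      unfolding v_est_def by (rule ennreal_plus) (auto intro!: sum_nonneg divide_nonneg_nonneg)
    also have "ennreal (1 / real n * (\<Sum>i\<in>{1..n}. \<bar>X i\<bar> powr alpha c))
        = ennreal (1 / real n) * ennreal (\<Sum>i\<in>{1..n}. \<bar>X i\<bar> powr alpha c)"
      by (rule ennreal_mult) (auto intro: sum_nonneg)
    also have "ennreal (\<Sum>i\<in>{1..n}. \<bar>X i\<bar> powr alpha c) = (\<Sum>i\<in>{1..n}. ennreal (\<bar>X i\<bar> powr alpha c))"
      by (rule sum_ennreal[symmetric]) simp
    finally show ?thesis by simp
  qed
  then have "(\<integral>\<^sup>+X. ennreal (v_est c n X) \<partial>joint_law n f)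
     = 1 + ennreal (1 / real n) * (\<integral>\<^sup>+X. (\<Sum>i\<in>{1..n}. ennreal (\<bar>X i\<bar> powr alpha c)) \<partial>joint_law n f)"
    by (simp add: nn_integral_add nn_integral_cmult J.emeasure_space_1)
  also have "(\<integral>\<^sup>+X. (\<Sum>i\<in>{1..n}. ennreal (\<bar>X i\<bar> powr alpha c)) \<partial>joint_law n f)
     = of_nat n * (\<integral>\<^sup>+x. ennreal (\<bar>x\<bar> powr alpha c) \<partial>law f)"
    unfolding joint_law_def
    by (subst nn_integral_PiM_sum[OF prob_space_law, where g="\<lambda>x. ennreal (\<bar>x\<bar> powr alpha c)"]) auto
  also have "(\<integral>\<^sup>+x. ennreal (\<bar>x\<bar> powr alpha c) \<partial>law f) = ennreal (v - 1)"
    using nn_integral_eq_integral[OF alpha_integrable] alpha_mean by simp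
  also have "1 + ennreal (1 / real n) * (of_nat n * ennreal (v - 1)) = ennreal (1 + 1 / real n * (real n * (v - 1)))"
  proof -
    have "of_nat n * ennreal (v - 1) = ennreal (real n * (v - 1))"
      unfolding ennreal_of_nat_eq_real_of_nat by (rule ennreal_mult''[symmetric]) (use v1 in simp)
    also have "ennreal (1 / real n) * ennreal (real n * (v - 1)) = ennreal (1 / real n * (real n * (v - 1)))"
      by (rule ennreal_mult''[symmetric]) (use v1 in simp)
    finally have "ennreal (1 / real n) * (of_nat n * ennreal (v - 1)) = ennreal (1 / real n * (real n * (v - 1)))" .
    then show ?thesis using v1 by (simp only: ennreal_1[symmetric], subst ennreal_plus) auto
  qed
  also have "1 + 1 / real n * (real n * (v - 1)) = v" using assms by simp
  finally show ?thesis .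
qed

text \<open>The bound of the class on the moment of order \<open>2 * alpha c\<close> enters here; it
  makes a penalty that is too small an event of order 1 / n.\<close>

lemma v_est_variance:
  assumes n: "n \<ge> 1" and L: "moment (2 * alpha c) f \<le> ennreal L" "L \<ge> 0"
  shows "(\<integral>\<^sup>+X. ennreal ((v_est c n X - v)\<^sup>2) \<partial>joint_law n f) \<le> ennreal (L / real n)"
proof -
  define g where "g = (\<lambda>x. \<bar>x\<bar> powr alpha c - (v - 1))"
  have sq: "(\<bar>x\<bar> powr alpha c)\<^sup>2 = \<bar>x\<bar> powr (2 * alpha c)" for x :: real
    by (simp add: power2_eq_square flip: powr_add)
  have m: "(\<integral>\<^sup>+x. ennreal ((\<bar>x\<bar> powr alpha c)\<^sup>2) \<partial>law f) \<le> ennreal L"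
    using L(1) unfolding moment_def sq .
  have i2: "integrable (law f) (\<lambda>x. (\<bar>x\<bar> powr alpha c)\<^sup>2)"
    by (rule integrableI_nonneg) (use m in \<open>auto intro: order_le_less_trans\<close>)
  have gm: "g \<in> borel_measurable (law f)" unfolding g_def by measurable
  have eq: "(g x)\<^sup>2 = (\<bar>x\<bar> powr alpha c)\<^sup>2 - 2 * (v - 1) * \<bar>x\<bar> powr alpha c + (v - 1)\<^sup>2" for x
    unfolding g_def power2_diff[of _ "v - 1"] by simp
  have g2: "integrable (law f) (\<lambda>x. (g x)\<^sup>2)"
    unfolding eq using i2 alpha_integrable by auto
  have g0: "(\<integral>x. g x \<partial>law f) = 0"
    unfolding g_def using alpha_integrable alpha_mean by simp
  have "(\<integral>x. (g x)\<^sup>2 \<partial>law f) = (\<integral>x. (\<bar>x\<bar> powr alpha c)\<^sup>2 \<partial>law f) - (v - 1)\<^sup>2"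
    unfolding eq using i2 alpha_integrable alpha_mean by (simp add: power2_eq_square)
  also have "\<dots> \<le> L"
  proof -
    have "(\<integral>x. (\<bar>x\<bar> powr alpha c)\<^sup>2 \<partial>law f) \<le> L"
      using m nn_integral_eq_integral[OF i2] L(2) by simp
    then show ?thesis using zero_le_power2[of "v - 1"] by linarith
  qed
  finally have gL: "(\<integral>x. (g x)\<^sup>2 \<partial>law f) \<le> L" .
  have "(v_est c n X - v)\<^sup>2 = 1 / (real n)\<^sup>2 * (\<Sum>i\<in>{1..n}. g (X i))\<^sup>2" for X
  proof -
    have "(\<Sum>i\<in>{1..n}. g (X i)) = (\<Sum>i\<in>{1..n}. \<bar>X i\<bar> powr alpha c) - real n * (v - 1)"
      by (simp add: g_def sum_subtractf)
    then have "v_est c n X - v = (\<Sum>i\<in>{1..n}. g (X i)) / real n"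
      using n by (simp add: v_est_def field_simps)
    then show ?thesis by (simp add: power_divide)
  qed
  then have "ennreal ((v_est c n X - v)\<^sup>2) = ennreal (1 / (real n)\<^sup>2) * ennreal ((\<Sum>i\<in>{1..n}. g (X i))\<^sup>2)" for X
    by (simp only: ennreal_mult''[OF zero_le_power2])
  then have "(\<integral>\<^sup>+X. ennreal ((v_est c n X - v)\<^sup>2) \<partial>joint_law n f)
     = (\<integral>\<^sup>+X. ennreal (1 / (real n)\<^sup>2) * ennreal ((\<Sum>i\<in>{1..n}. g (X i))\<^sup>2) \<partial>joint_law n f)"
    by (simp only:)
  also have "\<dots> = ennreal (1 / (real n)\<^sup>2) * (\<integral>\<^sup>+X. ennreal ((\<Sum>i\<in>{1..n}. g (X i))\<^sup>2) \<partial>joint_law n f)"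
  proof (rule nn_integral_cmult)
    have [measurable]: "(\<lambda>X. g (X i)) \<in> borel_measurable (joint_law n f)" if "i \<in> {1..n}" for i
      unfolding joint_law_def using that gm by measurable
    show "(\<lambda>X. ennreal ((\<Sum>i\<in>{1..n}. g (X i))\<^sup>2)) \<in> borel_measurable (joint_law n f)" by measurable
  qed
  also have "(\<integral>\<^sup>+X. ennreal ((\<Sum>i\<in>{1..n}. g (X i))\<^sup>2) \<partial>joint_law n f) = ennreal (real n * (\<integral>x. (g x)\<^sup>2 \<partial>law f))"
    unfolding joint_law_def using nn_integral_PiM_sum_square[OF prob_space_law _ gm g2 g0, of "{1..n}"] by simp
  also have "ennreal (1 / (real n)\<^sup>2) * ennreal (real n * (\<integral>x. (g x)\<^sup>2 \<partial>law f)) = ennreal ((\<integral>x. (g x)\<^sup>2 \<partial>law f) / real n)"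
    using n by (simp add: power2_eq_square flip: ennreal_mult'')
  also have "\<dots> \<le> ennreal (L / real n)" using gL by (intro ennreal_leI divide_right_mono) auto
  finally show ?thesis .
qed

text \<open>The loss is replaced by a measurable majorant that is linear in \<open>v_est\<close> and
  in its squared deviation. Unbiasedness of \<open>v_est\<close> gives the mean of the penalty, and
  the variance takes care of the bad event.\<close>

lemma risk_oracle:
  assumes n: "n \<ge> 1" and M: "max_dim c n \<ge> 1" and \<kappa>: "\<kappa> \<ge> 1" and \<Delta>: "\<Delta> \<ge> 84 * C\<phi>"
    and k0: "k0 \<in> {1..max_dim c n}" and L: "moment (2 * alpha c) f \<le> ennreal L" "L \<ge> 0"
  shows "risk w c \<Delta> \<kappa> n f
    \<le> ennreal (3 * B k0 + 36 * H n k0 + 2 * ln (real (max_dim c n)) / real n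
        + 2 * \<Delta> * v * sqrt (real k0) / real n + 4 * (9 * H n (max_dim c n) + F) * (L / real n))
      + 13 * (\<Sum>k=1..max_dim c n. \<integral>\<^sup>+X. ennreal (excess n X k) \<partial>joint_law n f)"
proof -
  interpret J: prob_space "joint_law n f" by (rule prob_space_joint)
  define A where "A = 3 * B k0 + 36 * H n k0 + 2 * ln (real (max_dim c n)) / real n"
  define q where "q = 2 * \<Delta> * sqrt (real k0) / real n"
  define r where "r = 4 * (9 * H n (max_dim c n) + F)"
  have A0: "A \<ge> 0" unfolding A_def using B_nonneg[of k0] H_nonneg[of n k0] M by simp
  have q0: "q \<ge> 0" unfolding q_def using \<Delta> C1 by simp
  have r0: "r \<ge> 0" unfolding r_def using H_nonneg F_nonneg by simp
  have v_est0: "v_est c n X \<ge> 0" for X unfolding v_est_def by (simp add: sum_nonneg add_nonneg_nonneg)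
  have [measurable]: "(\<lambda>X. Z n X k) \<in> borel_measurable (joint_law n f)" for k unfolding Z_def by measurable
  have "risk w c \<Delta> \<kappa> n f \<le> (\<integral>\<^sup>+X. ennreal A + ennreal q * ennreal (v_est c n X)
      + 13 * (\<Sum>k=1..max_dim c n. ennreal (excess n X k))
      + ennreal r * ennreal ((v_est c n X - v)\<^sup>2) \<partial>joint_law n f)"
    unfolding risk_def
  proof (rule nn_integral_mono)
    fix X
    define D where "D = (\<Sum>k=1..max_dim c n. excess n X k)"
    have D0: "D \<ge> 0" unfolding D_def by (simp add: sum_nonneg)
    have "loss w \<Delta> \<kappa> n X
       \<le> A + q * v_est c n X + 13 * D + r * (v_est c n X - v)\<^sup>2"
      using loss_oracle[OF n M \<kappa> \<Delta> k0, of w X] unfolding A_def q_def r_def D_def pen_est_def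
      by (simp add: mult_ac)
    then have "ennreal (loss w \<Delta> \<kappa> n X)
       \<le> ennreal (A + q * v_est c n X + 13 * D + r * (v_est c n X - v)\<^sup>2)" by (rule ennreal_leI)
    also have "\<dots> = ennreal A + ennreal q * ennreal (v_est c n X) + 13 * ennreal D + ennreal r * ennreal ((v_est c n X - v)\<^sup>2)"
      using A0 q0 r0 D0 v_est0[of X] by (simp add: ennreal_mult ennreal_plus)
    also have "ennreal D = (\<Sum>k=1..max_dim c n. ennreal (excess n X k))"
      unfolding D_def by (rule sum_ennreal[symmetric]) simp
    finally show "ennreal (loss w \<Delta> \<kappa> n X)
       \<le> ennreal A + ennreal q * ennreal (v_est c n X) + 13 * (\<Sum>k=1..max_dim c n. ennreal (excess n X k))
        + ennreal r * ennreal ((v_est c n X - v)\<^sup>2)" .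
  qed
  also have "\<dots> = ennreal A + ennreal q * (\<integral>\<^sup>+X. ennreal (v_est c n X) \<partial>joint_law n f)
      + 13 * (\<Sum>k=1..max_dim c n. \<integral>\<^sup>+X. ennreal (excess n X k) \<partial>joint_law n f)
      + ennreal r * (\<integral>\<^sup>+X. ennreal ((v_est c n X - v)\<^sup>2) \<partial>joint_law n f)"
    by (simp add: nn_integral_add nn_integral_cmult nn_integral_sum J.emeasure_space_1)
  also have "\<dots> \<le> ennreal A + ennreal q * ennreal v
      + 13 * (\<Sum>k=1..max_dim c n. \<integral>\<^sup>+X. ennreal (excess n X k) \<partial>joint_law n f)
      + ennreal r * ennreal (L / real n)"
    unfolding v_est_mean[OF n] by (intro add_mono mult_left_mono v_est_variance[OF n L] order_refl) auto
  also have "\<dots> = ennreal (A + q * v + r * (L / real n))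
      + 13 * (\<Sum>k=1..max_dim c n. \<integral>\<^sup>+X. ennreal (excess n X k) \<partial>joint_law n f)"
  proof -
    have "ennreal A + ennreal q * ennreal v + ennreal r * ennreal (L / real n) = ennreal (A + q * v + r * (L / real n))"
      using A0 q0 r0 v0 L(2)
      by (simp only: ennreal_mult[symmetric] ennreal_plus[symmetric] mult_nonneg_nonneg add_nonneg_nonneg
          divide_nonneg_nonneg of_nat_0_le_iff)
    then have "ennreal (A + q * v + r * (L / real n)) + E = ennreal A + ennreal q * ennreal v + E + ennreal r * ennreal (L / real n)"
      for E by (simp only: ac_simps flip: \<open>_ = ennreal (A + q * v + r * (L / real n))\<close>)
    then show ?thesis ..
  qed
  finally show ?thesis unfolding A_def q_def r_def by (simp add: ac_simps)
qed

end

subsection \<open>Rates\<close>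

lemma exp_minus_le_power:
  fixes y :: real
  assumes "y > 0"
  shows "exp (- y) \<le> fact m / y ^ m"
proof -
  have "y ^ m / fact m \<le> exp y" using assms by (intro power_div_fact_le_exp) simp
  then have "y ^ m \<le> fact m * exp y" by (simp add: field_simps)
  then show ?thesis using assms by (simp add: exp_minus field_simps)
qed

lemma sum_inverse_squares_le: "(\<Sum>k=1..n. 1 / (real k)\<^sup>2) \<le> 2"
proof -
  have le: "(\<Sum>k=1..n. 1 / (real k)\<^sup>2) \<le> 2 - 1 / real n" if "n \<ge> 1" for n
    using that
  proof (induction n rule: nat_induct_at_least)
    case (Suc n)
    have "1 / (real (Suc n))\<^sup>2 \<le> 1 / (real n * real (Suc n))"
      using Suc by (intro divide_left_mono) (auto simp: power2_eq_square)
    also have "\<dots> = 1 / real n - 1 / real (Suc n)" using Suc by (simp add: field_simps)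
    finally show ?case using Suc by simp
  qed simp
  show ?thesis
  proof (cases "n = 0")
    case False
    then have "(\<Sum>k=1..n. 1 / (real k)\<^sup>2) \<le> 2 - 1 / real n" by (intro le) simp
    also have "\<dots> \<le> 2" by simp
    finally show ?thesis .
  qed simp
qed

lemma max_dim_Laguerre:
  assumes "max_dim Laguerre n \<ge> 1"
  shows "n \<ge> 2" "ln (real n) \<ge> 1 / 600"
    "real (max_dim Laguerre n) \<le> (real n)\<^sup>2 / (600 * ln (real n)) ^ 4"
    "(real n)\<^sup>2 / (600 * ln (real n)) ^ 4 \<le> real (max_dim Laguerre n) + 1"
proof -
  show n2: "n \<ge> 2"
  proof (rule ccontr)
    assume "\<not> 2 \<le> n"
    \<comment> \<open>At \<open>n = 1\<close> the denominator is ln 1 = 0, and division by zero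
      gives dimension 0.\<close>
    then have "n = 0 \<or> n = 1" by auto
    then show False using assms by auto
  qed
  have "ln (real n) \<ge> ln 2" using n2 by simp
  then show "ln (real n) \<ge> 1 / 600" using ln2_ge_two_thirds by linarith
  define q where "q = (real n)\<^sup>2 / (600 * ln (real n)) ^ 4"
  have q0: "q \<ge> 0" unfolding q_def by (intro divide_nonneg_nonneg) auto
  have "real (max_dim Laguerre n) = of_int \<lfloor>q\<rfloor>" using q0 by (simp add: q_def)
  then show "real (max_dim Laguerre n) \<le> (real n)\<^sup>2 / (600 * ln (real n)) ^ 4"
    "(real n)\<^sup>2 / (600 * ln (real n)) ^ 4 \<le> real (max_dim Laguerre n) + 1"
    unfolding q_def[symmetric] by linarith+
qed

lemma max_dim_le:
  assumes "max_dim c n \<ge> 1"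
  shows "max_dim c n \<le> n\<^sup>2"
proof (cases c)
  case Laguerre
  note M = max_dim_Laguerre[of n, OF assms[unfolded Laguerre]]
  have "(600 * ln (real n)) ^ 4 \<ge> 1" using M(2) by (intro one_le_power) simp
  then have "(real n)\<^sup>2 / (600 * ln (real n)) ^ 4 \<le> (real n)\<^sup>2 / 1" by (intro divide_left_mono) auto
  then have "(real n)\<^sup>2 / (600 * ln (real n)) ^ 4 \<le> real (n\<^sup>2)" by simp
  then have "real (max_dim c n) \<le> real (n\<^sup>2)" unfolding Laguerre by (rule order_trans[OF M(3)])
  then show ?thesis by (simp only: of_nat_le_iff)
qed simp

lemma dexp_le: "dexp c \<le> 1" by (cases c) auto

text \<open>The third power is needed because up to n^2 dimensions are summed and 1 / n has to
  remain. For Laguerre functions the exponent of \<open>k\<close> is -1/4, and the logarithm in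
  \<open>max_dim\<close> gives sqrt n * k^(-1/4) \<ge> 600 ln n, far more than the 24 ln n required.
  For Hermite functions the exponent is -1/6.\<close>

lemma dimension_tail:
  assumes n: "n \<ge> 1" and k: "1 \<le> k" "k \<le> max_dim c n"
  shows "exp (- (sqrt (real n) * real k powr (1 / 4 - dexp c / 2) / 8)) \<le> fact 18 * 8 ^ 18 / real n ^ 3"
proof (cases c)
  case Laguerre
  have M1: "max_dim Laguerre n \<ge> 1" using k Laguerre by simp
  note M = max_dim_Laguerre[OF M1]
  define l where "l = 600 * ln (real n)"
  have l0: "l > 0" using M(2) by (simp add: l_def)
  have "real k \<le> real (max_dim Laguerre n)" using k Laguerre by (simp del: max_dim.simps)
  then have kle: "real k \<le> (real n)\<^sup>2 / l ^ 4" unfolding l_def by (rule order_trans[OF _ M(3)])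
  have k0: "real k > 0" using k by simp
  have "l * real k powr (1 / 4) \<le> sqrt (real n)"
  proof (rule power_le_imp_le_base)
    have "(l * real k powr (1 / 4)) ^ Suc 3 = l ^ 4 * real k"
      using k0 by (simp add: power_mult_distrib powr_power eval_nat_numeral flip: powr_add)
    also have "\<dots> \<le> (real n)\<^sup>2" using kle l0 by (simp add: field_simps)
    also have "\<dots> = sqrt (real n) ^ Suc 3" by (simp add: eval_nat_numeral flip: real_sqrt_mult)
    finally show "(l * real k powr (1 / 4)) ^ Suc 3 \<le> sqrt (real n) ^ Suc 3" .
  qed simp
  then have "l \<le> sqrt (real n) * real k powr (1 / 4 - dexp c / 2)"
    using k0 Laguerre by (simp add: powr_minus field_simps)
  then have "3 * ln (real n) \<le> sqrt (real n) * real k powr (1 / 4 - dexp c / 2) / 8"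
    using M(2) unfolding l_def by simp
  then have "exp (- (sqrt (real n) * real k powr (1 / 4 - dexp c / 2) / 8)) \<le> exp (- (3 * ln (real n)))" by simp
  also have "\<dots> = 1 / real n ^ 3"
  proof -
    have "exp (3 * ln (real n)) = real n ^ 3"
      using n exp_of_nat_mult[of 3 "ln (real n)"] by simp
    then show ?thesis by (simp add: exp_minus inverse_eq_divide)
  qed
  also have "\<dots> \<le> fact 18 * 8 ^ 18 / real n ^ 3"
    by (intro divide_right_mono) (auto simp: fact_numeral)
  finally show ?thesis .
next
  case Hermite
  have k0: "real k > 0" and n0: "real n > 0" using k n by auto
  have kn: "real k \<le> (real n)\<^sup>2" using k Hermite by (simp flip: of_nat_power)
  \<comment> \<open>With k \<le> n^2 at least n^(1/6) is left in the exponent, and the 18th power of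
    this is n^3; hence the 18! and the 8^18.\<close>
  have "real n powr (1 / 6) = sqrt (real n) * ((real n)\<^sup>2 powr (- (1 / 6)))"
  proof -
    have "(real n)\<^sup>2 powr (- (1 / 6)) = real n powr (- (1 / 3))"
      using n0 by (simp add: powr_powr flip: powr_numeral)
    then show ?thesis using n0 by (simp flip: powr_half_sqrt powr_add)
  qed
  also have "\<dots> \<le> sqrt (real n) * (real k powr (- (1 / 6)))"
    using k0 kn by (intro mult_left_mono powr_mono2') auto
  also have "- (1 / 6) = 1 / 4 - dexp c / 2" using Hermite by simp
  finally have le: "real n powr (1 / 6) / 8 \<le> sqrt (real n) * real k powr (1 / 4 - dexp c / 2) / 8" by simp
  have "exp (- (sqrt (real n) * real k powr (1 / 4 - dexp c / 2) / 8)) \<le> exp (- (real n powr (1 / 6) / 8))"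
    using le by simp
  also have "\<dots> \<le> fact 18 / (real n powr (1 / 6) / 8) ^ 18"
    by (rule exp_minus_le_power) (use n0 in simp)
  also have "(real n powr (1 / 6) / 8) ^ 18 = real n ^ 3 / 8 ^ 18"
    using n0 by (simp add: power_divide powr_power powr_numeral)
  finally show ?thesis by simp
qed

context basis_model
begin

text \<open>The fourth power is the one that turns exp (- sqrt k / (8 * s)) into the summable
  k^(-2): 24 is 4!, 4096 is 8^4, and the 2 bounds the sum of inverse squares. The second part is n^2
  times n^(-3).\<close>

lemma excess_sum:
  assumes n: "n \<ge> 1" and M: "max_dim c n \<ge> 1"
  shows "(\<Sum>k=1..max_dim c n. \<integral>\<^sup>+X. ennreal (excess n X k) \<partial>joint_law n f)
    \<le> ennreal ((256 * 24 * 4096 * 2 * s ^ 6 + 256 * (fact 18 * 8 ^ 18) * C\<phi>) / real n)"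
proof -
  define M where "M = max_dim c n"
  define K where "K = (fact 18 * 8 ^ 18 :: real)"
  have K0: "K \<ge> 0" by (simp add: K_def)
  have Mn: "M \<le> n\<^sup>2" unfolding M_def by (rule max_dim_le) fact
  have n0: "real n > 0" using n by simp
  have "(\<Sum>k=1..M. \<integral>\<^sup>+X. ennreal (excess n X k) \<partial>joint_law n f)
    \<le> (\<Sum>k=1..M. ennreal (256 * 24 * 4096 * s ^ 6 / real n * (1 / (real k)\<^sup>2) + 256 * C\<phi> * (K / real n ^ 3)))"
  proof (rule sum_mono)
    fix k assume k: "k \<in> {1..M}"
    have k0: "real k > 0" using k by simp
    have "(\<integral>\<^sup>+X. ennreal (excess n X k) \<partial>joint_law n f)
      \<le> ennreal (256 * s\<^sup>2 / real n * exp (- (sqrt (real k) / (8 * s)))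
        + 256 * C\<phi> * exp (- (sqrt (real n) * real k powr (1 / 4 - dexp c / 2) / 8)))"
      by (rule excess_expectation) (use n k Mn dexp_le in auto)
    also have "\<dots> \<le> ennreal (256 * 24 * 4096 * s ^ 6 / real n * (1 / (real k)\<^sup>2) + 256 * C\<phi> * (K / real n ^ 3))"
    proof (intro ennreal_leI add_mono mult_left_mono)
      have "exp (- (sqrt (real k) / (8 * s))) \<le> fact 4 / (sqrt (real k) / (8 * s)) ^ 4"
        by (rule exp_minus_le_power) (use k0 s1 in simp)
      also have "\<dots> = 24 * 4096 * s ^ 4 / (real k)\<^sup>2"
      proof -
        have "sqrt (real k) ^ 4 = (real k)\<^sup>2"
          by (simp add: eval_nat_numeral flip: real_sqrt_mult)
        then show ?thesis by (simp add: power_divide power_mult_distrib fact_numeral)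
      qed
      finally have "256 * s\<^sup>2 / real n * exp (- (sqrt (real k) / (8 * s)))
          \<le> 256 * s\<^sup>2 / real n * (24 * 4096 * s ^ 4 / (real k)\<^sup>2)"
        by (rule mult_left_mono) simp
      also have "\<dots> = 256 * 24 * 4096 * (s\<^sup>2 * s ^ 4) / real n * (1 / (real k)\<^sup>2)" by simp
      also have "s\<^sup>2 * s ^ 4 = s ^ 6" by (simp flip: power_add)
      finally show "256 * s\<^sup>2 / real n * exp (- (sqrt (real k) / (8 * s)))
          \<le> 256 * 24 * 4096 * s ^ 6 / real n * (1 / (real k)\<^sup>2)" .
      show "exp (- (sqrt (real n) * real k powr (1 / 4 - dexp c / 2) / 8)) \<le> K / real n ^ 3"
        unfolding K_def by (rule dimension_tail) (use n k M_def in auto)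
    qed (use C1 in auto)
    finally show "(\<integral>\<^sup>+X. ennreal (excess n X k) \<partial>joint_law n f)
      \<le> ennreal (256 * 24 * 4096 * s ^ 6 / real n * (1 / (real k)\<^sup>2) + 256 * C\<phi> * (K / real n ^ 3))" .
  qed
  also have "\<dots> = ennreal (\<Sum>k=1..M. 256 * 24 * 4096 * s ^ 6 / real n * (1 / (real k)\<^sup>2) + 256 * C\<phi> * (K / real n ^ 3))"
    by (rule sum_ennreal) (use s1 C1 K0 in auto)
  also have "(\<Sum>k=1..M. 256 * 24 * 4096 * s ^ 6 / real n * (1 / (real k)\<^sup>2) + 256 * C\<phi> * (K / real n ^ 3))
     = 256 * 24 * 4096 * s ^ 6 / real n * (\<Sum>k=1..M. 1 / (real k)\<^sup>2) + real M * (256 * C\<phi> * (K / real n ^ 3))"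
    by (simp add: sum.distrib sum_distrib_left)
  also have "\<dots> \<le> 256 * 24 * 4096 * s ^ 6 / real n * 2 + (real n)\<^sup>2 * (256 * C\<phi> * (K / real n ^ 3))"
  proof (intro add_mono mult_left_mono mult_right_mono sum_inverse_squares_le)
    show "real M \<le> (real n)\<^sup>2" using Mn by (simp flip: of_nat_power)
  qed (use s1 C1 K0 in auto)
  also have "\<dots> = (256 * 24 * 4096 * 2 * s ^ 6 + 256 * K * C\<phi>) / real n"
    using n0 by (simp add: field_simps power2_eq_square power3_eq_cube)
  finally show ?thesis unfolding M_def K_def by (simp add: ennreal_leI)
qed

lemma risk_bound:
  assumes n: "n \<ge> 1" and M: "max_dim c n \<ge> 1" and \<kappa>: "\<kappa> \<ge> 1" and \<Delta>: "\<Delta> \<ge> 84 * C\<phi>"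
    and k0: "k0 \<in> {1..max_dim c n}" and L: "moment (2 * alpha c) f \<le> ennreal L" "L \<ge> 0"
    and C: "1 \<le> C" "v \<le> C" "F \<le> C" "s = sqrt C" "L \<le> C"
  shows "risk w c \<Delta> \<kappa> n f \<le> ennreal (3 * B k0 + (36 * C\<phi> + 2 * \<Delta>) * (C * (sqrt (real k0) / real n))
     + 4 * (ln (real n) / real n)
     + (40 * C\<phi> + 13 * (256 * 24 * 4096 * 2) + 13 * (256 * (fact 18 * 8 ^ 18) * C\<phi>)) * (C ^ 3 / real n))"
proof -
  define M where "M = max_dim c n"
  define K where "K = (fact 18 * 8 ^ 18 :: real)"
  have K0: "K \<ge> 0" by (simp add: K_def)
  have Mn: "M \<le> n\<^sup>2" unfolding M_def by (rule max_dim_le) fact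
  have M1: "M \<ge> 1" using M M_def by simp
  have n0: "real n > 0" using n by simp
  have D0: "\<Delta> \<ge> 0" using \<Delta> C1 by simp
  have s6: "s ^ 6 = C ^ 3"
  proof -
    have "s ^ 6 = (s\<^sup>2) ^ 3" by (simp flip: power_mult)
    then show ?thesis using C by simp
  qed
  have C3: "C ^ 3 \<ge> 1" using C(1) by (rule one_le_power)
  have CC: "C * C \<le> C ^ 3"
    using mult_left_mono[OF C(1), of "C * C"] by (simp add: power3_eq_cube)
  define A where "A = 3 * B k0 + 36 * H n k0 + 2 * ln (real M) / real n
        + 2 * \<Delta> * v * sqrt (real k0) / real n + 4 * (9 * H n M + F) * (L / real n)"
  define E where "E = (256 * 24 * 4096 * 2 * s ^ 6 + 256 * K * C\<phi>) / real n"
  have E0: "E \<ge> 0" unfolding E_def s6 using C(1) C1 K0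
    by (intro divide_nonneg_nonneg add_nonneg_nonneg mult_nonneg_nonneg) auto
  have A0: "A \<ge> 0" unfolding A_def
    using B_nonneg[of k0] H_nonneg[of n k0] H_nonneg[of n M] F_nonneg D0 v0 L(2) M1 by simp
  have "risk w c \<Delta> \<kappa> n f \<le> ennreal A + 13 * ennreal E"
    unfolding A_def E_def K_def M_def
    by (rule order_trans[OF risk_oracle[OF n M \<kappa> \<Delta> k0 L] add_left_mono[OF mult_left_mono[OF excess_sum[OF n M]]]]) simp
  also have "\<dots> = ennreal (A + 13 * E)" using A0 E0 by (simp add: ennreal_plus ennreal_mult)
  also have "A + 13 * E \<le> 3 * B k0 + (36 * C\<phi> + 2 * \<Delta>) * (C * (sqrt (real k0) / real n))
     + 4 * (ln (real n) / real n)
     + (40 * C\<phi> + 13 * (256 * 24 * 4096 * 2) + 13 * (256 * K * C\<phi>)) * (C ^ 3 / real n)"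
  proof -
    define r where "r = sqrt (real k0) / real n"
    define t where "t = C ^ 3 / real n"
    have r0: "r \<ge> 0" by (simp add: r_def)
    have t0: "1 / real n \<le> t" using C3 n0 unfolding t_def by (intro divide_right_mono) auto
    have vr: "v * r \<le> C * r" using C r0 by (intro mult_right_mono) auto
    have h1: "36 * H n k0 \<le> 36 * C\<phi> * (C * r)"
    proof -
      have "H n k0 = C\<phi> * (v * r)" by (simp add: H_def r_def)
      then show ?thesis using mult_left_mono[OF vr, of "C\<phi>"] C1 by simp
    qed
    have h2: "2 * \<Delta> * v * sqrt (real k0) / real n \<le> 2 * \<Delta> * (C * r)"
      using mult_left_mono[OF vr, of "2 * \<Delta>"] D0 by (simp add: r_def mult_ac)
    have h3: "2 * ln (real M) / real n \<le> 4 * (ln (real n) / real n)"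
    proof -
      have "real M \<le> (real n)\<^sup>2" using Mn by (simp flip: of_nat_power)
      then have "ln (real M) \<le> ln ((real n)\<^sup>2)" using M1 n0 by (subst ln_le_cancel_iff) auto
      also have "\<dots> = 2 * ln (real n)" using n0 by (simp add: ln_realpow)
      finally have "2 * ln (real M) / real n \<le> 2 * (2 * ln (real n)) / real n"
        using n0 by (intro divide_right_mono mult_left_mono) auto
      then show ?thesis by simp
    qed
    \<comment> \<open>On the bad event the variance is taken at the largest dimension. As sqrt M
      \<le> n, it is still of order C, like \<open>F\<close>, so the factor L / n gives C^2 /
      n.\<close>
    have h4: "4 * (9 * H n M + F) * (L / real n) \<le> 40 * C\<phi> * t"
    proof -
      have "sqrt (real M) \<le> real n" using Mn by (intro real_le_lsqrt) (auto simp flip: of_nat_power)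
      then have "H n M \<le> C\<phi> * v" unfolding H_def using C1 v0 n0
        by (simp add: divide_le_eq mult_left_mono)
      also have "\<dots> \<le> C\<phi> * C" using C C1 by (intro mult_left_mono) auto
      finally have HM: "H n M \<le> C\<phi> * C" .
      have "1 * C \<le> C\<phi> * C" using C C1 by (intro mult_right_mono) auto
      then have "9 * H n M + F \<le> 10 * (C\<phi> * C)" using HM C(3) by linarith
      then have "4 * (9 * H n M + F) * (L / real n) \<le> 4 * (10 * (C\<phi> * C)) * (C / real n)"
        using C L(2) C1 n0 H_nonneg[of n M] F_nonneg by (intro mult_mono divide_right_mono) auto
      also have "\<dots> = 40 * C\<phi> * (C * C / real n)" by simp
      also have "\<dots> \<le> 40 * C\<phi> * t" unfolding t_def using CC C1 n0
        by (intro mult_left_mono divide_right_mono) auto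
      finally show ?thesis .
    qed
    have h5: "13 * E \<le> (13 * (256 * 24 * 4096 * 2) + 13 * (256 * K * C\<phi>)) * t"
    proof -
      have "13 * E = 13 * (256 * 24 * 4096 * 2) * t + 13 * (256 * K * C\<phi>) * (1 / real n)"
        unfolding E_def t_def s6 by (simp add: add_divide_distrib)
      also have "\<dots> \<le> 13 * (256 * 24 * 4096 * 2) * t + 13 * (256 * K * C\<phi>) * t"
        using t0 K0 C1 by (intro add_left_mono mult_left_mono) auto
      finally show ?thesis by (simp only: distrib_right)
    qed
    have d1: "(36 * C\<phi> + 2 * \<Delta>) * (C * r) = 36 * C\<phi> * (C * r) + 2 * \<Delta> * (C * r)"
      by (simp only: distrib_right)
    have d2: "(40 * C\<phi> + 13 * (256 * 24 * 4096 * 2) + 13 * (256 * K * C\<phi>)) * t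
      = 40 * C\<phi> * t + (13 * (256 * 24 * 4096 * 2) + 13 * (256 * K * C\<phi>)) * t"
      by (simp only: distrib_right add.assoc)
    show ?thesis unfolding A_def r_def[symmetric] t_def[symmetric] d1 d2
      using h1 h2 h3 h4 h5 by linarith
  qed
  finally show ?thesis unfolding K_def by (simp add: ennreal_leI)
qed

end

text \<open>Since \<omega> decreases, \<omega> k can be pulled out of the tail of the ellipsoid sum.
  Dimension \<open>k\<close> uses the indices below \<open>k\<close>, so for
  \<open>k \<ge> 1\<close> the tail stays clear of index 0, which the ellipsoid leaves free.\<close>

lemma class_bias:
  assumes f: "f \<in> density_class c \<omega> L" and pos: "\<And>k. k \<ge> 1 \<Longrightarrow> \<omega> k > 0"
    and mono: "\<And>k l. 1 \<le> k \<Longrightarrow> k \<le> l \<Longrightarrow> \<omega> l \<le> \<omega> k" and L: "L \<ge> 0" and k: "k \<ge> 1"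
  shows "(l2_norm (supp c) f)\<^sup>2 - (\<Sum>j<k. (coef c f j)\<^sup>2) \<le> \<omega> k * L"
proof -
  interpret density_model c f by unfold_locales (use f in \<open>simp add: density_class_def\<close>)
  have tail: "(\<Sum>j\<in>{k..<m}. (a j)\<^sup>2) \<le> \<omega> k * L" for m
  proof -
    have "ennreal (\<Sum>j\<in>{k..<m}. \<bar>a j\<bar>\<^sup>2 / \<omega> j) = (\<Sum>j\<in>{k..<m}. ennreal (\<bar>a j\<bar>\<^sup>2 / \<omega> j))"
      by (intro sum_ennreal[symmetric] divide_nonneg_nonneg) (use k pos in \<open>auto intro: less_imp_le\<close>)
    also have "\<dots> \<le> (\<Sum>\<^sub>\<infinity>j\<in>{1..}. ennreal (\<bar>a j\<bar>\<^sup>2 / \<omega> j))"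
      using k by (subst nonneg_infsum_complete) (auto intro!: SUP_upper)
    also have "\<dots> \<le> ennreal L" using f by (simp add: density_class_def)
    finally have le: "(\<Sum>j\<in>{k..<m}. \<bar>a j\<bar>\<^sup>2 / \<omega> j) \<le> L" using L by (simp add: ennreal_le_iff)
    have "(\<Sum>j\<in>{k..<m}. (a j)\<^sup>2) \<le> (\<Sum>j\<in>{k..<m}. \<omega> k * (\<bar>a j\<bar>\<^sup>2 / \<omega> j))"
    proof (rule sum_mono)
      fix j assume j: "j \<in> {k..<m}"
      then have "\<omega> j > 0" "\<omega> j \<le> \<omega> k" using pos[of j] mono[of k j] k by auto
      then show "(a j)\<^sup>2 \<le> \<omega> k * (\<bar>a j\<bar>\<^sup>2 / \<omega> j)"
        by (simp add: field_simps mult_right_mono)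
    qed
    also have "\<dots> = \<omega> k * (\<Sum>j\<in>{k..<m}. \<bar>a j\<bar>\<^sup>2 / \<omega> j)" by (simp add: sum_distrib_left)
    also have "\<dots> \<le> \<omega> k * L" using le pos[OF k] by (intro mult_left_mono) auto
    finally show ?thesis .
  qed
  have lim: "(\<lambda>m. \<Sum>j<m. (a j)\<^sup>2) \<longlonglongrightarrow> (l2_norm (supp c) f)\<^sup>2"
    using coef_sums by (simp add: sums_def)
  have "(l2_norm (supp c) f)\<^sup>2 \<le> (\<Sum>j<k. (a j)\<^sup>2) + \<omega> k * L"
  proof (rule LIMSEQ_le_const2[OF lim], intro exI allI impI)
    fix m assume "k \<le> m"
    then have "(\<Sum>j<m. (a j)\<^sup>2) = (\<Sum>j<k. (a j)\<^sup>2) + (\<Sum>j\<in>{k..<m}. (a j)\<^sup>2)"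
      by (simp add: lessThan_atLeast0 sum.atLeastLessThan_concat)
    then show "(\<Sum>j<m. (a j)\<^sup>2) \<le> (\<Sum>j<k. (a j)\<^sup>2) + \<omega> k * L" using tail[of m] by simp
  qed
  then show ?thesis by simp
qed

text \<open>The infimum is attained: beyond \<open>K\<close> the term sqrt k / n alone exceeds the
  value at 1, so finitely many dimensions compete.\<close>

lemma opt_dim_properties:
  assumes n: "n \<ge> 1"
  shows "opt_dim \<omega> n \<ge> 1" "\<omega> (opt_dim \<omega> n) \<le> opt_rate \<omega> n"
    "sqrt (real (opt_dim \<omega> n)) / real n \<le> opt_rate \<omega> n"
proof -
  define r where "r = rate_at \<omega> n"
  have n0: "real n > 0" using n by simp
  define K where "K = nat \<lceil>(real n * r 1)\<^sup>2\<rceil> + 1"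
  have big: "r 1 \<le> r k" if "k > K" for k
  proof -
    have "(real n * r 1)\<^sup>2 \<le> real k" using that unfolding K_def by linarith
    then have "real n * r 1 \<le> sqrt (real k)" by (rule real_le_rsqrt)
    then have "r 1 \<le> sqrt (real k) / real n" using n0 by (simp add: field_simps)
    also have "\<dots> \<le> r k" by (simp add: r_def rate_at_def)
    finally show ?thesis .
  qed
  obtain m where m: "m \<in> {1..K}" "\<And>k. k \<in> {1..K} \<Longrightarrow> r m \<le> r k"
    using ex_min_if_finite[of "r ` {1..K}"] by (auto simp: not_less K_def)
  have min: "r m \<le> r k" if "k \<ge> 1" for k
    using m(2)[of k] m(2)[of 1] big[of k] that by (cases "k \<le> K") (auto simp: K_def)
  have "opt_rate \<omega> n = r m"
    unfolding opt_rate_def r_def[symmetric] by (rule cInf_eq_minimum) (use m min in auto)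
  then have "\<exists>k. k \<ge> 1 \<and> rate_at \<omega> n k = opt_rate \<omega> n" using m by (auto simp: r_def)
  then have "opt_dim \<omega> n \<ge> 1 \<and> rate_at \<omega> n (opt_dim \<omega> n) = opt_rate \<omega> n"
    unfolding opt_dim_def by (rule LeastI_ex)
  then show "opt_dim \<omega> n \<ge> 1" "\<omega> (opt_dim \<omega> n) \<le> opt_rate \<omega> n"
    "sqrt (real (opt_dim \<omega> n)) / real n \<le> opt_rate \<omega> n"
    unfolding rate_at_def by auto
qed

lemma ln_le_two_sqrt:
  assumes "x > 0"
  shows "ln x \<le> 2 * sqrt x"
proof -
  have "ln (sqrt x) \<le> sqrt x" using assms ln_le_minus_one[of "sqrt x"] by simp
  then show ?thesis using assms by (simp add: ln_sqrt)
qed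

text \<open>A rate above 1 / sqrt n dominates ln n / n anyway. Below it, |ln R| is at least ln n /
  2, and the condition on the dimension gives ln n \<le> C\<phi> * sqrt k.\<close>

lemma ln_div_le_rate:
  assumes n: "n \<ge> 1" and C: "C \<ge> 1" and C\<phi>: "C\<phi> \<ge> 1"
    and R: "1 / real n \<le> R" "sqrt (real k) / real n \<le> R"
    and log: "sqrt (real k) \<ge> 400 * C / C\<phi> * \<bar>ln R\<bar>"
  shows "ln (real n) / real n \<le> (2 + C\<phi>) * R"
proof -
  have n0: "real n > 0" using n by simp
  have "0 < 1 / real n" using n0 by simp
  then have R0: "R > 0" using R(1) by linarith
  have lnn: "ln (real n) \<ge> 0" using n by simp
  show ?thesis
  proof (cases "R \<ge> 1 / sqrt (real n)")
    case True
    have "ln (real n) / real n \<le> 2 * sqrt (real n) / real n"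
      using ln_le_two_sqrt[OF n0] by (intro divide_right_mono) auto
    also have "\<dots> = 2 * (1 / sqrt (real n))" using n0 by (simp add: field_simps)
    also have "\<dots> \<le> 2 * R" using True by simp
    also have "\<dots> \<le> (2 + C\<phi>) * R" using R0 C\<phi> by simp
    finally show ?thesis .
  next
    case False
    then have "ln R \<le> ln (1 / sqrt (real n))" using R0 n0 by (subst ln_le_cancel_iff) auto
    also have "\<dots> = - (ln (real n) / 2)" using n0 by (simp add: ln_div ln_sqrt)
    finally have "ln (real n) / 2 \<le> \<bar>ln R\<bar>" by linarith
    then have "400 * C / C\<phi> * (ln (real n) / 2) \<le> 400 * C / C\<phi> * \<bar>ln R\<bar>"
      using C C\<phi> by (intro mult_left_mono) auto
    then have "200 * C / C\<phi> * ln (real n) \<le> sqrt (real k)" using log by simp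
    moreover have "1 / C\<phi> * ln (real n) \<le> 200 * C / C\<phi> * ln (real n)"
      using C C\<phi> lnn by (intro mult_right_mono divide_right_mono) auto
    ultimately have "ln (real n) \<le> C\<phi> * sqrt (real k)" using C\<phi> by (simp add: field_simps)
    then have "ln (real n) / real n \<le> C\<phi> * (sqrt (real k) / real n)"
      using n0 by (simp add: divide_right_mono)
    also have "\<dots> \<le> C\<phi> * R" using R(2) C\<phi> by (intro mult_left_mono) auto
    also have "\<dots> \<le> (2 + C\<phi>) * R" using R0 by simp
    finally show ?thesis .
  qed
qed

text \<open>For the optimal dimension \<open>k\<close> this case only arises with Laguerre functions and small samples; the
  trivial bound \<open>C\<close> of the bias is then absorbed by one of the two terms on the right.\<close>

lemma excluded_dimension:
  assumes n: "n \<ge> 1" and M: "max_dim c n \<ge> 1" and k: "k > max_dim c n" and C: "C \<ge> 1"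
    and R: "sqrt (real k) / real n \<le> R" and N: "real n \<le> N"
  shows "C \<le> 600 ^ 4 * 256 * (max N C * R + C ^ 3 / real n)"
proof -
  define T where "T = max N C * R + C ^ 3 / real n"
  have n0: "real n > 0" using n by simp
  have R0: "R \<ge> 0" using R by (rule order_trans[rotated]) simp
  have T1: "N * R \<le> T" "C * R \<le> T" "C ^ 3 / real n \<le> T"
    using R0 C n0 mult_right_mono[of N "max N C" R] mult_right_mono[of C "max N C" R]
    unfolding T_def by (auto intro: add_increasing2 add_increasing)
  have T0: "T \<ge> 0" using T1(2) R0 C by (meson mult_nonneg_nonneg order_trans zero_le_one)
  have big: "T \<le> 600 ^ 4 * 256 * T" using T0 by simp
  show ?thesis unfolding T_def[symmetric]
  proof (cases c)
    case Hermite
    have "real n = sqrt (real (max_dim c n))" using Hermite by simp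
    also have "\<dots> \<le> sqrt (real k)" using k by simp
    finally have "1 \<le> sqrt (real k) / real n" using n0 by simp
    then have "C * 1 \<le> C * R" using R C by (intro mult_left_mono) auto
    then show "C \<le> 600 ^ 4 * 256 * T" using T1(2) big by linarith
  next
    case Laguerre
    note dimL = max_dim_Laguerre[of n, OF M[unfolded Laguerre]]
    define l where "l = 600 * ln (real n)"
    have l0: "l > 0" using dimL(2) by (simp add: l_def)
    define q where "q = real n / l\<^sup>2"
    \<comment> \<open>An excluded dimension is at least \<open>max_dim c n + 1\<close>, which makes
      up for the rounding in \<open>max_dim\<close>.\<close>
    have "real n * (1 / l\<^sup>2) \<le> sqrt (real k)"
    proof (rule real_le_rsqrt)
      have "(real n * (1 / l\<^sup>2))\<^sup>2 = (real n)\<^sup>2 / l ^ 4" by (simp add: power_divide flip: power_mult)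
      also have "\<dots> \<le> real (max_dim c n) + 1" using dimL(4) Laguerre by (simp add: l_def)
      also have "\<dots> \<le> real k" using k by linarith
      finally show "(real n * (1 / l\<^sup>2))\<^sup>2 \<le> real k" .
    qed
    also have "\<dots> \<le> real n * R" using R n0 by (simp add: field_simps)
    finally have "1 / l\<^sup>2 \<le> R" using n0 by (simp only: mult_le_cancel_left_pos)
    then have "real n * (1 / l\<^sup>2) \<le> N * R" using N R0 n0 by (intro mult_mono) auto
    then have qT: "q \<le> T" using T1(1) by (simp add: q_def)
    show "C \<le> 600 ^ 4 * 256 * T"
    proof (cases "C \<le> q")
      case True then show ?thesis using qT big by linarith
    next
      case False
      \<comment> \<open>If C > q = n / l^2, then C * n / l^4 is at most C^3 / n, and it remains to
        bound l^4 / n. Here 256 is 4^4, from ln n \<le> 4 n^(1/4).\<close>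
      have l4: "l ^ 4 \<le> 600 ^ 4 * 256 * real n"
      proof -
        have "ln (real n) \<le> 4 * sqrt (sqrt (real n))"
          using ln_le_two_sqrt[of "sqrt (real n)"] n0 by (simp add: ln_sqrt)
        then have "ln (real n) ^ 4 \<le> (4 * sqrt (sqrt (real n))) ^ 4"
          using n by (intro power_mono) auto
        also have "\<dots> = 256 * real n"
        proof -
          have "sqrt (sqrt (real n)) ^ 4 = (sqrt (sqrt (real n)) ^ 2) ^ 2" by (simp only: power_mult[symmetric]) simp
          also have "\<dots> = real n" by simp
          finally show ?thesis by (simp add: power_mult_distrib)
        qed
        finally show ?thesis by (simp add: l_def power_mult_distrib)
      qed
      have "C * (real n / l ^ 4) = C * (q\<^sup>2 / real n)"
        using n0 l0 by (simp add: q_def power_divide power2_eq_square eval_nat_numeral)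
      also have "\<dots> \<le> C * (C\<^sup>2 / real n)"
        using False C n0 l0 by (intro mult_left_mono divide_right_mono power_mono) (auto simp: q_def)
      also have "\<dots> = C ^ 3 / real n" by (simp add: power2_eq_square power3_eq_cube)
      finally have "C * (real n / l ^ 4) \<le> T" using T1(3) by linarith
      then have "C * real n \<le> T * l ^ 4" using l0 by (simp add: field_simps)
      also have "\<dots> \<le> T * (600 ^ 4 * 256 * real n)" using l4 T0 by (intro mult_left_mono) auto
      finally have "C * real n \<le> (600 ^ 4 * 256 * T) * real n" by (simp add: mult_ac)
      then show ?thesis using n0 by (simp only: mult_le_cancel_right_pos)
    qed
  qed
qed

text \<open>Any member of the class forces \<open>C \<ge> 1\<close>, since its magnitude lies
  between 1 and C. The bound on the squared sup norm makes sqrt C an almost sure bound on the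
  density.\<close>

lemma class_basis_model:
  assumes bc: "basis_const c C\<phi>" and f: "f \<in> density_class c \<omega> L"
    and m: "1 \<le> magnitude c L f" "magnitude c L f \<le> ennreal C" and C: "C > 0"
  shows "C \<ge> 1" "L \<le> C" "(l2_norm (supp c) f)\<^sup>2 \<le> C"
    "\<exists>v. v \<le> C \<and> basis_model c f C\<phi> v (sqrt C)"
proof -
  have dens: "l2_density (supp c) f" using f by (simp add: density_class_def)
  interpret density_model c f by unfold_locales (rule dens)
  have "1 \<le> ennreal C" using m by (rule order_trans)
  then show C1: "C \<ge> 1" using C by (simp add: ennreal_ge_1)
  have b: "ennreal L \<le> ennreal C" "vf c f \<le> ennreal C" "ennreal ((l2_norm (supp c) f)\<^sup>2) \<le> ennreal C"
     "(linf_norm (supp c) f)\<^sup>2 \<le> ennreal C"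
    using m(2) unfolding magnitude_def by simp_all
  show "L \<le> C" "(l2_norm (supp c) f)\<^sup>2 \<le> C" using b(1,3) C by (simp_all add: ennreal_le_iff)
  define v where "v = enn2real (vf c f)"
  have "vf c f < \<infinity>" using b(2) by (rule order_le_less_trans) simp
  then have vf: "vf c f = ennreal v" by (simp add: v_def)
  have v0: "v \<ge> 0" by (simp add: v_def)
  have vC: "v \<le> C" using b(2) C unfolding vf by (simp add: ennreal_le_iff)
  have linf: "linf_norm (supp c) f \<le> ennreal (sqrt C)"
  proof (cases "linf_norm (supp c) f")
    case (real r)
    then have "r\<^sup>2 \<le> C" using b(4) C by (simp add: ennreal_power)
    then show ?thesis using real by (simp add: ennreal_leI real_le_rsqrt)
  next
    case top
    then show ?thesis using b(4) by (simp add: power2_eq_square ennreal_mult_top top_unique)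
  qed
  have "AE x in lborel. f x \<le> sqrt C"
  proof -
    let ?g = "\<lambda>x. ennreal (\<bar>f x\<bar> * indicator (supp c) x)"
    have "AE x in lborel. ?g x \<le> esssup lborel ?g" by (rule esssup_AE)
    then show ?thesis
    proof eventually_elim
      fix x assume "?g x \<le> esssup lborel ?g"
      then have "?g x \<le> ennreal (sqrt C)" using linf unfolding linf_norm_def by (rule order_trans)
      then show "f x \<le> sqrt C"
        using f_nonneg[of x] f_outside[of x] C by (cases "x \<in> supp c") (auto simp: ennreal_le_iff)
    qed
  qed
  then have "basis_model c f C\<phi> v (sqrt C)"
    using C1 by (intro basis_model.intro[OF density_model_axioms] basis_model_axioms.intro bc vf v0) auto
  then show "\<exists>v. v \<le> C \<and> basis_model c f C\<phi> v (sqrt C)" using vC by blast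
qed

theorem corollary3p9:
  fixes c :: basis_case and w :: weighting and C\<phi> \<Delta> \<kappa> :: real
  assumes "basis_const c C\<phi>"
    and "\<Delta> \<ge> 84 * C\<phi>"
    and "\<kappa> \<ge> 1"
  shows "\<exists>C>0. \<forall>(L::real) (\<omega>::nat \<Rightarrow> real) (C\<omega>L::real) (n\<omega>L::nat).
    L > 0 \<longrightarrow>
    (\<forall>k\<ge>1. \<omega> k > 0) \<longrightarrow>
    (\<forall>k\<ge>1. \<forall>l\<ge>k. \<omega> l \<le> \<omega> k) \<longrightarrow>
    \<omega> 1 \<le> 1 \<longrightarrow>
    \<omega> \<longlonglongrightarrow> 0 \<longrightarrow>
    C\<omega>L > 0 \<longrightarrow>
    (\<forall>f\<in>density_class c \<omega> L. 1 \<le> magnitude c L f \<and> magnitude c L f \<le> ennreal C\<omega>L) \<longrightarrow>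
    n\<omega>L \<ge> 1 \<longrightarrow>
    (\<forall>n\<ge>n\<omega>L. sqrt (real (max_dim c n)) \<ge> sqrt (real (opt_dim \<omega> n)) \<and>
       sqrt (real (opt_dim \<omega> n)) \<ge> 400 * C\<omega>L / C\<phi> * \<bar>ln (opt_rate \<omega> n)\<bar>) \<longrightarrow>
    (\<forall>n\<ge>1. max_dim c n \<ge> 1 \<longrightarrow>
       (SUP f\<in>density_class c \<omega> L. risk w c \<Delta> \<kappa> n f)
         \<le> ennreal (C * (max (real n\<omega>L) C\<omega>L * opt_rate \<omega> n + C\<omega>L ^ 3 / real n)))"
proof -
  have C\<phi>1: "C\<phi> \<ge> 1" using assms(1) by (simp add: basis_const_def)
  have D0: "\<Delta> \<ge> 0" using assms(2) C\<phi>1 by simp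
  define K1 where "K1 = 36 * C\<phi> + 2 * \<Delta>"
  define K2 where "K2 = 40 * C\<phi> + 13 * (256 * 24 * 4096 * 2) + 13 * (256 * (fact 18 * 8 ^ 18) * C\<phi>)"
  define K4 where "K4 = (600 ^ 4 * 256 :: real)"
  \<comment> \<open>One summand each for bias, variance, logarithm and remainder, depending on
    C\<phi> and \<Delta> only.\<close>
  define K where "K = 3 * K4 + K1 + 4 * (2 + C\<phi>) + K2"
  have K10: "K1 \<ge> 0" unfolding K1_def using C\<phi>1 D0 by simp
  have K20: "K2 \<ge> 0" unfolding K2_def using C\<phi>1 by simp
  have K41: "K4 \<ge> 1" unfolding K4_def by simp
  have K0: "K > 0" unfolding K_def using K10 K20 K41 C\<phi>1 by simp
  show ?thesis
  \<comment> \<open>The supremum is resolved into its members at once, so that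
    \<open>C \<ge> 1\<close> is available; an empty class leaves nothing to prove.\<close>
  proof (rule exI[of _ K], intro conjI K0 allI impI SUP_least)
    fix L :: real and \<omega> :: "nat \<Rightarrow> real" and C :: real and N n :: nat and f :: "real \<Rightarrow> real"
    assume L: "L > 0" and pos: "\<forall>k\<ge>1. \<omega> k > 0" and mono: "\<forall>k\<ge>1. \<forall>l\<ge>k. \<omega> l \<le> \<omega> k"
      and C0: "C > 0"
      and mag: "\<forall>f\<in>density_class c \<omega> L. 1 \<le> magnitude c L f \<and> magnitude c L f \<le> ennreal C"
      and N: "N \<ge> 1"
      and dims: "\<forall>n\<ge>N. sqrt (real (max_dim c n)) \<ge> sqrt (real (opt_dim \<omega> n)) \<and>
         sqrt (real (opt_dim \<omega> n)) \<ge> 400 * C / C\<phi> * \<bar>ln (opt_rate \<omega> n)\<bar>"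
      and n: "n \<ge> 1" and M: "max_dim c n \<ge> 1" and f: "f \<in> density_class c \<omega> L"
    have m: "1 \<le> magnitude c L f" "magnitude c L f \<le> ennreal C" using mag f by auto
    note cm = class_basis_model[OF assms(1) f m C0]
    have Cge1: "C \<ge> 1" by (rule cm(1))
    obtain v where v: "v \<le> C" and bm: "basis_model c f C\<phi> v (sqrt C)" using cm(4) by blast
    interpret basis_model c f C\<phi> v "sqrt C" by (rule bm)
    define k where "k = opt_dim \<omega> n"
    define R where "R = opt_rate \<omega> n"
    define T where "T = max (real N) C * R + C ^ 3 / real n"
    have n0: "real n > 0" using n by simp
    have k: "k \<ge> 1" "\<omega> k \<le> R" "sqrt (real k) / real n \<le> R"
      unfolding k_def R_def using opt_dim_properties[OF n] by auto
    have R1: "1 / real n \<le> R"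
    proof -
      have "1 / real n \<le> sqrt (real k) / real n" using k(1) n0 by (intro divide_right_mono) auto
      then show ?thesis using k(3) by linarith
    qed
    have R0: "R \<ge> 0" using R1 by (rule order_trans[rotated]) simp
    have mx: "real N * R \<le> max (real N) C * R" "C * R \<le> max (real N) C * R"
      by (intro mult_right_mono R0; simp)+
    have CR: "0 \<le> C ^ 3 / real n" "0 \<le> C * R" using C0 R0 by auto
    have T: "real N * R \<le> T" "C * R \<le> T" "C ^ 3 / real n \<le> T"
      unfolding T_def using mx CR by linarith+
    have T0: "T \<ge> 0" using T(2) CR(2) by linarith
    have RT: "R \<le> T" using T(2) mult_right_mono[OF Cge1 R0] by simp
    have mom: "moment (2 * alpha c) f \<le> ennreal L" using f by (simp add: density_class_def)
    have FC: "F \<le> C" using cm(3) by (simp add: F_def)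
    \<comment> \<open>For \<open>n < N\<close> the optimal dimension may not be available. Capping
      it can only lower the variance term, so only the bias needs separate treatment.\<close>
    define k0 where "k0 = min k (max_dim c n)"
    have k0: "k0 \<in> {1..max_dim c n}" using k(1) M by (auto simp: k0_def)
    have risk: "risk w c \<Delta> \<kappa> n f \<le> ennreal (3 * B k0 + K1 * (C * (sqrt (real k0) / real n))
       + 4 * (ln (real n) / real n) + K2 * (C ^ 3 / real n))"
      unfolding K1_def K2_def
      by (rule risk_bound[OF n M assms(3) assms(2) k0 mom]) (use L Cge1 v FC cm(2) in auto)
    \<comment> \<open>Below \<open>N\<close> the condition on the dimension says nothing, but then
      ln n / n \<le> 1 \<le> N * (1 / n) \<le> N * R: this is what the maximum with \<open>N\<close>
      in the bound is for.\<close>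
    have lnT: "ln (real n) / real n \<le> (2 + C\<phi>) * T"
    proof (cases "n \<ge> N")
      case True
      have "ln (real n) / real n \<le> (2 + C\<phi>) * R"
        by (rule ln_div_le_rate[OF n Cge1 C\<phi>1 R1 k(3)]) (use dims True in \<open>auto simp: k_def R_def\<close>)
      also have "\<dots> \<le> (2 + C\<phi>) * T" using RT C\<phi>1 by (intro mult_left_mono) auto
      finally show ?thesis .
    next
      case False
      have "ln (real n) / real n \<le> 1" using n0 ln_le_minus_one[OF n0] by simp
      also have "\<dots> \<le> real N * (1 / real n)" using False n0 by simp
      also have "\<dots> \<le> real N * R" using R1 by (intro mult_left_mono) auto
      also have "\<dots> \<le> 1 * T" using T(1) by simp
      also have "\<dots> \<le> (2 + C\<phi>) * T" using T0 C\<phi>1 by (intro mult_right_mono) auto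
      finally show ?thesis .
    qed
    have var: "C * (sqrt (real k0) / real n) \<le> T"
    proof -
      have "sqrt (real k0) / real n \<le> sqrt (real k) / real n"
        unfolding k0_def using n0 by (intro divide_right_mono) auto
      then have "C * (sqrt (real k0) / real n) \<le> C * R" using k(3) Cge1 by (intro mult_left_mono) auto
      then show ?thesis using T(2) by linarith
    qed
    have bias: "B k0 \<le> K4 * T"
    proof (cases "k \<le> max_dim c n")
      case True
      then have "B k0 \<le> \<omega> k * L"
        unfolding k0_def B_def F_def using class_bias[OF f _ _ _ k(1)] pos mono L by simp
      also have "\<dots> \<le> R * C" using k(2) cm(2) L R0 by (intro mult_mono) auto
      also have "\<dots> \<le> 1 * T" using T(2) by (simp add: mult.commute)
      also have "\<dots> \<le> K4 * T" using K41 T0 by (intro mult_right_mono) auto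
      finally show ?thesis .
    next
      case False
      have "n < N"
      proof (rule ccontr)
        assume "\<not> n < N"
        then have "sqrt (real k) \<le> sqrt (real (max_dim c n))" using dims by (simp add: k_def)
        then show False using False by simp
      qed
      have "B k0 \<le> C" using B_le[of k0] FC by linarith
      also have "\<dots> \<le> K4 * T" unfolding K4_def T_def
        by (rule excluded_dimension[OF n M _ Cge1 k(3)]) (use False \<open>n < N\<close> in auto)
      finally show ?thesis .
    qed
    have "3 * B k0 + K1 * (C * (sqrt (real k0) / real n)) + 4 * (ln (real n) / real n) + K2 * (C ^ 3 / real n)
      \<le> 3 * (K4 * T) + K1 * T + 4 * ((2 + C\<phi>) * T) + K2 * T"
      using bias lnT mult_left_mono[OF var K10] mult_left_mono[OF T(3) K20] by linarith
    also have "\<dots> = K * T" unfolding K_def by (simp add: algebra_simps)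
    finally show "risk w c \<Delta> \<kappa> n f \<le> ennreal (K * (max (real N) C * opt_rate \<omega> n + C ^ 3 / real n))"
      using risk unfolding T_def R_def by (meson ennreal_leI order_trans)
  qed
qed

end
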